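(* Let $\mathbb{G}$ be a Carnot group, let $p\in[1,+\infty)$ and let $\mathcal{A}_0$ be the class of all bounded open subsets of $\mathbb{G}$. Let $F:L^p_{\mathrm{loc}}(\mathbb{G})\times\mathcal{A}_0\to[0,+\infty]$ be an increasing functional satisfying the following properties: (a) $F$ is local and left-invariant; (b) $F$ is a measure; (c) $F$ is convex and lower semicontinuous; (d) $F(u+c,A)=F(u,A)$ for each $u\in L^p_{\mathrm{loc}}(\mathbb{G})$, $A\in\mathcal{A}_0$ and $c\in\mathbb{R}$; (e) there exist real constants $a,b>0$ such that $$0\le F(u,A)\le\int_A\left(a+b\,|\nabla_{\mathbb{G}}u(x)|^p\right)dx$$ for each $A\in\mathcal{A}_0$ and each $u\in L^p_{\mathrm{loc}}(\mathbb{G})$ with $u|_A\in W^{1,1}_{\mathbb{G},\mathrm{loc}}(A)$. Then there exists a convex function $f:\mathbb{R}^m\to[0,+\infty]$ such that (i) for each $u\in L^p_{\mathrm{loc}}(\mathbb{G})$ and each $A\in\mathcal{A}_0$ with $u|_A\in W^{1,1}_{\mathbb{G},\mathrm{loc}}(A)$ we have $$F(u,A)=\int_A f(\nabla_{\mathbb{G}}u(x))\,dx;$$ (ii) $0\le f(\eta)\le a+b\,|\eta|^p$ for all $\eta\in\mathbb{R}^m$.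
   Context: Carnot group. $\mathbb{G}=(\mathbb{R}^n,\cdot)$ is a connected, simply connected, nilpotent Lie group whose Lie algebra $\mathfrak{g}$ is stratified: $\mathfrak{g}=V_1\oplus\dots\oplus V_k$ with $[V_1,V_i]=V_{i+1}$, $V_k\neq\{0\}$, $V_i=\{0\}$ for $i>k$. $\mathbb{G}$ is identified with $\mathfrak{g}$ through the exponential map (exponential coordinates), and $m:=\dim V_1$. The Lebesgue measure on $\mathbb{R}^n$ is the Haar measure of $\mathbb{G}$. Let $(X_1,\dots,X_m)$ be a fixed basis of $V_1$ made of left-invariant vector fields, and $\nabla_{\mathbb{G}}u:=(X_1u,\dots,X_mu)$ (in the distributional sense) the horizontal gradient. Sobolev spaces. For $\Omega\subset\mathbb{G}$ open and $1\le q<+\infty$, $W^{1,q}_{\mathbb{G}}(\Omega):=\{u\in L^q(\Omega):\nabla_{\mathbb{G}}u\in (L^q(\Omega))^m\}$, and $W^{1,q}_{\mathbb{G},\mathrm{loc}}(\Omega)$ is the set of $u$ belonging to $W^{1,q}_{\mathbb{G}}(\Omega')$ for every open $\Omega'\Subset\Omega$. Translations. For $y\in\mathbb{G}$: $\tau_yu(x):=u(y^{-1}\cdot x)$ for $u\in L^p_{\mathrm{loc}}(\mathbb{G})$, and $\tau_yA:=y\cdot A=\{x: y^{-1}\cdot x\in A\}$ for $A\in\mathcal{A}_0$. Functionals. A functional $F:L^p_{\mathrm{loc}}(\mathbb{G})\times\mathcal{A}_0\to[0,+\infty]$ is: - increasing if $F(u,A)\le F(u,B)$ for every $u\in L^p_{\mathrm{loc}}(\mathbb{G})$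 and $A\subseteq B$ in $\mathcal{A}_0$; - a measure if for every $u\in L^p_{\mathrm{loc}}(\mathbb{G})$ there is a Borel measure $\mu:\mathcal{B}(\mathbb{G})\to[0,+\infty]$ with $F(u,A)=\mu(A)$ for every $A\in\mathcal{A}_0$; - local if $F(u,A)=F(v,A)$ whenever $A\in\mathcal{A}_0$ and $u,v\in L^p_{\mathrm{loc}}(\mathbb{G})$ satisfy $u=v$ a.e. on $A$; - lower semicontinuous (resp. convex) if for every $A\in\mathcal{A}_0$ the map $F(\cdot,A)$ is lower semicontinuous in the $L^p_{\mathrm{loc}}(\mathbb{G})$ topology (resp. convex); - left-invariant if $F(\tau_yu,\tau_yA)=F(u,A)$ for every $y\in\mathbb{G}$, $u\in L^p_{\mathrm{loc}}(\mathbb{G})$, $A\in\mathcal{A}_0$. *)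

theory Defs
  imports "HOL-Analysis.Analysis"
begin

section \<open>Carnot groups in exponential coordinates\<close>

text \<open>\<open>C\<^sup>k\<close> maps between (finite-dimensional) spaces, by recursion on directional derivatives.\<close>

primrec Ck_map :: "nat \<Rightarrow> ('a::euclidean_space \<Rightarrow> 'b::real_normed_vector) \<Rightarrow> bool" where
  "Ck_map 0 f \<longleftrightarrow> continuous_on UNIV f"
| "Ck_map (Suc k) f \<longleftrightarrow>
     (\<forall>x. f differentiable at x) \<and> (\<forall>v. Ck_map k (\<lambda>x. frechet_derivative f (at x) v))"

definition smooth_map :: "('a::euclidean_space \<Rightarrow> 'b::real_normed_vector) \<Rightarrow> bool" where
  "smooth_map f \<longleftrightarrow> (\<forall>k. Ck_map k f)"

text \<open>A vector field on \<open>\<real>\<^sup>n\<close> is a map \<open>\<real>\<^sup>n \<Rightarrow> \<real>\<^sup>n\<close>. It acts on functions as a derivation, and the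
  bracket is the commutator of derivations: \<open>[Y,Z]\<phi> = Y(Z\<phi>) - Z(Y\<phi>)\<close>.\<close>

definition vf_apply :: "('a::real_normed_vector \<Rightarrow> 'a) \<Rightarrow> ('a \<Rightarrow> real) \<Rightarrow> 'a \<Rightarrow> real" where
  "vf_apply Y \<phi> x = frechet_derivative \<phi> (at x) (Y x)"

definition vf_bracket :: "('a::real_normed_vector \<Rightarrow> 'a) \<Rightarrow> ('a \<Rightarrow> 'a) \<Rightarrow> 'a \<Rightarrow> 'a" where
  "vf_bracket Y Z x = frechet_derivative Z (at x) (Y x) - frechet_derivative Y (at x) (Z x)"

text \<open>The Lie algebra of left-invariant vector fields of a group law \<open>mul\<close> with identity \<open>0\<close> is
  identified with the tangent space \<open>\<real>\<^sup>n\<close> at \<open>0\<close>: the vector \<open>v\<close> stands for the left-invariant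
  field with value \<open>v\<close> at \<open>0\<close>.\<close>

definition left_inv_field :: "('a::real_normed_vector \<Rightarrow> 'a \<Rightarrow> 'a) \<Rightarrow> 'a \<Rightarrow> 'a \<Rightarrow> 'a" where
  "left_inv_field mul v x = frechet_derivative (mul x) (at 0) v"

definition lie_bracket :: "('a::real_normed_vector \<Rightarrow> 'a \<Rightarrow> 'a) \<Rightarrow> 'a \<Rightarrow> 'a \<Rightarrow> 'a" where
  "lie_bracket mul v w = vf_bracket (left_inv_field mul v) (left_inv_field mul w) 0"

locale lie_group_on_Rn = group mul 0 minv
  for mul :: "real^'n \<Rightarrow> real^'n \<Rightarrow> real^'n" and minv :: "real^'n \<Rightarrow> real^'n" +
  assumes smooth_mult: "smooth_map (\<lambda>z. mul (fst z) (snd z))"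
    and smooth_inv: "smooth_map minv"

text \<open>Connectedness and simple connectedness are automatic on \<open>\<real>\<^sup>n\<close>, and nilpotency follows from
  the stratification. That the coordinates are exponential means \<open>exp v = v\<close> for all \<open>v\<close>, i.e. the
  one-parameter subgroup with velocity \<open>v\<close> at the identity is \<open>t \<mapsto> t v\<close>. No adapted basis is
  imposed: the layers are arbitrary linear subspaces of \<open>\<real>\<^sup>n\<close>. The value \<open>V 0\<close> plays no role.\<close>

locale carnot_group = lie_group_on_Rn mul minv
  for mul :: "real^'n \<Rightarrow> real^'n \<Rightarrow> real^'n" and minv :: "real^'n \<Rightarrow> real^'n" +
  fixes V :: "nat \<Rightarrow> (real^'n) set" and k :: nat
  assumes exp_coords: "mul (s *\<^sub>R v) (t *\<^sub>R v) = (s + t) *\<^sub>R v"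
    and step_pos: "1 \<le> k"
    and layer_subspace: "1 \<le> i \<Longrightarrow> subspace (V i)"
    and direct_sum: "\<exists>!c. c \<in> (\<Pi>\<^sub>E i\<in>{1..k}. V i) \<and> x = (\<Sum>i=1..k. c i)"
    and bracket_layer: "1 \<le> i \<Longrightarrow>
      span {lie_bracket mul v w | v w. v \<in> V 1 \<and> w \<in> V i} = V (Suc i)"
    and top_layer: "V k \<noteq> {0}"
    and above_top: "i > k \<Longrightarrow> V i = {0}"

definition is_basis_of :: "('m \<Rightarrow> 'a::real_vector) \<Rightarrow> 'a set \<Rightarrow> bool" where
  "is_basis_of X S \<longleftrightarrow> inj X \<and> independent (range X) \<and> span (range X) = S"


section \<open>Lebesgue and Sobolev spaces\<close>

text \<open>Spaces of functions rather than of a.e.-classes.\<close>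

definition Lp :: "real \<Rightarrow> 'a::euclidean_space set \<Rightarrow> ('a \<Rightarrow> real) set" where
  "Lp q \<Omega> = {u. set_borel_measurable lebesgue \<Omega> u \<and>
                 set_integrable lebesgue \<Omega> (\<lambda>x. \<bar>u x\<bar> powr q)}"

definition Lp_loc :: "real \<Rightarrow> 'a::euclidean_space set \<Rightarrow> ('a \<Rightarrow> real) set" where
  "Lp_loc q \<Omega> = {u. \<forall>K. compact K \<and> K \<subseteq> \<Omega> \<longrightarrow> u \<in> Lp q K}"

text \<open>The topology of \<open>L\<^sup>q\<^sub>l\<^sub>o\<^sub>c(\<real>\<^sup>n)\<close> is generated by the balls of the seminorms of \<open>L\<^sup>q(K)\<close>,
  \<open>K\<close> compact.\<close>

definition Lp_seminorm :: "real \<Rightarrow> 'a::euclidean_space set \<Rightarrow> ('a \<Rightarrow> real) \<Rightarrow> real" where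
  "Lp_seminorm q K u = (LINT x:K|lebesgue. \<bar>u x\<bar> powr q) powr (1 / q)"

definition Lp_loc_topology :: "real \<Rightarrow> ('a::euclidean_space \<Rightarrow> real) topology" where
  "Lp_loc_topology q = topology_generated_by
     {{v \<in> Lp_loc q UNIV. Lp_seminorm q K (\<lambda>x. v x - u x) < r} | K u r.
        compact K \<and> u \<in> Lp_loc q UNIV \<and> 0 < r}"

definition test_functions :: "'a::euclidean_space set \<Rightarrow> ('a \<Rightarrow> real) set" where
  "test_functions \<Omega> = {\<phi>. smooth_map \<phi> \<and> compact (closure (support_on UNIV \<phi>)) \<and>
                           closure (support_on UNIV \<phi>) \<subseteq> \<Omega>}"

text \<open>\<open>g\<close> is the derivative of \<open>u\<close> along \<open>Y\<close> in the sense of distributions on \<open>\<Omega>\<close>. The formal adjoint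
  of \<open>Y\<close> is taken to be \<open>-Y\<close>, as for every divergence-free \<open>Y\<close>; left-invariant fields of a Carnot
  group in exponential coordinates are of this kind.\<close>

definition weak_derivative ::
    "('a::euclidean_space \<Rightarrow> 'a) \<Rightarrow> 'a set \<Rightarrow> ('a \<Rightarrow> real) \<Rightarrow> ('a \<Rightarrow> real) \<Rightarrow> bool" where
  "weak_derivative Y \<Omega> u g \<longleftrightarrow> u \<in> Lp_loc 1 \<Omega> \<and> g \<in> Lp_loc 1 \<Omega> \<and>
     (\<forall>\<phi>\<in>test_functions \<Omega>.
        (LINT x:\<Omega>|lebesgue. u x * vf_apply Y \<phi> x) = - (LINT x:\<Omega>|lebesgue. g x * \<phi> x))"

text \<open>In the rest of this section \<open>X j \<in> \<real>\<^sup>n\<close> represents the left-invariant field \<open>X\<^sub>j\<close>.\<close>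

definition is_weak_hgrad ::
    "(real^'n \<Rightarrow> real^'n \<Rightarrow> real^'n) \<Rightarrow> ('m::finite \<Rightarrow> real^'n) \<Rightarrow>
     (real^'n) set \<Rightarrow> (real^'n \<Rightarrow> real) \<Rightarrow> (real^'n \<Rightarrow> real^'m) \<Rightarrow> bool" where
  "is_weak_hgrad mul X \<Omega> u g \<longleftrightarrow>
     (\<forall>j. weak_derivative (left_inv_field mul (X j)) \<Omega> u (\<lambda>x. g x $ j))"

text \<open>A representative of the horizontal gradient on \<open>\<Omega>\<close>, determined a.e. on \<open>\<Omega>\<close> when it exists.\<close>

definition hgrad ::
    "(real^'n \<Rightarrow> real^'n \<Rightarrow> real^'n) \<Rightarrow> ('m::finite \<Rightarrow> real^'n) \<Rightarrow>
     (real^'n) set \<Rightarrow> (real^'n \<Rightarrow> real) \<Rightarrow> real^'n \<Rightarrow> real^'m" where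
  "hgrad mul X \<Omega> u = (SOME g. is_weak_hgrad mul X \<Omega> u g)"

definition sobolev ::
    "(real^'n \<Rightarrow> real^'n \<Rightarrow> real^'n) \<Rightarrow> ('m::finite \<Rightarrow> real^'n) \<Rightarrow>
     real \<Rightarrow> (real^'n) set \<Rightarrow> (real^'n \<Rightarrow> real) set" where
  "sobolev mul X q \<Omega> = {u \<in> Lp q \<Omega>.
     \<exists>g. is_weak_hgrad mul X \<Omega> u g \<and> (\<forall>j. (\<lambda>x. g x $ j) \<in> Lp q \<Omega>)}"

definition sobolev_loc ::
    "(real^'n \<Rightarrow> real^'n \<Rightarrow> real^'n) \<Rightarrow> ('m::finite \<Rightarrow> real^'n) \<Rightarrow>
     real \<Rightarrow> (real^'n) set \<Rightarrow> (real^'n \<Rightarrow> real) set" where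
  "sobolev_loc mul X q \<Omega> = {u. \<forall>\<Omega>'. open \<Omega>' \<and> compact (closure \<Omega>') \<and> closure \<Omega>' \<subseteq> \<Omega> \<longrightarrow>
     u \<in> sobolev mul X q \<Omega>'}"


section \<open>Functionals on \<open>L\<^sup>p\<^sub>l\<^sub>o\<^sub>c \<times> \<A>\<^sub>0\<close>\<close>

text \<open>A functional is a function \<open>F u A\<close> of which only the values with \<open>u \<in> Lp_loc p UNIV\<close> and
  \<open>A \<in> bounded_opens\<close> matter. A local functional depends on the a.e.-class of \<open>u\<close> only.\<close>

type_synonym 'a functional = "('a \<Rightarrow> real) \<Rightarrow> 'a set \<Rightarrow> ennreal"

definition bounded_opens :: "'a::metric_space set set" where
  "bounded_opens = {A. open A \<and> bounded A}"

definition increasing_functional :: "real \<Rightarrow> 'a::euclidean_space functional \<Rightarrow> bool" where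
  "increasing_functional p F \<longleftrightarrow>
     (\<forall>u\<in>Lp_loc p UNIV. \<forall>A\<in>bounded_opens. \<forall>B\<in>bounded_opens. A \<subseteq> B \<longrightarrow> F u A \<le> F u B)"

definition measure_functional :: "real \<Rightarrow> 'a::euclidean_space functional \<Rightarrow> bool" where
  "measure_functional p F \<longleftrightarrow>
     (\<forall>u\<in>Lp_loc p UNIV. \<exists>\<mu>::'a measure. sets \<mu> = sets borel \<and>
        (\<forall>A\<in>bounded_opens. F u A = emeasure \<mu> A))"

definition local_functional :: "real \<Rightarrow> 'a::euclidean_space functional \<Rightarrow> bool" where
  "local_functional p F \<longleftrightarrow>
     (\<forall>A\<in>bounded_opens. \<forall>u\<in>Lp_loc p UNIV. \<forall>v\<in>Lp_loc p UNIV.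
        (AE x in lebesgue. x \<in> A \<longrightarrow> u x = v x) \<longrightarrow> F u A = F v A)"

definition lsc_functional :: "real \<Rightarrow> 'a::euclidean_space functional \<Rightarrow> bool" where
  "lsc_functional p F \<longleftrightarrow>
     (\<forall>A\<in>bounded_opens. \<forall>t. openin (Lp_loc_topology p) {u \<in> Lp_loc p UNIV. t < F u A})"

definition convex_functional :: "real \<Rightarrow> 'a::euclidean_space functional \<Rightarrow> bool" where
  "convex_functional p F \<longleftrightarrow>
     (\<forall>A\<in>bounded_opens. \<forall>u\<in>Lp_loc p UNIV. \<forall>v\<in>Lp_loc p UNIV. \<forall>t\<in>{0..1}.
        F (\<lambda>x. (1 - t) * u x + t * v x) A \<le> ennreal (1 - t) * F u A + ennreal t * F v A)"

definition left_invariant_functional ::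
    "('a \<Rightarrow> 'a \<Rightarrow> 'a) \<Rightarrow> ('a \<Rightarrow> 'a) \<Rightarrow> real \<Rightarrow> 'a::euclidean_space functional \<Rightarrow> bool" where
  "left_invariant_functional mul minv p F \<longleftrightarrow>
     (\<forall>y. \<forall>u\<in>Lp_loc p UNIV. \<forall>A\<in>bounded_opens.
        F (\<lambda>x. u (mul (minv y) x)) (mul y ` A) = F u A)"

text \<open>The library's \<open>convex_on\<close> is for real-valued functions only.\<close>

definition convex_ennreal :: "('a::real_vector \<Rightarrow> ennreal) \<Rightarrow> bool" where
  "convex_ennreal f \<longleftrightarrow>
     (\<forall>\<xi> \<eta>. \<forall>t\<in>{0..1}.
        f ((1 - t) *\<^sub>R \<xi> + t *\<^sub>R \<eta>) \<le> ennreal (1 - t) * f \<xi> + ennreal t * f \<eta>)"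

end

theory Submission
  imports Defs
begin

text \<open>Let \<open>\<ell>\<^sub>\<eta>\<close> be the group homomorphism into \<open>\<real>\<close> with horizontal gradient \<open>\<eta>\<close>. By left invariance and (d),
  \<open>F(\<ell>\<^sub>\<eta>,\<cdot>)\<close> is an invariant measure, so \<open>F(\<ell>\<^sub>\<eta>,A) = f(\<eta>)|A|\<close>. If the gradient of \<open>v\<close> stays within \<open>\<epsilon>\<close> of \<open>\<eta>\<close>
  on \<open>W\<close>, then convexity and the growth condition applied to \<open>\<ell>\<^sub>\<eta> + (v - \<ell>\<^sub>\<eta>)/\<epsilon>\<close>, and symmetrically, give
  \<open>|F(v,W) - f(\<eta>)|W|| \<le> C\<epsilon>|W|\<close>; a Vitali covering then yields the representation for every \<open>v\<close> with a
  continuous gradient. A general \<open>u\<close> is approximated by left convolutions \<open>\<rho> * u\<close>, which are limits of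
  convex combinations of left translates of \<open>u\<close> and satisfy \<open>\<nabla>(\<rho> * u) = \<rho> * \<nabla>u\<close>. Convexity, invariance and
  semicontinuity give \<open>F(\<rho> * u,A') \<le> F(u,A)\<close>, whence one inequality by Fatou's lemma; semicontinuity
  and Jensen's inequality for \<open>f\<close> give the other.

  Two facts about the group have to be extracted from its definition: Lebesgue measure is
  bi-invariant, and linear forms vanishing on \<open>V\<^sub>2 \<oplus> \<dots> \<oplus> V\<^sub>k\<close> are additive. Both follow since the
  differentials of left translations are unipotent for the flag \<open>V\<^sub>i \<oplus> \<dots> \<oplus> V\<^sub>k\<close>.\<close>


section \<open>Smooth maps\<close>

text \<open>What shapes the proof is how little is known about \<open>u\<close>: it is locally
  p-integrable on the whole group, but on \<open>A\<close> its gradient is merely locally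
  integrable. Approximating the gradient in p-norm is out of reach, and the growth condition, whose
  right side may be infinite, is applied only to functions with bounded gradient. The limit passage
  rests on two modes of convergence of the regularised functions: in \<open>L^p\<close> on compact
  sets for the functions, as semicontinuity requires, and only in \<open>L^1\<close> for the
  gradients, enough for a subsequence that converges almost everywhere. Estimates by translation
  lose part of the domain, since the translates of a smaller set have to stay inside
  \<open>A\<close>; both sides being measures, exhausting \<open>A\<close> from inside repairs this.

  The constant \<open>C\<close> is the growth bound at gradients one unit longer than those of the
  comparison function. As no basis adapted to the layers is fixed, the Jacobian of a translation is
  not read off a triangular matrix: conjugation with dilations leaves the determinant unchanged and
  deforms the differential into the identity.\<close>

lemma Ck_map_Suc_D: "Ck_map (Suc k) f \<Longrightarrow> Ck_map k f"
proof (induction k arbitrary: f)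
  case 0
  then have "\<forall>x. f differentiable at x" by simp
  then show ?case
    by (auto simp: continuous_on_eq_continuous_at intro: differentiable_imp_continuous_within)
qed auto

lemma Ck_map_continuous: "Ck_map k f \<Longrightarrow> continuous_on UNIV f"
  by (induction k) (auto dest: Ck_map_Suc_D simp del: Ck_map.simps(2) simp: Ck_map.simps(1))

text \<open>Replaces \<open>frechet_derivative\<close> by an explicit formula for the derivative, so
  that the closure properties below become inductions on the order of differentiability.\<close>

lemma Ck_mapI:
  assumes "\<And>x. (f has_derivative f' x) (at x)" "\<And>v. Ck_map k (\<lambda>x. f' x v)"
  shows "Ck_map (Suc k) f"
proof -
  have "frechet_derivative f (at x) = f' x" for x
    using frechet_derivative_at[OF assms(1)] by simp
  then show ?thesis using assms by (auto simp: differentiable_def)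
qed

lemma Ck_map_has_derivative:
  "Ck_map (Suc k) f \<Longrightarrow> (f has_derivative frechet_derivative f (at x)) (at x)"
  by (simp add: frechet_derivative_works)

lemma Ck_map_const: "Ck_map k (\<lambda>x. c)"
proof (induction k arbitrary: c)
  case (Suc k)
  show ?case by (rule Ck_mapI[where f' = "\<lambda>x v. 0"]) (auto intro: Suc)
qed simp

lemma Ck_map_add:
  assumes "Ck_map k f" "Ck_map k g" shows "Ck_map k (\<lambda>x. f x + g x)"
  using assms
proof (induction k arbitrary: f g)
  case 0
  then show ?case by (auto intro: continuous_intros)
next
  case (Suc k)
  show ?case
    by (rule Ck_mapI[OF has_derivative_add[OF Ck_map_has_derivative[OF Suc(2)] Ck_map_has_derivative[OF Suc(3)]]])
       (use Suc in auto)
qed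

lemma Ck_map_sum:
  assumes "\<And>i. i \<in> I \<Longrightarrow> Ck_map k (f i)" shows "Ck_map k (\<lambda>x. \<Sum>i\<in>I. f i x)"
  using assms by (induction I rule: infinite_finite_induct) (auto intro: Ck_map_const Ck_map_add)

lemma Ck_map_bilinear:
  assumes "bounded_bilinear B" "Ck_map k f" "Ck_map k g"
  shows "Ck_map k (\<lambda>x. B (f x) (g x))"
  using assms(2,3)
proof (induction k arbitrary: f g)
  case 0
  then show ?case by (auto intro: bounded_bilinear.continuous_on[OF assms(1)])
next
  case (Suc k)
  show ?case
  proof (rule Ck_mapI[OF bounded_bilinear.FDERIV[OF assms(1) Ck_map_has_derivative[OF Suc(2)] Ck_map_has_derivative[OF Suc(3)]]])
    fix v
    show "Ck_map k (\<lambda>x. B (f x) (frechet_derivative g (at x) v) + B (frechet_derivative f (at x) v) (g x))"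
      using Suc(2,3) by (intro Ck_map_add Suc.IH) (auto intro: Ck_map_Suc_D)
  qed
qed

lemma Ck_map_bounded_linear:
  assumes "bounded_linear L" shows "Ck_map k L"
proof (cases k)
  case 0
  then show ?thesis using assms by (simp add: linear_continuous_on)
next
  case (Suc j)
  show ?thesis unfolding Suc
    by (rule Ck_mapI[OF bounded_linear_imp_has_derivative[OF assms]]) (rule Ck_map_const)
qed

text \<open>The recursion in \<open>Ck_map\<close> only sees derivatives in a fixed direction. A
  derivative in a direction that varies with the point becomes, by this expansion, a finite sum of
  coefficients times derivatives in fixed directions.\<close>

lemma derivative_basis_sum:
  fixes v :: "'a::euclidean_space"
  assumes "linear f"
  shows "f v = (\<Sum>b\<in>Basis. (v \<bullet> b) *\<^sub>R f b)"
proof -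
  have "f v = f (\<Sum>b\<in>Basis. (v \<bullet> b) *\<^sub>R b)" by (simp add: euclidean_representation)
  also have "\<dots> = (\<Sum>b\<in>Basis. (v \<bullet> b) *\<^sub>R f b)"
    using assms by (simp add: linear_sum linear_cmul o_def)
  finally show ?thesis .
qed

lemma Ck_map_compose:
  fixes f :: "'b::euclidean_space \<Rightarrow> 'c::real_normed_vector" and g :: "'a::euclidean_space \<Rightarrow> 'b"
  assumes "Ck_map k f" "Ck_map k g"
  shows "Ck_map k (\<lambda>x. f (g x))"
  using assms
proof (induction k arbitrary: f)
  case 0
  then show ?case using continuous_on_compose[of UNIV g f] continuous_on_subset by (auto simp: o_def)
next
  case (Suc k)
  have d: "((\<lambda>x. f (g x)) has_derivative (\<lambda>v. frechet_derivative f (at (g x)) (frechet_derivative g (at x) v))) (at x)" for x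
    using diff_chain_at[OF Ck_map_has_derivative[OF Suc(3)] Ck_map_has_derivative[OF Suc(2)]]
    by (simp add: o_def)
  have e: "frechet_derivative f (at (g x)) (frechet_derivative g (at x) v) =
     (\<Sum>b\<in>Basis. (frechet_derivative g (at x) v \<bullet> b) *\<^sub>R frechet_derivative f (at (g x)) b)" for x v
    by (rule derivative_basis_sum) (use Ck_map_has_derivative[OF Suc(2)] has_derivative_linear in blast)
  show ?case
  proof (rule Ck_mapI[OF d])
    fix v
    show "Ck_map k (\<lambda>x. frechet_derivative f (at (g x)) (frechet_derivative g (at x) v))"
      unfolding e
    proof (intro Ck_map_sum Ck_map_bilinear[OF bounded_bilinear_scaleR])
      fix b :: 'b assume "b \<in> Basis"
      show "Ck_map k (\<lambda>x. frechet_derivative g (at x) v \<bullet> b)"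
        by (rule Ck_map_bilinear[OF bounded_bilinear_inner]) (use Suc(3) Ck_map_const in auto)
      show "Ck_map k (\<lambda>x. frechet_derivative f (at (g x)) b)"
        by (rule Suc.IH) (use Suc(2,3) Ck_map_Suc_D in auto)
    qed
  qed
qed

lemma smooth_map_continuous: "smooth_map f \<Longrightarrow> continuous_on UNIV f"
  unfolding smooth_map_def using Ck_map_continuous by blast

lemma smooth_map_has_derivative:
  "smooth_map f \<Longrightarrow> (f has_derivative frechet_derivative f (at x)) (at x)"
  unfolding smooth_map_def using Ck_map_has_derivative by blast

lemma smooth_map_derivative: "smooth_map f \<Longrightarrow> smooth_map (\<lambda>x. frechet_derivative f (at x) v)"
  unfolding smooth_map_def by (metis Ck_map.simps(2))

lemma smooth_map_const: "smooth_map (\<lambda>x. c)"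
  by (simp add: smooth_map_def Ck_map_const)

lemma smooth_map_add: "smooth_map f \<Longrightarrow> smooth_map g \<Longrightarrow> smooth_map (\<lambda>x. f x + g x)"
  by (simp add: smooth_map_def Ck_map_add)

lemma smooth_map_sum: "(\<And>i. i \<in> I \<Longrightarrow> smooth_map (f i)) \<Longrightarrow> smooth_map (\<lambda>x. \<Sum>i\<in>I. f i x)"
  by (simp add: smooth_map_def Ck_map_sum)

lemma smooth_map_bilinear:
  "bounded_bilinear B \<Longrightarrow> smooth_map f \<Longrightarrow> smooth_map g \<Longrightarrow> smooth_map (\<lambda>x. B (f x) (g x))"
  by (simp add: smooth_map_def Ck_map_bilinear)

lemmas smooth_map_scaleR = smooth_map_bilinear[OF bounded_bilinear_scaleR]
lemmas smooth_map_mult = smooth_map_bilinear[OF bounded_bilinear_mult]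
lemmas smooth_map_inner = smooth_map_bilinear[OF bounded_bilinear_inner]

lemma smooth_map_bounded_linear: "bounded_linear L \<Longrightarrow> smooth_map L"
  by (simp add: smooth_map_def Ck_map_bounded_linear)

lemma smooth_map_compose:
  fixes f :: "'b::euclidean_space \<Rightarrow> 'c::real_normed_vector" and g :: "'a::euclidean_space \<Rightarrow> 'b"
  shows "smooth_map f \<Longrightarrow> smooth_map g \<Longrightarrow> smooth_map (\<lambda>x. f (g x))"
  by (simp add: smooth_map_def Ck_map_compose)

lemma smooth_map_Pair:
  fixes f :: "'a::euclidean_space \<Rightarrow> 'b::euclidean_space" and g :: "'a \<Rightarrow> 'c::euclidean_space"
  assumes "smooth_map f" "smooth_map g"
  shows "smooth_map (\<lambda>x. (f x, g x))"
proof -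
  have "smooth_map (\<lambda>x. (\<lambda>y. (y, 0)) (f x) + (\<lambda>y. (0, y)) (g x))"
    by (rule smooth_map_add[OF smooth_map_compose smooth_map_compose])
       (rule smooth_map_bounded_linear assms bounded_linear_Pair bounded_linear_ident bounded_linear_zero)+
  then show ?thesis by simp
qed

lemma smooth_map_derivative_apply:
  fixes f :: "'b::euclidean_space \<Rightarrow> 'c::real_normed_vector" and g h :: "'a::euclidean_space \<Rightarrow> 'b"
  assumes "smooth_map f" "smooth_map g" "smooth_map h"
  shows "smooth_map (\<lambda>x. frechet_derivative f (at (g x)) (h x))"
proof -
  have e: "frechet_derivative f (at (g x)) (h x) =
     (\<Sum>b\<in>Basis. (h x \<bullet> b) *\<^sub>R frechet_derivative f (at (g x)) b)" for x
    by (rule derivative_basis_sum) (use smooth_map_has_derivative[OF assms(1)] has_derivative_linear in blast)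
  show ?thesis unfolding e
    by (rule smooth_map_sum, rule smooth_map_scaleR, rule smooth_map_inner, rule assms, rule smooth_map_const,
        rule smooth_map_compose[OF smooth_map_derivative[OF assms(1)] assms(2)])
qed

section \<open>Symmetry of second derivatives\<close>

text \<open>Schwarz's theorem by second differences: two applications of the mean value theorem
  write \<Delta>(s) as s^2 times a mixed derivative at a point tending to \<open>a\<close> with s,
  and \<Delta> does not depend on the order of \<open>v\<close> and \<open>w\<close>.\<close>

lemma symmetric_second_derivative_real:
  fixes f :: "'a::euclidean_space \<Rightarrow> real"
  assumes f: "smooth_map f"
  shows "frechet_derivative (\<lambda>x. frechet_derivative f (at x) v) (at a) w =
         frechet_derivative (\<lambda>x. frechet_derivative f (at x) w) (at a) v"
proof -
  define D where "D = (\<lambda>v w x. frechet_derivative (\<lambda>x. frechet_derivative f (at x) v) (at x) w)"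
  define \<Delta> where "\<Delta> = (\<lambda>s. f (a + s *\<^sub>R v + s *\<^sub>R w) - f (a + s *\<^sub>R v) - f (a + s *\<^sub>R w) + f a)"
  have cD: "continuous_on UNIV (D v w)" for v w
    unfolding D_def by (intro smooth_map_continuous smooth_map_derivative f)
  have der: "((\<lambda>r. g (c + r *\<^sub>R u)) has_real_derivative frechet_derivative g (at (c + r *\<^sub>R u)) u) (at r)"
    if "smooth_map g" for g :: "'a \<Rightarrow> real" and c u r
  proof -
    have "((\<lambda>r. c + r *\<^sub>R u) has_derivative (\<lambda>h. h *\<^sub>R u)) (at r)"
      by (auto intro!: derivative_eq_intros)
    from diff_chain_at[OF this smooth_map_has_derivative[OF that]]
    have "((\<lambda>r. g (c + r *\<^sub>R u)) has_derivative (\<lambda>h. frechet_derivative g (at (c + r *\<^sub>R u)) (h *\<^sub>R u))) (at r)"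
      by (simp add: o_def)
    moreover have "frechet_derivative g (at (c + r *\<^sub>R u)) (h *\<^sub>R u) = frechet_derivative g (at (c + r *\<^sub>R u)) u * h" for h
      using linear_cmul[OF has_derivative_linear[OF smooth_map_has_derivative[OF that]]] by simp
    ultimately show ?thesis by (simp add: has_field_derivative_def)
  qed
  \<comment> \<open>Quantified over \<open>v\<close> and \<open>w\<close> afresh, so that it also
    serves with the two exchanged.\<close>
  have key: "\<exists>\<xi> \<zeta>. 0 < \<xi> \<and> \<xi> < s \<and> 0 < \<zeta> \<and> \<zeta> < s \<and>
      f (a + s *\<^sub>R v + s *\<^sub>R w) - f (a + s *\<^sub>R v) - f (a + s *\<^sub>R w) + f a = s * (s * D v w (a + \<xi> *\<^sub>R v + \<zeta> *\<^sub>R w))"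
    if s: "s > 0" for s v w
  proof -
    have "\<exists>\<xi>. 0 < \<xi> \<and> \<xi> < s \<and> (\<lambda>r. f (a + s *\<^sub>R w + r *\<^sub>R v) - f (a + r *\<^sub>R v)) s - (\<lambda>r. f (a + s *\<^sub>R w + r *\<^sub>R v) - f (a + r *\<^sub>R v)) 0
       = (s - 0) * (frechet_derivative f (at (a + s *\<^sub>R w + \<xi> *\<^sub>R v)) v - frechet_derivative f (at (a + \<xi> *\<^sub>R v)) v)"
      by (rule MVT2[OF s]) (intro DERIV_diff der f)
    then obtain \<xi> where \<xi>: "0 < \<xi>" "\<xi> < s" and 1: "f (a + s *\<^sub>R w + s *\<^sub>R v) - f (a + s *\<^sub>R v) - f (a + s *\<^sub>R w) + f a =
        s * (frechet_derivative f (at (a + s *\<^sub>R w + \<xi> *\<^sub>R v)) v - frechet_derivative f (at (a + \<xi> *\<^sub>R v)) v)"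
      by auto
    have "\<exists>\<zeta>. 0 < \<zeta> \<and> \<zeta> < s \<and> (\<lambda>r. frechet_derivative f (at (a + \<xi> *\<^sub>R v + r *\<^sub>R w)) v) s - (\<lambda>r. frechet_derivative f (at (a + \<xi> *\<^sub>R v + r *\<^sub>R w)) v) 0
       = (s - 0) * D v w (a + \<xi> *\<^sub>R v + \<zeta> *\<^sub>R w)"
      unfolding D_def by (rule MVT2[OF s]) (intro der smooth_map_derivative f)
    then obtain \<zeta> where \<zeta>: "0 < \<zeta>" "\<zeta> < s" and 2: "frechet_derivative f (at (a + \<xi> *\<^sub>R v + s *\<^sub>R w)) v - frechet_derivative f (at (a + \<xi> *\<^sub>R v)) v
       = s * D v w (a + \<xi> *\<^sub>R v + \<zeta> *\<^sub>R w)" by auto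
    show ?thesis
      using \<xi> \<zeta> 1 2 by (intro exI[of _ \<xi>] exI[of _ \<zeta>]) (simp add: algebra_simps)
  qed
  have lim: "((\<lambda>s. \<Delta> s / s\<^sup>2) \<longlongrightarrow> D v w a) (at_right 0)"
    if \<Delta>: "\<And>s. \<Delta> s = f (a + s *\<^sub>R v + s *\<^sub>R w) - f (a + s *\<^sub>R v) - f (a + s *\<^sub>R w) + f a" for v w
  proof -
    have "\<forall>s\<in>{0<..}. \<exists>p. 0 < fst p \<and> fst p < s \<and> 0 < snd p \<and> snd p < s \<and> \<Delta> s / s\<^sup>2 = D v w (a + fst p *\<^sub>R v + snd p *\<^sub>R w)"
      using key[of _ v w] unfolding \<Delta> by (fastforce simp: power2_eq_square)
    then obtain q where q: "\<And>s. s > 0 \<Longrightarrow> 0 < fst (q s) \<and> fst (q s) < s \<and> 0 < snd (q s) \<and> snd (q s) < s \<and> \<Delta> s / s\<^sup>2 = D v w (a + fst (q s) *\<^sub>R v + snd (q s) *\<^sub>R w)"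
      by (metis greaterThan_iff bchoice)
    have z: "((\<lambda>s::real. s) \<longlongrightarrow> 0) (at_right 0)" by (rule tendsto_ident_at)
    have ev: "eventually (\<lambda>s::real. 0 < s) (at_right 0)" by (simp add: eventually_at_right_less)
    have f0: "((\<lambda>s. fst (q s)) \<longlongrightarrow> 0) (at_right 0)"
      by (rule tendsto_sandwich[OF _ _ tendsto_const z]; rule eventually_mono[OF ev]) (use q in \<open>force simp: less_imp_le\<close>)+
    have s0: "((\<lambda>s. snd (q s)) \<longlongrightarrow> 0) (at_right 0)"
      by (rule tendsto_sandwich[OF _ _ tendsto_const z]; rule eventually_mono[OF ev]) (use q in \<open>force simp: less_imp_le\<close>)+
    have "((\<lambda>s. a + fst (q s) *\<^sub>R v + snd (q s) *\<^sub>R w) \<longlongrightarrow> a + 0 *\<^sub>R v + 0 *\<^sub>R w) (at_right 0)"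
      by (intro tendsto_intros f0 s0)
    then have "((\<lambda>s. D v w (a + fst (q s) *\<^sub>R v + snd (q s) *\<^sub>R w)) \<longlongrightarrow> D v w a) (at_right 0)"
      using continuous_on_tendsto_compose[OF cD] by auto
    then show ?thesis
      by (rule Lim_transform_eventually) (rule eventually_mono[OF ev], use q in metis)
  qed
  have "D v w a = D w v a"
  proof (rule tendsto_unique)
    show "((\<lambda>s. \<Delta> s / s\<^sup>2) \<longlongrightarrow> D v w a) (at_right 0)"
      by (rule lim) (simp add: \<Delta>_def)
    have "\<Delta> s = f (a + s *\<^sub>R w + s *\<^sub>R v) - f (a + s *\<^sub>R w) - f (a + s *\<^sub>R v) + f a" for s
      by (simp add: \<Delta>_def add_ac)
    then show "((\<lambda>s. \<Delta> s / s\<^sup>2) \<longlongrightarrow> D w v a) (at_right 0)"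
      by (rule lim)
  qed simp
  then show ?thesis by (simp add: D_def)
qed

lemma frechet_derivative_inner_left:
  fixes f :: "'a::euclidean_space \<Rightarrow> 'b::euclidean_space"
  assumes "smooth_map f"
  shows "frechet_derivative (\<lambda>x. f x \<bullet> e) (at x) v = frechet_derivative f (at x) v \<bullet> e"
proof -
  have "((\<lambda>x. f x \<bullet> e) has_derivative (\<lambda>v. frechet_derivative f (at x) v \<bullet> e)) (at x)"
    by (rule has_derivative_inner_left) (rule smooth_map_has_derivative[OF assms])
  from frechet_derivative_at[OF this] show ?thesis by metis
qed

lemma symmetric_second_derivative:
  fixes f :: "'a::euclidean_space \<Rightarrow> 'b::euclidean_space"
  assumes f: "smooth_map f"
  shows "frechet_derivative (\<lambda>x. frechet_derivative f (at x) v) (at a) w =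
         frechet_derivative (\<lambda>x. frechet_derivative f (at x) w) (at a) v"
proof (rule euclidean_eqI)
  fix e :: 'b assume "e \<in> Basis"
  have "smooth_map (\<lambda>x. f x \<bullet> e)" by (intro smooth_map_inner f smooth_map_const)
  from symmetric_second_derivative_real[OF this, of v a w]
  show "frechet_derivative (\<lambda>x. frechet_derivative f (at x) v) (at a) w \<bullet> e =
         frechet_derivative (\<lambda>x. frechet_derivative f (at x) w) (at a) v \<bullet> e"
    by (simp add: frechet_derivative_inner_left f smooth_map_derivative)
qed

section \<open>The adjoint representation and the differential of left translations\<close>

context carnot_group
begin

text \<open>\<open>exp_coords\<close> with the parameters 1 and -1: \<open>x\<close> and
  \<open>- x\<close> lie on one one-parameter subgroup, and their product is 0.\<close>

lemma minv_eq: "minv x = - x"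
  using exp_coords[of 1 x "-1"] by (metis add.right_inverse inverse_unique scaleR_minus1_left scaleR_one scaleR_zero_left)

lemma mul_0 [simp]: "mul 0 x = x" "mul x 0 = x"
  by (simp_all add: group_left_neutral)

lemma mul_neg [simp]: "mul (- x) x = 0" "mul x (- x) = 0"
  using left_inverse[of x] right_inverse[of x] by (simp_all add: minv_eq)

lemma mul_neg_cancel [simp]: "mul (- x) (mul x y) = y" "mul x (mul (- x) y) = y"
  "mul (mul y x) (- x) = y" "mul (mul y (- x)) x = y"
  by (metis assoc mul_0 mul_neg)+

lemma neg_mul: "- mul x y = mul (- y) (- x)"
proof -
  have "mul (mul x y) (mul (- y) (- x)) = 0" by (metis assoc mul_neg_cancel(2) mul_neg(2))
  then show ?thesis by (metis mul_neg_cancel(1) mul_0(2))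
qed

abbreviation M where "M \<equiv> (\<lambda>z. mul (fst z) (snd z))"

abbreviation DM where "DM z \<equiv> frechet_derivative M (at z)"

definition DL where "DL x y = frechet_derivative (mul x) (at y)"

lemma smooth_map_mul:
  fixes f g :: "'c::euclidean_space \<Rightarrow> real^'n"
  assumes "smooth_map f" "smooth_map g" shows "smooth_map (\<lambda>x. mul (f x) (g x))"
  using smooth_map_compose[OF smooth_mult smooth_map_Pair[OF assms]] by simp

lemma smooth_map_mul_left: "smooth_map (mul x)"
  by (rule smooth_map_mul[OF smooth_map_const smooth_map_bounded_linear[OF bounded_linear_ident]])

lemma has_derivative_mul:
  assumes "(f has_derivative f') (at x)" "(g has_derivative g') (at x)"
  shows "((\<lambda>x. mul (f x) (g x)) has_derivative (\<lambda>h. DM (f x, g x) (f' h, g' h))) (at x)"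
  using diff_chain_at[OF has_derivative_Pair[OF assms] smooth_map_has_derivative[OF smooth_mult]]
  by (simp add: o_def)

lemma linear_DM: "linear (DM z)"
  by (rule has_derivative_linear[OF smooth_map_has_derivative[OF smooth_mult]])

lemma DM_add: "DM z (h, l) = DM z (h, 0) + DM z (0, l)"
  using linear_add[OF linear_DM, of z "(h,0)" "(0,l)"] by simp

lemma has_derivative_mul_left: "(mul x has_derivative DL x y) (at y)"
  unfolding DL_def by (rule smooth_map_has_derivative[OF smooth_map_mul_left])

lemma linear_DL: "linear (DL x y)"
  by (rule has_derivative_linear[OF has_derivative_mul_left])

lemma DL_DM: "DL x y l = DM (x, y) (0, l)"
proof -
  have "(mul x has_derivative (\<lambda>l. DM (x, y) (0, l))) (at y)"
    by (rule has_derivative_mul) (auto intro!: derivative_eq_intros)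
  from has_derivative_unique[OF this has_derivative_mul_left] show ?thesis by metis
qed

lemma has_derivative_mul_right: "((\<lambda>x. mul x y) has_derivative (\<lambda>h. DM (x, y) (h, 0))) (at x)"
  by (rule has_derivative_mul) (auto intro!: derivative_eq_intros)

lemma DL_0 [simp]: "DL 0 y h = h"
proof -
  have "mul 0 = (\<lambda>x. x)" by auto
  then have "(mul 0 has_derivative (\<lambda>h. h)) (at y)" by simp
  from has_derivative_unique[OF this has_derivative_mul_left] show ?thesis by metis
qed

lemma DM_right_0 [simp]: "DM (x, 0) (h, 0) = h"
proof -
  have "((\<lambda>x. mul x 0) has_derivative (\<lambda>h. h)) (at x)" by simp
  from has_derivative_unique[OF this has_derivative_mul_right] show ?thesis by metis
qed

lemma DM_left_0 [simp]: "DM (0, x) (0, h) = h"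
  using DL_DM[of 0 x h] by simp

lemma DL_chain: "DL (mul x y) z h = DL x (mul y z) (DL y z h)"
proof -
  have "mul (mul x y) = (\<lambda>z. mul x (mul y z))" by (simp add: assoc fun_eq_iff)
  moreover have "((\<lambda>z. mul x (mul y z)) has_derivative (\<lambda>h. DL x (mul y z) (DL y z h))) (at z)"
    using diff_chain_at[OF has_derivative_mul_left has_derivative_mul_left] by (simp add: o_def)
  ultimately show ?thesis using has_derivative_unique[OF _ has_derivative_mul_left, of "mul x y"] by metis
qed

lemma DL_inverse: "DL (- x) x (DL x 0 h) = h" "DL x 0 (DL (- x) x h) = h"
  using DL_chain[of "-x" x 0 h] DL_chain[of x "-x" x h] by simp_all

definition Ad where "Ad x w = frechet_derivative (\<lambda>z. mul (mul x z) (- x)) (at 0) w"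

lemma smooth_map_conj: "smooth_map (\<lambda>z. mul (mul x z) (- x))"
  by (rule smooth_map_mul[OF smooth_map_mul_left smooth_map_const])

lemma has_derivative_conj: "((\<lambda>z. mul (mul x z) (- x)) has_derivative Ad x) (at 0)"
  using smooth_map_has_derivative[OF smooth_map_conj, of x 0] by (simp add: Ad_def[abs_def])

lemma linear_Ad: "linear (Ad x)"
  by (rule has_derivative_linear[OF has_derivative_conj])

lemma Ad_0 [simp]: "Ad 0 w = w"
proof -
  have "((\<lambda>z. mul (mul 0 z) (- 0)) has_derivative (\<lambda>h. h)) (at 0)" by simp
  from has_derivative_unique[OF this has_derivative_conj] show ?thesis by metis
qed

lemma Ad_mul: "Ad (mul x y) w = Ad x (Ad y w)"
proof -
  have "(\<lambda>z. mul (mul (mul x y) z) (- mul x y)) = (\<lambda>z. mul (mul x (mul (mul y z) (- y))) (- x))"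
    by (simp add: neg_mul assoc)
  moreover have "((\<lambda>z. mul (mul x (mul (mul y z) (- y))) (- x)) has_derivative (\<lambda>w. Ad x (Ad y w))) (at 0)"
    using diff_chain_at[OF has_derivative_conj[of y], of "\<lambda>z. mul (mul x z) (- x)" "Ad x"] has_derivative_conj[of x]
    by (simp add: o_def)
  ultimately show ?thesis using has_derivative_unique[OF _ has_derivative_conj, of "mul x y"] by metis
qed

lemma smooth_map_Ad: "smooth_map (\<lambda>x. Ad x w)"
proof -
  \<comment> \<open>Conjugation as a jointly smooth function of both variables, which makes
    \<open>Ad x w\<close> a directional derivative of one fixed map.\<close>
  define c where "c = (\<lambda>z. mul (M z) (- fst z))"
  have c: "smooth_map c" unfolding c_def
    by (rule smooth_map_mul[OF smooth_mult]) (intro smooth_map_bounded_linear bounded_linear_minus bounded_linear_fst)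
  have "Ad x w = frechet_derivative c (at (x, 0)) (0, w)" for x
  proof -
    have "((\<lambda>z. (x, z)) has_derivative (\<lambda>z. (0, z))) (at (0::real^'n))"
      by (auto intro!: derivative_eq_intros)
    from diff_chain_at[OF this smooth_map_has_derivative[OF c]]
    have "((\<lambda>z. mul (mul x z) (- x)) has_derivative (\<lambda>w. frechet_derivative c (at (x, 0)) (0, w))) (at 0)"
      by (simp add: o_def c_def)
    from has_derivative_unique[OF this has_derivative_conj] show ?thesis by metis
  qed
  then show ?thesis
    using smooth_map_derivative_apply[OF c, of "\<lambda>x. (x, 0)" "\<lambda>x. (0, w)"]
    by (simp add: smooth_map_const smooth_map_bounded_linear bounded_linear_Pair bounded_linear_ident bounded_linear_zero)
qed

abbreviation br where "br \<equiv> lie_bracket mul"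

lemma left_inv_field_DL: "left_inv_field mul w x = DL x 0 w"
  by (simp add: left_inv_field_def DL_def)

text \<open>Differentiating \<open>x\<cdot>z = (x\<cdot>z\<cdot>x\<^sup>-\<^sup>1)\<cdot>x\<close> once in \<open>z\<close> and once in \<open>x\<close>; the two mixed second derivatives
  of the product combine to the bracket.\<close>

lemma has_derivative_Ad: "((\<lambda>x. Ad x w) has_derivative (\<lambda>v. br v w)) (at 0)"
proof -
  \<comment> \<open>\<open>A w\<close> and \<open>R w\<close> are the left-invariant and the
    right-invariant field with value \<open>w\<close> at 0.\<close>
  define A where "A = (\<lambda>w x. DM (x, 0) (0, w))"
  define R where "R = (\<lambda>w x. DM (0, x) (w, 0))"
  define D where "D = frechet_derivative (\<lambda>x. Ad x w) (at 0)"
  have D: "((\<lambda>x. Ad x w) has_derivative D) (at 0)"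
    unfolding D_def by (rule smooth_map_has_derivative[OF smooth_map_Ad])
  have A: "left_inv_field mul w = A w" for w
    by (simp add: fun_eq_iff left_inv_field_DL DL_DM A_def)
  have dA: "(A w has_derivative (\<lambda>v. frechet_derivative (\<lambda>z. DM z (0, w)) (at (0,0)) (v, 0))) (at 0)" for w
  proof -
    have "((\<lambda>x. (x, 0)) has_derivative (\<lambda>x. (x, 0))) (at (0::real^'n))"
      by (auto intro!: derivative_eq_intros)
    from diff_chain_at[OF this smooth_map_has_derivative[OF smooth_map_derivative[OF smooth_mult, of "(0, w)"]]]
    show ?thesis by (simp add: o_def A_def)
  qed
  \<comment> \<open>Both sides are the mixed second derivative of the product at
    \<open>(0,0)\<close> along \<open>(w,0)\<close> and \<open>(0,v)\<close>.\<close>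
  have dR: "(R w has_derivative (\<lambda>v. frechet_derivative (A v) (at 0) w)) (at 0)" for w
  proof -
    have "((\<lambda>x. (0, x)) has_derivative (\<lambda>x. (0, x))) (at (0::real^'n))"
      by (auto intro!: derivative_eq_intros)
    from diff_chain_at[OF this smooth_map_has_derivative[OF smooth_map_derivative[OF smooth_mult, of "(w, 0)"]]]
    have "(R w has_derivative (\<lambda>v. frechet_derivative (\<lambda>z. DM z (w, 0)) (at (0,0)) (0, v))) (at 0)"
      by (simp add: o_def R_def)
    moreover have "frechet_derivative (\<lambda>z. DM z (w, 0)) (at (0,0)) (0, v) = frechet_derivative (A v) (at 0) w" for v
      using symmetric_second_derivative[OF smooth_mult, of "(w,0)" "(0,0)" "(0,v)"]
        fun_cong[OF frechet_derivative_at[OF dA[of v]], of w] by simp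
    ultimately show ?thesis by simp
  qed
  have AR: "A w x = R (Ad x w) x" for w x
  proof -
    have "((\<lambda>z. mul (mul (mul x z) (- x)) x) has_derivative (\<lambda>w. R (Ad x w) x)) (at 0)"
      using diff_chain_at[OF has_derivative_conj has_derivative_mul_right, of x x] by (simp add: o_def R_def)
    then have "(mul x has_derivative (\<lambda>w. R (Ad x w) x)) (at 0)" by simp
    from has_derivative_unique[OF this has_derivative_mul_left] show ?thesis by (metis A_def DL_DM)
  qed
  \<comment> \<open>Both arguments in \<open>R (Ad x w) x\<close> move with \<open>x\<close>;
    linearity in the first one separates them for the product rule.\<close>
  have R_sum: "R u x = (\<Sum>b\<in>Basis. (u \<bullet> b) *\<^sub>R R b x)" for u x
  proof (rule derivative_basis_sum)
    have "R = (\<lambda>u x. DM (0, x) (u, 0))" by (simp add: R_def)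
    then show "linear (\<lambda>u. R u x)"
      using has_derivative_linear[OF has_derivative_mul_right] by simp
  qed
  have "A w = (\<lambda>x. \<Sum>b\<in>Basis. (Ad x w \<bullet> b) *\<^sub>R R b x)"
    using AR R_sum by metis
  moreover have "((\<lambda>x. \<Sum>b\<in>Basis. (Ad x w \<bullet> b) *\<^sub>R R b x) has_derivative
      (\<lambda>v. \<Sum>b\<in>Basis. (Ad 0 w \<bullet> b) *\<^sub>R frechet_derivative (A v) (at 0) b + (D v \<bullet> b) *\<^sub>R R b 0)) (at 0)"
    by (intro has_derivative_sum has_derivative_scaleR has_derivative_inner_left D dR)
  ultimately have "(A w has_derivative
      (\<lambda>v. \<Sum>b\<in>Basis. (Ad 0 w \<bullet> b) *\<^sub>R frechet_derivative (A v) (at 0) b + (D v \<bullet> b) *\<^sub>R R b 0)) (at 0)"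
    by simp
  from fun_cong[OF frechet_derivative_at[OF this]] have "frechet_derivative (A w) (at 0) v =
      (\<Sum>b\<in>Basis. (Ad 0 w \<bullet> b) *\<^sub>R frechet_derivative (A v) (at 0) b + (D v \<bullet> b) *\<^sub>R R b 0)" for v
    by simp
  moreover have "(\<Sum>b\<in>Basis. (Ad 0 w \<bullet> b) *\<^sub>R frechet_derivative (A v) (at 0) b) = frechet_derivative (A v) (at 0) w" for v
    using derivative_basis_sum[of "frechet_derivative (A v) (at 0)" w] has_derivative_linear[OF dA[of v]]
      frechet_derivative_at[OF dA[of v]] by simp
  moreover have "(\<Sum>b\<in>Basis. (D v \<bullet> b) *\<^sub>R R b 0) = D v" for v
    by (simp add: R_def euclidean_representation)
  moreover have "br v w = frechet_derivative (A w) (at 0) v - frechet_derivative (A v) (at 0) w" for v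
    unfolding lie_bracket_def vf_bracket_def A by (simp add: A_def)
  ultimately have "D v = br v w" for v by (simp add: sum.distrib)
  then show ?thesis using D by presburger
qed

lemma br_antisym: "br v w = - br w v"
  by (simp add: lie_bracket_def vf_bracket_def)

lemma linear_br_left: "linear (\<lambda>v. br v w)"
  by (rule has_derivative_linear[OF has_derivative_Ad])

lemma linear_br_right: "linear (br v)"
proof -
  have "br v = (\<lambda>w. - br w v)" using br_antisym by blast
  then show ?thesis using linear_compose_neg[OF linear_br_left[of v]] by simp
qed

lemma bounded_bilinear_br: "bounded_bilinear br"
  using linear_br_left linear_br_right bilinear_conv_bounded_bilinear bilinear_def by blast

lemma Ad_curve_0: "((\<lambda>s. Ad (s *\<^sub>R x) w) has_vector_derivative br x w) (at 0)"
proof -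
  have "((\<lambda>s. s *\<^sub>R x) has_derivative (\<lambda>s. s *\<^sub>R x)) (at 0)"
    by (auto intro!: derivative_eq_intros)
  from diff_chain_at[OF this] has_derivative_Ad[of w]
  have "((\<lambda>s. Ad (s *\<^sub>R x) w) has_derivative (\<lambda>s. br (s *\<^sub>R x) w)) (at 0)" by (simp add: o_def)
  then show ?thesis
    using linear_cmul[OF linear_br_left] by (simp add: has_vector_derivative_def)
qed

lemma has_vector_derivative_shift:
  fixes f :: "real \<Rightarrow> 'c::real_normed_vector"
  assumes "((\<lambda>s. f (t + s)) has_vector_derivative d) (at 0)"
  shows "(f has_vector_derivative d) (at t)"
proof -
  have "((\<lambda>r. r - t) has_vector_derivative 1) (at t)" by (auto intro!: derivative_eq_intros)
  from vector_diff_chain_at[OF this, of "\<lambda>s. f (t + s)" d] assms show ?thesis by (simp add: o_def)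
qed

text \<open>In exponential coordinates t \<mapsto> t x is a one-parameter subgroup, so t \<mapsto>
  Ad(t x) is a one-parameter group of linear maps and its derivative at 0 determines all
  others.\<close>

lemma Ad_curve: "((\<lambda>t. Ad (t *\<^sub>R x) w) has_vector_derivative br x (Ad (t *\<^sub>R x) w)) (at t)"
proof (rule has_vector_derivative_shift)
  have "(\<lambda>s. Ad ((t + s) *\<^sub>R x) w) = (\<lambda>s. Ad (s *\<^sub>R x) (Ad (t *\<^sub>R x) w))"
    by (simp add: exp_coords Ad_mul[symmetric] add.commute)
  then show "((\<lambda>s. Ad ((t + s) *\<^sub>R x) w) has_vector_derivative br x (Ad (t *\<^sub>R x) w)) (at 0)"
    using Ad_curve_0 by simp
qed

text \<open>Both sides are the derivative at \<open>x = 0\<close> in direction \<open>v\<close> of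
  Ad y (Ad x w), which equals Ad (y x y^-1) (Ad y w).\<close>

lemma Ad_br: "Ad y (br v w) = br (Ad y v) (Ad y w)"
proof -
  have "((\<lambda>x. Ad y (Ad x w)) has_derivative (\<lambda>v. Ad y (br v w))) (at 0)"
    using has_derivative_compose[OF has_derivative_Ad[of w] bounded_linear_imp_has_derivative]
      linear_Ad[of y] linear_conv_bounded_linear by blast
  moreover have "(\<lambda>x. Ad y (Ad x w)) = (\<lambda>x. Ad (mul (mul y x) (- y)) (Ad y w))"
    by (simp add: fun_eq_iff Ad_mul[symmetric] assoc)
  moreover have "((\<lambda>x. Ad (mul (mul y x) (- y)) (Ad y w)) has_derivative (\<lambda>v. br (Ad y v) (Ad y w))) (at 0)"
    using has_derivative_compose[OF has_derivative_conj[of y], of "\<lambda>x. Ad x (Ad y w)"] has_derivative_Ad[of "Ad y w"]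
    by simp
  ultimately show ?thesis using has_derivative_unique by metis
qed

text \<open>The derivative at t = 0 of \<open>Ad_br\<close> with
  \<open>y = t *\<^sub>R x\<close>.\<close>

lemma jacobi: "br x (br v w) = br (br x v) w + br v (br x w)"
proof -
  have "((\<lambda>t. br (Ad (t *\<^sub>R x) v) (Ad (t *\<^sub>R x) w)) has_vector_derivative
     br (Ad (0 *\<^sub>R x) v) (br x w) + br (br x v) (Ad (0 *\<^sub>R x) w)) (at 0)"
    by (rule bounded_bilinear.has_vector_derivative[OF bounded_bilinear_br]) (rule Ad_curve_0)+
  then have "((\<lambda>t. Ad (t *\<^sub>R x) (br v w)) has_vector_derivative br v (br x w) + br (br x v) w) (at 0)"
    by (simp add: Ad_br)
  with Ad_curve_0 show ?thesis by (metis vector_derivative_unique_at add.commute)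
qed

section \<open>Projections onto the layers and the descending flag\<close>

text \<open>The projection onto layer \<open>j\<close> along the other layers. The value 0 outside
  \<open>{1..k}\<close> agrees with the layers above \<open>k\<close> being zero and keeps
  \<open>pr\<close> linear for every index.\<close>

definition pr :: "nat \<Rightarrow> real^'n \<Rightarrow> real^'n" where
  "pr j x = (if j \<in> {1..k} then (THE c. c \<in> (\<Pi>\<^sub>E i\<in>{1..k}. V i) \<and> x = (\<Sum>i=1..k. c i)) j else 0)"

lemma pr_eqI:
  assumes "\<And>i. i \<in> {1..k} \<Longrightarrow> c i \<in> V i" "x = (\<Sum>i=1..k. c i)" "j \<in> {1..k}"
  shows "pr j x = c j"
proof -
  have "(THE c. c \<in> (\<Pi>\<^sub>E i\<in>{1..k}. V i) \<and> x = (\<Sum>i=1..k. c i)) = restrict c {1..k}"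
    by (rule the1_equality[OF direct_sum]) (use assms in simp)
  then show ?thesis using assms(3) by (simp add: pr_def)
qed

lemma pr_in: "j \<ge> 1 \<Longrightarrow> pr j x \<in> V j" and pr_sum: "(\<Sum>i=Suc 0..k. pr i x) = x"
proof -
  have *: "(THE c. c \<in> (\<Pi>\<^sub>E i\<in>{1..k}. V i) \<and> x = (\<Sum>i=1..k. c i)) \<in> (\<Pi>\<^sub>E i\<in>{1..k}. V i) \<and>
      x = (\<Sum>i=1..k. (THE c. c \<in> (\<Pi>\<^sub>E i\<in>{1..k}. V i) \<and> x = (\<Sum>i=1..k. c i)) i)"
    by (rule theI'[OF direct_sum])
  show "j \<ge> 1 \<Longrightarrow> pr j x \<in> V j"
    using * layer_subspace[of j] by (auto simp: pr_def PiE_mem subspace_0)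
  show "(\<Sum>i=Suc 0..k. pr i x) = x"
    using * by (simp add: pr_def)
qed

lemma pr_layer:
  assumes "v \<in> V j" "j \<in> {1..k}" shows "pr i v = (if i = j then v else 0)"
proof (cases "i \<in> {1..k}")
  case True
  have "pr i v = (\<lambda>i. if i = j then v else 0) i"
  proof (rule pr_eqI[OF _ _ True])
    show "(if i = j then v else 0) \<in> V i" if "i \<in> {1..k}" for i
      using assms layer_subspace[of i] that by (auto simp: subspace_0)
    show "v = (\<Sum>i=1..k. if i = j then v else 0)" using assms(2) by simp
  qed
  then show ?thesis by simp
qed (use assms in \<open>auto simp: pr_def\<close>)

lemma linear_pr: "linear (pr j)"
proof (cases "j \<in> {1..k}")
  case True
  show ?thesis
  proof (rule linearI)
    show "pr j (x + y) = pr j x + pr j y" for x y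
      by (rule pr_eqI[OF _ _ True]) (auto simp: pr_in pr_sum sum.distrib intro!: subspace_add[OF layer_subspace])
    show "pr j (c *\<^sub>R x) = c *\<^sub>R pr j x" for c x
      by (rule pr_eqI[OF _ _ True]) (auto simp: pr_in pr_sum scaleR_sum_right[symmetric] intro!: subspace_scale[OF layer_subspace])
  qed
qed (auto simp: pr_def[abs_def] intro: linear_zero)

text \<open>For positive \<open>i\<close> this is the sum of the layers from \<open>i\<close>
  upwards. Describing it by vanishing projections turns membership into linear equations, which can
  be differentiated along a curve.\<close>

definition flag :: "nat \<Rightarrow> (real^'n) set" where
  "flag i = {v. \<forall>j. 1 \<le> j \<and> j < i \<longrightarrow> pr j v = 0}"

lemma subspace_flag: "subspace (flag i)"
  by (simp add: flag_def subspace_def linear_0[OF linear_pr] linear_add[OF linear_pr] linear_cmul[OF linear_pr])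

lemma flag_1 [simp]: "flag (Suc 0) = UNIV" by (auto simp: flag_def)

lemma flag_mono: "i \<le> j \<Longrightarrow> flag j \<subseteq> flag i" by (auto simp: flag_def)

lemma flag_top: "k < i \<Longrightarrow> flag i = {0}"
proof -
  assume i: "k < i"
  have "v = 0" if "v \<in> flag i" for v
  proof -
    have "(\<Sum>j=1..k. pr j v) = 0" by (rule sum.neutral) (use that i in \<open>auto simp: flag_def\<close>)
    then show ?thesis by (simp add: pr_sum)
  qed
  then show ?thesis using subspace_0[OF subspace_flag] by blast
qed

lemma V_subset_flag: "1 \<le> j \<Longrightarrow> i \<le> j \<Longrightarrow> V j \<subseteq> flag i"
proof
  fix v assume j: "1 \<le> j" "i \<le> j" and v: "v \<in> V j"
  show "v \<in> flag i"
  proof (cases "j \<le> k")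
    case True
    then show ?thesis using pr_layer[OF v] j by (auto simp: flag_def)
  next
    case False
    then show ?thesis using above_top[of j] v by (simp add: subspace_0[OF subspace_flag])
  qed
qed

lemma br_layer_flag:
  assumes v: "v \<in> V 1" and i: "1 \<le> i" and w: "w \<in> flag i"
  shows "br v w \<in> flag (Suc i)"
proof -
  have "br v w = (\<Sum>j=1..k. br v (pr j w))"
    using linear_sum[OF linear_br_right[of v], of "\<lambda>j. pr j w" "{1..k}"] by (simp add: pr_sum o_def)
  moreover have "br v (pr j w) \<in> flag (Suc i)" if j: "j \<in> {1..k}" for j
  proof (cases "j < i")
    case True
    then show ?thesis using w j linear_0[OF linear_br_right] by (simp add: flag_def linear_0[OF linear_pr])
  next
    case False
    have "br v (pr j w) \<in> V (Suc j)"
      using bracket_layer[of j] v pr_in[of j w] j by (auto intro!: span_base)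
    then show ?thesis using V_subset_flag[of "Suc j" "Suc i"] False by auto
  qed
  ultimately show ?thesis using subspace_sum[OF subspace_flag] by metis
qed

text \<open>The stratification only says what brackets with \<open>V 1\<close> do. The vectors whose
  bracket moves every flag one step deeper form a subspace \<open>S\<close>; by the Jacobi identity
  it contains the brackets of \<open>V 1\<close> with any layer inside \<open>S\<close>, hence all
  layers one after the other.\<close>

lemma br_flag:
  assumes i: "1 \<le> i" and w: "w \<in> flag i"
  shows "br v w \<in> flag (Suc i)"
proof -
  define S where "S = {v. \<forall>i\<ge>1. \<forall>w\<in>flag i. br v w \<in> flag (Suc i)}"
  have sub: "subspace S"
    using subspace_flag by (auto simp: S_def subspace_def linear_0[OF linear_br_left] linear_add[OF linear_br_left] linear_cmul[OF linear_br_left])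
  have "V j \<subseteq> S" if "1 \<le> j" for j
    using that
  proof (induction j rule: nat_induct_at_least)
    case base
    then show ?case using br_layer_flag by (auto simp: S_def)
  next
    case (Suc j)
    have "br v w \<in> S" if "v \<in> V 1" "w \<in> V j" for v w
      unfolding S_def
    proof (intro CollectI allI impI ballI)
      fix i :: nat and u assume i: "1 \<le> i" and u: "u \<in> flag i"
      have v: "v \<in> S" using that br_layer_flag by (auto simp: S_def)
      have w: "w \<in> S" using that Suc by auto
      have 1: "br v (br w u) \<in> flag (Suc (Suc i))" "br w (br v u) \<in> flag (Suc (Suc i))"
        using v w i u by (auto simp: S_def)
      have "br (br v w) u = br v (br w u) - br w (br v u)" using jacobi[of v w u] by simp
      also have "\<dots> \<in> flag (Suc (Suc i))" using 1 by (rule subspace_diff[OF subspace_flag])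
      finally show "br (br v w) u \<in> flag (Suc i)" using flag_mono[of "Suc i" "Suc (Suc i)"] by auto
    qed
    then have "span {br v w | v w. v \<in> V 1 \<and> w \<in> V j} \<subseteq> S"
      by (intro span_minimal sub) auto
    then show ?case using bracket_layer[of j] Suc by simp
  qed
  then have "(\<Sum>j=1..k. pr j v) \<in> S"
    using pr_in by (intro subspace_sum[OF sub]) auto
  then show ?thesis using i w by (simp add: pr_sum S_def)
qed

text \<open>Each of the components that have to vanish has derivative zero along the curve.\<close>

lemma curve_in_flag:
  fixes y :: "real \<Rightarrow> real^'n"
  assumes "\<And>t. (y has_vector_derivative y' t) (at t)" "\<And>t. y' t \<in> flag i" "y 0 \<in> flag i"
  shows "y t \<in> flag i"
  unfolding flag_def
proof (intro CollectI allI impI)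
  fix j assume j: "1 \<le> j \<and> j < i"
  have bl: "bounded_linear (pr j)" using linear_pr linear_conv_bounded_linear by blast
  have "((\<lambda>t. pr j (y t)) has_vector_derivative 0) (at t within UNIV)" for t
    using bounded_linear.has_vector_derivative[OF bl assms(1)[of t]] assms(2)[of t] j by (simp add: flag_def)
  then obtain c where c: "\<And>t. pr j (y t) = c"
    using has_vector_derivative_zero_constant[OF convex_UNIV, of "\<lambda>t. pr j (y t)"] by (metis UNIV_I)
  have "pr j (y 0) = 0" using assms(3) j by (simp add: flag_def)
  then show "pr j (y t) = 0" by (simp add: c)
qed

text \<open>A bootstrap along the curve Ad(t x) w: once it stays in \<open>flag (Suc j)\<close>, its
  derivative, a bracket with \<open>x\<close>, lies one step deeper, and therefore so does its
  difference from \<open>w\<close>. The induction starts from the whole space.\<close>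

lemma Ad_unipotent:
  assumes "1 \<le> i" "w \<in> flag i"
  shows "Ad x w - w \<in> flag (Suc i)"
proof -
  have "\<forall>t. Ad (t *\<^sub>R x) w - w \<in> flag (Suc j)" if "j \<le> i" for j
    using that
  proof (induction j)
    case (Suc j)
    have y: "Ad (t *\<^sub>R x) w \<in> flag (Suc j)" for t
    proof -
      have "(Ad (t *\<^sub>R x) w - w) + w \<in> flag (Suc j)"
        using Suc assms flag_mono[of "Suc j" i] by (intro subspace_add[OF subspace_flag]) auto
      then show ?thesis by simp
    qed
    show ?case
    proof
      fix t
      show "Ad (t *\<^sub>R x) w - w \<in> flag (Suc (Suc j))"
      proof (rule curve_in_flag)
        show "((\<lambda>t. Ad (t *\<^sub>R x) w - w) has_vector_derivative br x (Ad (t *\<^sub>R x) w)) (at t)" for t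
          using has_vector_derivative_diff[OF Ad_curve has_vector_derivative_const] by simp
        show "br x (Ad (t *\<^sub>R x) w) \<in> flag (Suc (Suc j))" for t
          using y by (intro br_flag) auto
      qed (simp add: subspace_0[OF subspace_flag])
    qed
  qed simp
  from this[of i] show ?thesis by (metis order_refl scaleR_one)
qed

text \<open>\<open>Y t = D(L\<^sub>-\<^sub>t\<^sub>x)(tx)(th)\<close> satisfies \<open>Y (t + s) = Ad (-tx) (Y s) + Y t\<close>, so that
  \<open>D(L\<^sub>-\<^sub>x)(x) = \<integral>\<^sub>0\<^sup>1 Ad (-sx) ds\<close>: the usual formula for the differential of the exponential map.\<close>

lemma DL_neg_unipotent:
  assumes i: "1 \<le> i" and h: "h \<in> flag i"
  shows "DL (- x) x h - h \<in> flag (Suc i)"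
proof -
  define Y where "Y = (\<lambda>t::real. DL (- (t *\<^sub>R x)) (t *\<^sub>R x) (t *\<^sub>R h))"
  define N where "N = (\<lambda>t::real. DM (t *\<^sub>R (- x), t *\<^sub>R x) (0, h))"
  have Y: "Y t = t *\<^sub>R N t" for t
    using linear_cmul[OF linear_DL] by (simp add: Y_def N_def DL_DM)
  have dY: "((\<lambda>s. mul (- (t *\<^sub>R x)) (t *\<^sub>R (x + s *\<^sub>R h))) has_derivative (\<lambda>s. s *\<^sub>R Y t)) (at 0)" for t
  proof -
    have "((\<lambda>s. t *\<^sub>R (x + s *\<^sub>R h)) has_derivative (\<lambda>s. s *\<^sub>R t *\<^sub>R h)) (at 0)"
      by (auto intro!: derivative_eq_intros)
    from diff_chain_at[OF this has_derivative_mul_left] show ?thesis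
      using linear_cmul[OF linear_DL] by (simp add: o_def Y_def)
  qed
  have coc: "Y (t + s) = Ad (- (t *\<^sub>R x)) (Y s) + Y t" for t s
  proof -
    \<comment> \<open>The identity for \<open>Y\<close> is the derivative in \<open>r\<close> of an
      identity between products: the rays through \<open>x\<close> and through
      \<open>x + r *\<^sub>R h\<close> are one-parameter subgroups, and inserting (t x)(-t x)
      between the factors exhibits \<open>g (t + s) r\<close> as a conjugate of \<open>g s r\<close>
      times \<open>g t r\<close>.\<close>
    define g where "g = (\<lambda>t r. mul (- (t *\<^sub>R x)) (t *\<^sub>R (x + r *\<^sub>R h)))"
    have g: "g (t + s) r = mul (mul (mul (- (t *\<^sub>R x)) (g s r)) (- (- (t *\<^sub>R x)))) (g t r)" for r
    proof -
      have "mul (- (s *\<^sub>R x)) (- (t *\<^sub>R x)) = - ((t + s) *\<^sub>R x)"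
        using exp_coords[of "-s" x "-t"] by (simp add: algebra_simps)
      moreover have "mul (- (t *\<^sub>R x)) (- (s *\<^sub>R x)) = - ((t + s) *\<^sub>R x)"
        using exp_coords[of "-t" x "-s"] by (simp add: algebra_simps)
      moreover have "mul (s *\<^sub>R (x + r *\<^sub>R h)) (t *\<^sub>R (x + r *\<^sub>R h)) = (t + s) *\<^sub>R (x + r *\<^sub>R h)"
        using exp_coords[of s "x + r *\<^sub>R h" t] by (simp add: add.commute)
      ultimately show ?thesis unfolding g_def by (metis assoc minus_minus mul_neg_cancel(2))
    qed
    have d: "(g t has_derivative (\<lambda>r. r *\<^sub>R Y t)) (at 0)" for t
      unfolding g_def by (rule dY)
    have z: "g t 0 = 0" for t by (simp add: g_def)
    have c: "((\<lambda>r. mul (mul (- (t *\<^sub>R x)) (g s r)) (- (- (t *\<^sub>R x)))) has_derivative (\<lambda>r. Ad (- (t *\<^sub>R x)) (r *\<^sub>R Y s))) (at 0)"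
      using diff_chain_at[OF d[of s], of "\<lambda>z. mul (mul (- (t *\<^sub>R x)) z) (- (- (t *\<^sub>R x)))"] has_derivative_conj[of "- (t *\<^sub>R x)"]
      by (simp only: z o_def)
    have "(g (t + s) has_derivative (\<lambda>r. DM (0, 0) (Ad (- (t *\<^sub>R x)) (r *\<^sub>R Y s), r *\<^sub>R Y t))) (at 0)"
      using has_derivative_mul[OF c d[of t]] unfolding g[symmetric] z by simp
    from has_derivative_unique[OF d this] have "1 *\<^sub>R Y (t + s) = DM (0, 0) (Ad (- (t *\<^sub>R x)) (1 *\<^sub>R Y s), 1 *\<^sub>R Y t)"
      by metis
    then show ?thesis using DM_add[of "(0,0)" "Ad (- (t *\<^sub>R x)) (Y s)" "Y t"] by simp
  qed
  have smN: "smooth_map N" unfolding N_def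
    by (rule smooth_map_derivative_apply[OF smooth_mult])
       (intro smooth_map_const smooth_map_Pair smooth_map_bounded_linear bounded_linear_scaleR_left)+
  \<comment> \<open>In \<open>Y t = t *\<^sub>R N t\<close> the derivative of \<open>N\<close> is
    multiplied by t and drops out at 0.\<close>
  have Y0: "(Y has_vector_derivative h) (at 0)"
  proof -
    have "((\<lambda>t. t *\<^sub>R N t) has_derivative (\<lambda>s. 0 *\<^sub>R frechet_derivative N (at 0) s + s *\<^sub>R N 0)) (at 0)"
      by (rule has_derivative_scaleR[OF has_derivative_ident smooth_map_has_derivative[OF smN]])
    moreover have "N 0 = h" by (simp add: N_def)
    ultimately show ?thesis by (simp add: has_vector_derivative_def Y[abs_def])
  qed
  have dY': "(Y has_vector_derivative Ad (- (t *\<^sub>R x)) h) (at t)" for t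
  proof (rule has_vector_derivative_shift)
    have "((\<lambda>s. Ad (- (t *\<^sub>R x)) (Y s) + Y t) has_vector_derivative Ad (- (t *\<^sub>R x)) h + 0) (at 0)"
      by (intro has_vector_derivative_add has_vector_derivative_const bounded_linear.has_vector_derivative[OF _ Y0])
         (use linear_Ad linear_conv_bounded_linear in blast)
    then show "((\<lambda>s. Y (t + s)) has_vector_derivative Ad (- (t *\<^sub>R x)) h) (at 0)" by (simp add: coc)
  qed
  have "Y 1 - 1 *\<^sub>R h \<in> flag (Suc i)"
  proof (rule curve_in_flag)
    show "((\<lambda>t. Y t - t *\<^sub>R h) has_vector_derivative Ad (- (t *\<^sub>R x)) h - h) (at t)" for t
      by (intro has_vector_derivative_diff dY') (auto intro!: derivative_eq_intros)
    show "Ad (- (t *\<^sub>R x)) h - h \<in> flag (Suc i)" for t by (rule Ad_unipotent[OF i h])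
  qed (simp add: Y subspace_0[OF subspace_flag])
  then show ?thesis by (simp add: Y_def)
qed

text \<open>Descending induction on the flag: by \<open>DL_neg_unipotent\<close>, h - DL x 0 h is
  the image under \<open>DL x 0\<close> of a vector one step deeper, where invariance is already
  known.\<close>

lemma DL_0_flag:
  assumes i: "1 \<le> i" and h: "h \<in> flag i"
  shows "DL x 0 h \<in> flag i"
proof (cases "i \<le> Suc k")
  case True
  from True i have "\<forall>h\<in>flag i. DL x 0 h \<in> flag i"
  proof (induction i rule: inc_induct)
    case base
    then show ?case by (simp add: flag_top linear_0[OF linear_DL])
  next
    case (step i)
    show ?case
    proof
      fix h assume h: "h \<in> flag i"
      have "DL x 0 (DL (- x) x h - h) \<in> flag i"
        using step DL_neg_unipotent[of i h x] h flag_mono[of i "Suc i"] by auto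
      then have "h - DL x 0 (DL (- x) x h - h) \<in> flag i" using h by (intro subspace_diff[OF subspace_flag])
      then show "DL x 0 h \<in> flag i" by (simp add: linear_diff[OF linear_DL] DL_inverse)
    qed
  qed
  then show ?thesis using h by simp
qed (use h flag_top in \<open>simp add: linear_0[OF linear_DL]\<close>)

text \<open>\<open>L_x\<close> near \<open>y\<close> is \<open>L_(-y)\<close> followed by
  \<open>L_(xy)\<close> near 0, so the differential is a product of the two kinds already
  treated.\<close>

lemma DL_unipotent:
  assumes i: "1 \<le> i" and h: "h \<in> flag i"
  shows "DL x y h - h \<in> flag (Suc i)"
proof -
  have 0: "DL x 0 h - h \<in> flag (Suc i)" if h: "h \<in> flag i" for x h
  proof -
    have "- DL x 0 (DL (- x) x h - h) \<in> flag (Suc i)"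
      using DL_neg_unipotent[OF i h] by (intro subspace_neg[OF subspace_flag] DL_0_flag) auto
    then show ?thesis by (simp add: linear_diff[OF linear_DL] DL_inverse)
  qed
  define u where "u = DL (- y) y h"
  have u: "u - h \<in> flag (Suc i)" using DL_neg_unipotent[OF i h] by (simp add: u_def)
  then have "(u - h) + h \<in> flag i" using h flag_mono[of i "Suc i"] by (intro subspace_add[OF subspace_flag]) auto
  then have "(DL (mul x y) 0 u - u) + (u - h) \<in> flag (Suc i)"
    using u by (intro subspace_add[OF subspace_flag] 0) auto
  moreover have "DL (mul x y) 0 u = DL x y h"
    using DL_chain[of "mul x y" "-y" y h] by (simp add: u_def)
  ultimately show ?thesis by simp
qed

text \<open>\<open>flag 2\<close> is the kernel of \<open>pr 1\<close>, so unipotency says that left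
  translations do not change the first component of a tangent vector. Hence pr 1 (x y) - pr 1 y is
  constant in \<open>y\<close>, and \<open>y = 0\<close> gives its value.\<close>

lemma pr_1_mul: "pr 1 (mul x y) = pr 1 x + pr 1 y"
proof -
  have bl: "bounded_linear (pr 1)" using linear_pr linear_conv_bounded_linear by blast
  have "((\<lambda>y. pr 1 (mul x y) - pr 1 y) has_derivative (\<lambda>h. 0)) (at y within UNIV)" for y
  proof -
    have "((\<lambda>y. pr 1 (mul x y) - pr 1 y) has_derivative (\<lambda>h. pr 1 (DL x y h) - pr 1 h)) (at y)"
      by (intro has_derivative_diff bounded_linear_imp_has_derivative[OF bl]
          has_derivative_compose[OF has_derivative_mul_left bounded_linear_imp_has_derivative[OF bl]])
    moreover have "pr 1 (DL x y h) - pr 1 h = 0" for h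
      using DL_unipotent[of 1 h x y] by (simp add: flag_def linear_diff[OF linear_pr])
    ultimately show ?thesis by simp
  qed
  then obtain c where "\<And>y. pr 1 (mul x y) - pr 1 y = c"
    using has_derivative_zero_constant[OF convex_UNIV, of "\<lambda>y. pr 1 (mul x y) - pr 1 y"] by (metis UNIV_I)
  from this[of y] this[of 0] show ?thesis by (simp add: linear_0[OF linear_pr] algebra_simps)
qed

section \<open>Dilations\<close>

text \<open>Conjugation with \<open>dil r\<close> multiplies the block of a linear map leading from
  layer \<open>i\<close> to layer \<open>j\<close> by r^(i-j); for a map that is unipotent on the
  flag this damps everything except the diagonal.\<close>

definition dil :: "real \<Rightarrow> real^'n \<Rightarrow> real^'n" where
  "dil r v = (\<Sum>i=1..k. r ^ i *\<^sub>R pr i v)"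

lemma linear_dil: "linear (dil r)"
  unfolding dil_def by (intro linear_compose_sum ballI linear_compose_scale_right linear_pr)

lemma pr_pr: "j \<in> {1..k} \<Longrightarrow> pr i (pr j v) = (if i = j then pr j v else 0)"
  by (rule pr_layer) (auto simp: pr_in)

lemma pr_dil: "i \<in> {1..k} \<Longrightarrow> pr i (dil r v) = r ^ i *\<^sub>R pr i v"
proof -
  assume i: "i \<in> {1..k}"
  have "pr i (dil r v) = (\<Sum>j=1..k. r ^ j *\<^sub>R pr i (pr j v))"
    by (simp add: dil_def linear_sum[OF linear_pr] linear_cmul[OF linear_pr] o_def)
  also have "\<dots> = (\<Sum>j=1..k. if i = j then r ^ i *\<^sub>R pr i v else 0)"
    by (rule sum.cong) (auto simp: pr_pr)
  finally show ?thesis using i by simp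
qed

lemma dil_inverse: "r \<noteq> 0 \<Longrightarrow> dil (1 / r) (dil r v) = v"
proof -
  assume "r \<noteq> 0"
  have "dil (1 / r) (dil r v) = (\<Sum>i=1..k. (1 / r) ^ i *\<^sub>R r ^ i *\<^sub>R pr i v)"
    unfolding dil_def[of "1 / r"] by (rule sum.cong) (simp_all only: pr_dil refl)
  also have "\<dots> = (\<Sum>i=1..k. pr i v)" using \<open>r \<noteq> 0\<close> by (simp add: power_one_over)
  finally show ?thesis by (simp add: pr_sum)
qed

text \<open>By \<open>DL_unipotent\<close> the blocks leading to a lower layer vanish and the
  diagonal blocks are identities. The remaining ones carry a negative power of
  \<open>r\<close>.\<close>

lemma dil_DL_tendsto: "((\<lambda>r. dil (1 / r) (DL x y (dil r v))) \<longlongrightarrow> v) at_top"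
proof -
  have e: "dil (1 / r) (DL x y (dil r v)) = (\<Sum>j=1..k. \<Sum>i=1..k. ((1 / r) ^ j * r ^ i) *\<^sub>R pr j (DL x y (pr i v)))" for r
    by (simp add: dil_def linear_sum[OF linear_DL] linear_cmul[OF linear_DL] linear_sum[OF linear_pr]
        linear_cmul[OF linear_pr] o_def scaleR_sum_right)
  have t: "((\<lambda>r. ((1 / r) ^ j * r ^ i) *\<^sub>R pr j (DL x y (pr i v))) \<longlongrightarrow> (if i = j then pr i v else 0)) at_top"
    if i: "i \<in> {1..k}" and j: "j \<in> {1..k}" for i j
  proof -
    have "pr i v \<in> flag i" using pr_in[of i v] V_subset_flag[of i i] i by auto
    then have d: "DL x y (pr i v) - pr i v \<in> flag (Suc i)" using DL_unipotent i by auto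
    have ev: "eventually (\<lambda>r::real. r > 0) at_top" by (rule eventually_gt_at_top)
    consider "j \<le> i" | "i < j" by linarith
    then show ?thesis
    proof cases
      case 1
      then have "pr j (DL x y (pr i v)) = (if i = j then pr i v else 0)"
        using d j pr_pr[OF i, of j v] by (auto simp: flag_def linear_diff[OF linear_pr])
      then have "eventually (\<lambda>r. (if i = j then pr i v else 0) = ((1 / r) ^ j * r ^ i) *\<^sub>R pr j (DL x y (pr i v))) at_top"
        by (intro eventually_mono[OF ev]) (auto simp: power_one_over)
      then show ?thesis by (rule Lim_transform_eventually[OF tendsto_const])
    next
      case 2
      have "((\<lambda>r::real. inverse (r ^ (j - i))) \<longlongrightarrow> 0) at_top"
        using 2 by (intro tendsto_inverse_0_at_top filterlim_pow_at_top filterlim_ident) auto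
      then have "((\<lambda>r::real. (1 / r) ^ j * r ^ i) \<longlongrightarrow> 0) at_top"
      proof (rule Lim_transform_eventually, intro eventually_mono[OF ev])
        fix r :: real assume "0 < r"
        then show "inverse (r ^ (j - i)) = (1 / r) ^ j * r ^ i"
          using 2 power_add[of r i "j - i"] by (simp add: power_one_over field_simps)
      qed
      from tendsto_scaleR[OF this tendsto_const] show ?thesis using 2 by simp
    qed
  qed
  have "((\<lambda>r. \<Sum>j=1..k. \<Sum>i=1..k. ((1 / r) ^ j * r ^ i) *\<^sub>R pr j (DL x y (pr i v))) \<longlongrightarrow> (\<Sum>j=1..k. \<Sum>i=1..k. if i = j then pr i v else 0)) at_top"
    by (intro tendsto_sum t)
  moreover have "(\<Sum>j=1..k. \<Sum>i=1..k. if i = j then pr i v else 0) = v"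
  proof -
    have "(\<Sum>j=1..k. \<Sum>i=1..k. if i = j then pr i v else 0) = (\<Sum>j=1..k. pr j v)"
      by (rule sum.cong) (auto simp: sum.delta')
    then show ?thesis by (simp add: pr_sum)
  qed
  ultimately show ?thesis by (simp add: e)
qed

end

section \<open>Invariance of Lebesgue measure\<close>

text \<open>The change of variables theorem of the library requires a well-ordered index type;
  \<open>'n idx\<close> is a well-ordered copy of the finite type \<open>'n\<close>.\<close>

typedef (overloaded) ('n::finite) idx = "{..<CARD('n)}"
  by (rule exI[of _ 0]) simp

instance idx :: (finite) finite
proof
  have "finite (Abs_idx ` {..<CARD('a)} :: 'a idx set)" by simp
  moreover have "(UNIV :: 'a idx set) = Abs_idx ` {..<CARD('a)}"
    by (metis type_definition.Abs_image type_definition_idx)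
  ultimately show "finite (UNIV :: 'a idx set)" by simp
qed

instantiation idx :: (finite) wellorder
begin

definition less_eq_idx :: "'a idx \<Rightarrow> 'a idx \<Rightarrow> bool" where "less_eq_idx x y \<longleftrightarrow> Rep_idx x \<le> Rep_idx y"

definition less_idx :: "'a idx \<Rightarrow> 'a idx \<Rightarrow> bool" where "less_idx x y \<longleftrightarrow> Rep_idx x < Rep_idx y"

instance
proof
  fix P :: "'a idx \<Rightarrow> bool" and a
  assume *: "\<And>x. (\<And>y. y < x \<Longrightarrow> P y) \<Longrightarrow> P x"
  show "P a"
    by (induction a rule: measure_induct_rule[of Rep_idx]) (use * in \<open>auto simp: less_idx_def\<close>)
qed (auto simp: less_eq_idx_def less_idx_def Rep_idx_inject)

end

lemma card_idx: "CARD('n::finite idx) = CARD('n)"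
  using type_definition.card[OF type_definition_idx] by auto

lemma tendsto_det:
  fixes A :: "'r \<Rightarrow> real^'n^'n"
  assumes "\<And>i j. ((\<lambda>r. A r $ i $ j) \<longlongrightarrow> B $ i $ j) F"
  shows "((\<lambda>r. det (A r)) \<longlongrightarrow> det B) F"
  unfolding det_def by (intro tendsto_intros assms)

text \<open>Conjugation by dilations does not change the determinant.\<close>

lemma det_eq_1_dilations:
  fixes T :: "real^'n \<Rightarrow> real^'n" and d D :: "real \<Rightarrow> real^'n \<Rightarrow> real^'n"
  assumes T: "linear T" and d: "\<And>r. linear (d r)" and D: "\<And>r. linear (D r)"
    and inv: "\<And>r v. r > (0::real) \<Longrightarrow> d r (D r v) = v"
    and lim: "\<And>v. ((\<lambda>r. d r (T (D r v))) \<longlongrightarrow> v) at_top"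
  shows "det (matrix T) = 1"
proof -
  have e: "det (matrix (\<lambda>v. d r (T (D r v)))) = det (matrix T)" if r: "r > 0" for r
  proof -
    have "matrix (\<lambda>v. d r (T (D r v))) = matrix (d r) ** (matrix T ** matrix (D r))"
      using matrix_compose[OF D[of r] T] matrix_compose[OF linear_compose[OF D[of r] T] d[of r]] by (simp add: o_def)
    moreover have "det (matrix (d r)) * det (matrix (D r)) = 1"
    proof -
      have "matrix (\<lambda>v. d r (D r v)) = matrix (d r) ** matrix (D r)"
        using matrix_compose[OF D[of r] d[of r]] by (simp add: o_def)
      moreover have "(\<lambda>v. d r (D r v)) = id" using inv[OF r] by auto
      ultimately show ?thesis by (metis det_I det_mul matrix_id_mat_1)
    qed
    ultimately show ?thesis by (simp add: det_mul mult.left_commute)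
  qed
  have "((\<lambda>r. det (matrix (\<lambda>v. d r (T (D r v))))) \<longlongrightarrow> det (mat 1 :: real^'n^'n)) at_top"
  proof (rule tendsto_det)
    fix i j :: 'n
    have "((\<lambda>r. d r (T (D r (axis j 1))) $ i) \<longlongrightarrow> axis j 1 $ i) at_top"
      by (intro tendsto_vec_nth lim)
    then show "((\<lambda>r. matrix (\<lambda>v. d r (T (D r v))) $ i $ j) \<longlongrightarrow> mat 1 $ i $ j) at_top"
      by (simp add: matrix_def mat_def axis_def eq_commute)
  qed
  then have "((\<lambda>r::real. det (matrix T)) \<longlongrightarrow> det (mat 1 :: real^'n^'n)) at_top"
    by (rule Lim_transform_eventually) (rule eventually_mono[OF eventually_gt_at_top[of 0]], simp add: e)
  then show ?thesis by (simp add: tendsto_const_iff)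
qed

lemma emeasure_image_box_wellorder:
  fixes f :: "real^'n::{finite,wellorder} \<Rightarrow> real^'n::_"
  assumes d: "\<And>x. (f has_derivative f' x) (at x)" and "inj f" and det: "\<And>x. \<bar>det (matrix (f' x))\<bar> = 1"
  shows "emeasure lebesgue (f ` box a b) = emeasure lborel (box a b)"
proof -
  have "((\<lambda>x. \<bar>det (matrix (f' x))\<bar>) has_integral measure lborel (cbox a b)) (box a b)"
    using has_integral_const[of "1::real" a b] by (simp add: det has_integral_open_interval)
  then have "f ` box a b \<in> lmeasurable \<and> measure lebesgue (f ` box a b) = measure lborel (cbox a b)"
    using has_measure_differentiable_image[of "box a b" f f' "measure lborel (cbox a b)"] d \<open>inj f\<close>
    by (auto intro: has_derivative_at_withinI inj_on_subset)
  then show ?thesis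
    by (metis emeasure_eq_measure2 emeasure_lborel_box_eq emeasure_lborel_cbox_eq emeasure_lborel_cbox_finite
        fmeasurableD2 infinity_ennreal_def less_irrefl emeasure_eq_ennreal_measure)
qed

definition to_idx :: "real^'n \<Rightarrow> real^('n::finite idx)" where
  "to_idx v = (\<chi> i. v $ (SOME e. bij e) i)"

lemma ex_bij_idx: "\<exists>e :: 'n::finite idx \<Rightarrow> 'n. bij e"
  using finite_same_card_bij[of "UNIV :: 'n idx set" "UNIV :: 'n set"] card_idx by auto

definition of_idx :: "real^('n::finite idx) \<Rightarrow> real^'n" where
  "of_idx w = (\<chi> j. w $ inv (SOME e. bij e) j)"

lemma of_idx_to_idx [simp]: "of_idx (to_idx v) = v" "to_idx (of_idx w) = w"
  for v :: "real^'n" and w :: "real^'n idx"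
proof -
  have b: "bij (SOME e :: 'n idx \<Rightarrow> 'n. bij e)" by (rule someI_ex[OF ex_bij_idx])
  show "of_idx (to_idx v) = v" "to_idx (of_idx w) = w"
    using surj_f_inv_f[OF bij_is_surj[OF b]] inv_f_f[OF bij_is_inj[OF b]]
    by (simp_all add: of_idx_def to_idx_def vec_eq_iff)
qed

lemma linear_to_idx: "linear to_idx" and linear_of_idx: "linear of_idx"
  by (auto intro!: linearI simp: to_idx_def of_idx_def vec_eq_iff)

lemma continuous_to_idx: "continuous_on UNIV to_idx" and continuous_of_idx: "continuous_on UNIV of_idx"
  by (simp_all add: linear_to_idx linear_of_idx linear_continuous_on linear_conv_bounded_linear[symmetric])

lemma emeasure_box_cart:
  fixes a b :: "real^'n"
  shows "emeasure lborel (box a b) = ennreal (if \<forall>i. a $ i \<le> b $ i then \<Prod>i\<in>UNIV. b $ i - a $ i else 0)"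
proof -
  have B: "(Basis :: (real^'n) set) = (\<lambda>i. axis i 1) ` UNIV"
    by (auto simp: Basis_vec_def)
  have inj: "inj (\<lambda>i::'n. axis i (1::real))"
    by (auto simp: inj_on_def axis_eq_axis)
  show ?thesis
    unfolding emeasure_lborel_box_eq B
    by (simp add: inner_axis inner_axis' prod.reindex[OF inj] o_def)
qed

text \<open>Renaming coordinates maps boxes to boxes with the same side lengths.\<close>

lemma distr_to_idx: "distr lborel borel (to_idx :: real^'n::finite \<Rightarrow> _) = lborel"
proof (rule lborel_eqI[symmetric])
  define e :: "'n idx \<Rightarrow> 'n" where "e = (SOME e. bij e)"
  have e: "bij e" unfolding e_def by (rule someI_ex[OF ex_bij_idx])
  fix l u :: "real^'n idx"
  assume lu: "\<And>b. b \<in> Basis \<Longrightarrow> l \<bullet> b \<le> u \<bullet> b"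
  have m: "to_idx \<in> borel_measurable borel" by (simp add: continuous_to_idx borel_measurable_continuous_onI)
  have "to_idx -` box l u = box (of_idx l) (of_idx u)"
  proof -
    have "(\<forall>i. l $ i < v $ e i \<and> v $ e i < u $ i) \<longleftrightarrow> (\<forall>j. l $ inv e j < v $ j \<and> v $ j < u $ inv e j)" for v
      using e by (metis bij_inv_eq_iff)
    then show ?thesis by (auto simp: mem_box_cart to_idx_def of_idx_def e_def[symmetric])
  qed
  then have "emeasure (distr lborel borel to_idx) (box l u) = emeasure lborel (box (of_idx l) (of_idx u))"
    using m by (subst emeasure_distr) (auto simp: measurable_lborel2)
  also have "\<dots> = emeasure lborel (box l u)"
  proof -
    have "(\<Prod>j\<in>UNIV. u $ inv e j - l $ inv e j) = (\<Prod>i\<in>UNIV. u $ i - l $ i)"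
      using prod.reindex_bij_betw[OF bij_imp_bij_inv[OF e], of "\<lambda>i. u $ i - l $ i"] by simp
    moreover have "(\<forall>j. l $ inv e j \<le> u $ inv e j) \<longleftrightarrow> (\<forall>i. l $ i \<le> u $ i)"
      using e by (metis bij_inv_eq_iff)
    ultimately show ?thesis by (simp add: emeasure_box_cart of_idx_def e_def[symmetric])
  qed
  also have "\<dots> = (\<Prod>b\<in>Basis. (u - l) \<bullet> b)" using lu by (simp add: emeasure_lborel_box_eq)
  finally show "emeasure (distr lborel borel to_idx) (box l u) = ennreal (\<Prod>b\<in>Basis. (u - l) \<bullet> b)" .
qed simp

text \<open>The preimage of a box under \<open>g\<close> is its image under the inverse
  \<open>f\<close>, so the change of variables is carried out for \<open>f\<close>. The
  differentials of \<open>f\<close> have determinant 1 because dilations deform them into the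
  identity.\<close>

lemma distr_lborel_dilations:
  fixes f g :: "real^'n \<Rightarrow> real^'n" and d D :: "real \<Rightarrow> real^'n \<Rightarrow> real^'n"
  assumes f: "\<And>x. (f has_derivative f' x) (at x)" and g: "continuous_on UNIV g"
    and gf: "\<And>x. g (f x) = x" and fg: "\<And>x. f (g x) = x"
    and d: "\<And>r. linear (d r)" and D: "\<And>r. linear (D r)"
    and inv: "\<And>r v. r > (0::real) \<Longrightarrow> d r (D r v) = v"
    and lim: "\<And>x v. ((\<lambda>r. d r (f' x (D r v))) \<longlongrightarrow> v) at_top"
  shows "distr lborel borel g = lborel"
proof (rule lborel_eqI[symmetric])
  fix l u :: "real^'n"
  assume lu: "\<And>b. b \<in> Basis \<Longrightarrow> l \<bullet> b \<le> u \<bullet> b"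
  have bl: "bounded_linear (to_idx :: real^'n \<Rightarrow> _)" "bounded_linear (of_idx :: _ \<Rightarrow> real^'n)"
    using linear_to_idx linear_of_idx linear_conv_bounded_linear by blast+
  have gm: "g \<in> borel_measurable borel" using g by (rule borel_measurable_continuous_onI)
  have gv: "g -` box l u = f ` box l u" using gf fg by (auto simp: image_iff) (metis fg)
  have op: "open (f ` box l u)" unfolding gv[symmetric] by (rule open_vimage[OF open_box g])
  \<comment> \<open>\<open>f\<close> transported to the well-ordered index type, where the Jacobian
    controls the volume of images of boxes.\<close>
  define h where "h = (\<lambda>w. to_idx (f (of_idx w)))"
  define h' where "h' = (\<lambda>w v. to_idx (f' (of_idx w) (of_idx v)))"
  have h: "(h has_derivative h' w) (at w)" for w
    unfolding h_def h'_def
    by (rule has_derivative_compose[OF has_derivative_compose[OF bounded_linear_imp_has_derivative[OF bl(2)] f]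
        bounded_linear_imp_has_derivative[OF bl(1)]])
  have "det (matrix (h' w)) = 1" for w
  proof (rule det_eq_1_dilations)
    show "linear (h' w)" by (rule has_derivative_linear[OF h])
    show "linear (\<lambda>v. to_idx (d r (of_idx v)))" "linear (\<lambda>v. to_idx (D r (of_idx v)))" for r
      using linear_compose[OF linear_of_idx linear_compose[OF d linear_to_idx]]
        linear_compose[OF linear_of_idx linear_compose[OF D linear_to_idx]] by (simp_all add: o_def)
    show "to_idx (d r (of_idx (to_idx (D r (of_idx v))))) = v" if "r > 0" for r v
      using inv[OF that] by simp
    have "((\<lambda>r. to_idx (d r (f' (of_idx w) (D r (of_idx v))))) \<longlongrightarrow> to_idx (of_idx v)) at_top" for v
      by (intro bounded_linear.tendsto[OF bl(1)] lim)
    then show "((\<lambda>r. to_idx (d r (of_idx (h' w (to_idx (D r (of_idx v))))))) \<longlongrightarrow> v) at_top" for v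
      by (simp add: h'_def)
  qed
  moreover have "inj h" unfolding h_def by (rule injI) (metis gf of_idx_to_idx)
  ultimately have hb: "emeasure lebesgue (h ` box a b) = emeasure lborel (box a b)" for a b
    using emeasure_image_box_wellorder[of h h', OF h] by simp
  have mt: "to_idx \<in> borel_measurable borel" "of_idx \<in> borel_measurable borel"
    by (simp_all add: continuous_to_idx continuous_of_idx borel_measurable_continuous_onI)
  have tm: "emeasure lborel (to_idx -` S) = emeasure lborel S" if "S \<in> sets borel" for S :: "(real^'n idx) set"
  proof -
    have "to_idx \<in> lborel \<rightarrow>\<^sub>M borel" using mt(1) by (simp add: measurable_lborel2)
    from emeasure_distr[OF this, of S] that show ?thesis by (simp add: distr_to_idx)
  qed
  have ti: "to_idx ` S = of_idx -` S" for S :: "(real^'n) set" by (auto simp: image_iff) (metis of_idx_to_idx(2))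
  have box: "to_idx ` box l u \<in> sets borel" "to_idx ` f ` box l u \<in> sets borel"
    unfolding ti using mt(2) op measurable_sets[OF mt(2), of "box l u"] measurable_sets[OF mt(2), of "f ` box l u"] by auto
  have vt: "to_idx -` to_idx ` S = S" for S :: "(real^'n) set" by (metis inj_on_def inj_vimage_image_eq of_idx_to_idx(1))
  have "\<exists>a b. to_idx ` box l u = box a b"
  proof -
    define e :: "'n idx \<Rightarrow> 'n" where "e = (SOME e. bij e)"
    have e: "bij e" unfolding e_def by (rule someI_ex[OF ex_bij_idx])
    have "(\<forall>i. (\<chi> i. l $ e i) $ i < w $ i \<and> w $ i < (\<chi> i. u $ e i) $ i) \<longleftrightarrow> (\<forall>j. l $ j < w $ inv e j \<and> w $ inv e j < u $ j)" for w
      using e by (simp, metis bij_inv_eq_iff)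
    then have "of_idx -` box l u = box (\<chi> i. l $ e i) (\<chi> i. u $ e i)"
      by (auto simp: mem_box_cart of_idx_def e_def[symmetric])
    then show ?thesis unfolding ti by blast
  qed
  then obtain a b where ab: "to_idx ` box l u = box a b" by blast
  have "emeasure (distr lborel borel g) (box l u) = emeasure lborel (f ` box l u)"
    using gm gv by (subst emeasure_distr) (auto simp: measurable_lborel2)
  also have "\<dots> = emeasure lborel (to_idx ` f ` box l u)" using tm[OF box(2)] vt by simp
  also have "to_idx ` f ` box l u = h ` box a b" unfolding ab[symmetric] h_def by (simp add: image_image)
  also have "emeasure lborel (h ` box a b) = emeasure lebesgue (h ` box a b)"
    using box(2) by (simp add: ab[symmetric] h_def image_image)
  also have "\<dots> = emeasure lborel (box l u)" using hb ab tm[OF box(1)] vt by metis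
  also have "\<dots> = (\<Prod>b\<in>Basis. (u - l) \<bullet> b)" using lu by (simp add: emeasure_lborel_box_eq)
  finally show "emeasure (distr lborel borel g) (box l u) = ennreal (\<Prod>b\<in>Basis. (u - l) \<bullet> b)" .
qed simp

lemma distr_lborel_uminus: "distr lborel borel uminus = (lborel :: 'a::euclidean_space measure)"
proof (rule lborel_eqI[symmetric])
  fix l u :: 'a
  assume lu: "\<And>b. b \<in> Basis \<Longrightarrow> l \<bullet> b \<le> u \<bullet> b"
  have "uminus -` box l u = box (- u) (- l)"
    by (auto simp: mem_box minus_less_iff less_minus_iff)
  then have "emeasure (distr lborel borel uminus) (box l u) = emeasure lborel (box (- u) (- l))"
    by (subst emeasure_distr) auto
  also have "\<dots> = (\<Prod>b\<in>Basis. (u - l) \<bullet> b)" using lu by (simp add: emeasure_lborel_box_eq algebra_simps)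
  finally show "emeasure (distr lborel borel uminus) (box l u) = ennreal (\<Prod>b\<in>Basis. (u - l) \<bullet> b)" .
qed simp

context carnot_group
begin

lemma continuous_mul: "continuous_on UNIV M"
  by (rule smooth_map_continuous[OF smooth_mult])

lemma continuous_on_mul [continuous_intros]:
  "continuous_on S f \<Longrightarrow> continuous_on S g \<Longrightarrow> continuous_on S (\<lambda>x. mul (f x) (g x))"
  using continuous_on_compose2[OF continuous_mul continuous_on_Pair, of S f g] by simp

lemma measurable_mul [measurable (raw)]:
  fixes f g :: "'c \<Rightarrow> real^'n"
  assumes "f \<in> borel_measurable N" "g \<in> borel_measurable N"
  shows "(\<lambda>x. mul (f x) (g x)) \<in> borel_measurable N"
  using borel_measurable_continuous_Pair[OF assms, of mul] continuous_mul by (simp add: case_prod_unfold)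

lemma distr_mul_left: "distr lborel borel (mul y) = lborel"
proof (rule distr_lborel_dilations[of "mul (- y)"])
  show "(mul (- y) has_derivative DL (- y) x) (at x)" for x by (rule has_derivative_mul_left)
  show "continuous_on UNIV (mul y)" by (intro continuous_intros)
  show "linear (dil (1 / r))" "linear (dil r)" for r by (rule linear_dil)+
  show "dil (1 / r) (dil r v) = v" if "r > 0" for r v using dil_inverse that by simp
  show "((\<lambda>r. dil (1 / r) (DL (- y) x (dil r v))) \<longlongrightarrow> v) at_top" for x v by (rule dil_DL_tendsto)
  show "mul y (mul (- y) x) = x" "mul (- y) (mul y x) = x" for x by simp_all
qed

text \<open>Inversion is negation, which preserves Lebesgue measure and exchanges right with left
  translations.\<close>

lemma distr_mul_right: "distr lborel borel (\<lambda>x. mul x y) = lborel"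
proof -
  have "(\<lambda>x. mul x y) = uminus \<circ> (mul (- y) \<circ> uminus)"
    by (auto simp: neg_mul fun_eq_iff)
  moreover have "distr lborel borel (uminus \<circ> (mul (- y) \<circ> uminus)) = distr (distr (distr lborel borel uminus) borel (mul (- y))) borel uminus"
    by (subst distr_distr, measurable)+ (simp add: o_assoc)
  ultimately show ?thesis by (simp add: distr_lborel_uminus distr_mul_left)
qed

lemma nn_integral_mul_left:
  "f \<in> borel_measurable borel \<Longrightarrow> (\<integral>\<^sup>+x. f (mul y x) \<partial>lborel) = (\<integral>\<^sup>+x. f x \<partial>lborel)"
  using nn_integral_distr[of "mul y" lborel borel f] distr_mul_left by simp

lemma nn_integral_mul_right:
  "f \<in> borel_measurable borel \<Longrightarrow> (\<integral>\<^sup>+x. f (mul x y) \<partial>lborel) = (\<integral>\<^sup>+x. f x \<partial>lborel)"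
  using nn_integral_distr[of "\<lambda>x. mul x y" lborel borel f] distr_mul_right by simp

lemma nn_integral_neg:
  "f \<in> borel_measurable borel \<Longrightarrow> (\<integral>\<^sup>+x. f (- x) \<partial>lborel) = (\<integral>\<^sup>+x. f x \<partial>lborel)" for f :: "real^'n \<Rightarrow> ennreal"
  using nn_integral_distr[of uminus lborel borel f] by (simp add: distr_lborel_uminus)

end

section \<open>Local \<open>L\<^sup>q\<close> norms and averages\<close>

text \<open>If one of the two points is 0, convexity reduces to s^q \<le> s for s in (0,1).\<close>

lemma convex_on_powr_nonneg:
  assumes "1 \<le> q" shows "convex_on {0..} (\<lambda>x::real. x powr q)"
proof (rule convex_onI)
  fix t x y :: real assume t: "0 < t" "t < 1" and xy: "x \<in> {0..}" "y \<in> {0..}"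
  have z: "(s * z) powr q \<le> s * z powr q" if "0 < s" "s < 1" "z \<ge> 0" for s z :: real
  proof -
    have "s powr q \<le> s powr 1" using that assms by (intro powr_mono') auto
    then show ?thesis using that by (simp add: powr_mult mult_right_mono)
  qed
  consider "x = 0" | "y = 0" | "x > 0" "y > 0" using xy by fastforce
  then show "((1 - t) *\<^sub>R x + t *\<^sub>R y) powr q \<le> (1 - t) * x powr q + t * y powr q"
  proof cases
    case 3
    then show ?thesis using convex_onD[OF powr_convex[OF assms], of t x y] t by simp
  qed (use z[of t y] z[of "1 - t" x] t xy assms in auto)
qed simp

lemma convex_on_norm_powr:
  assumes "1 \<le> q" shows "convex_on UNIV (\<lambda>x::'a::real_normed_vector. norm x powr q)"
proof (rule convex_onI)
  fix t :: real and x y :: 'a assume t: "0 < t" "t < 1"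
  have "norm ((1 - t) *\<^sub>R x + t *\<^sub>R y) \<le> (1 - t) * norm x + t * norm y"
    using norm_triangle_ineq[of "(1 - t) *\<^sub>R x" "t *\<^sub>R y"] t by simp
  then have "norm ((1 - t) *\<^sub>R x + t *\<^sub>R y) powr q \<le> ((1 - t) * norm x + t * norm y) powr q"
    using assms by (intro powr_mono2) auto
  also have "\<dots> \<le> (1 - t) * norm x powr q + t * norm y powr q"
    using convex_onD[OF convex_on_powr_nonneg[OF assms], of t "norm x" "norm y"] t by simp
  finally show "norm ((1 - t) *\<^sub>R x + t *\<^sub>R y) powr q \<le> (1 - t) * norm x powr q + t * norm y powr q" .
qed simp

text \<open>Convexity at the points x/(1-t) and y/t. As t tends to 0 the factor of the first summand
  tends to 1; this is how strict inequalities survive a small perturbation, in place of Minkowski's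
  inequality.\<close>

lemma norm_add_powr_le:
  fixes x y :: "'a::real_normed_vector"
  assumes "1 \<le> q" "0 < t" "t < 1"
  shows "norm (x + y) powr q \<le> (1 - t) powr (1 - q) * norm x powr q + t powr (1 - q) * norm y powr q"
proof -
  have s: "s * norm ((1 / s) *\<^sub>R z) powr q = s powr (1 - q) * norm z powr q" if "s > 0" for s and z :: 'a
    using that by (simp add: powr_divide powr_diff)
  have "norm (x + y) powr q = norm ((1 - t) *\<^sub>R ((1 / (1 - t)) *\<^sub>R x) + t *\<^sub>R ((1 / t) *\<^sub>R y)) powr q"
    using assms by simp
  also have "\<dots> \<le> (1 - t) * norm ((1 / (1 - t)) *\<^sub>R x) powr q + t * norm ((1 / t) *\<^sub>R y) powr q"
    using assms by (intro convex_onD[OF convex_on_norm_powr[OF assms(1)]]) auto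
  finally show ?thesis using assms s[of "1 - t" x] s[of t y] by simp
qed

text \<open>The q-th power of the seminorm on \<open>K\<close>. Being extended-valued it can be
  estimated without integrability, and with \<open>lborel\<close> it is open to Tonelli's theorem
  and to translations.\<close>

definition Lint :: "real \<Rightarrow> 'a::euclidean_space set \<Rightarrow> ('a \<Rightarrow> 'b::euclidean_space) \<Rightarrow> ennreal" where
  "Lint q K u = (\<integral>\<^sup>+x\<in>K. ennreal (norm (u x) powr q) \<partial>lborel)"

text \<open>The Borel representatives of local \<open>L^q\<close> on the whole space, also with
  vector values because gradients are treated in the same way.\<close>

definition Lqloc :: "real \<Rightarrow> ('a::euclidean_space \<Rightarrow> 'b::euclidean_space) \<Rightarrow> bool" where
  "Lqloc q u \<longleftrightarrow> u \<in> borel_measurable borel \<and> (\<forall>K. compact K \<longrightarrow> Lint q K u < \<infinity>)"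

lemma Lint_mono:
  "K \<subseteq> K' \<Longrightarrow> (\<And>x. x \<in> K \<Longrightarrow> norm (u x) \<le> norm (v x)) \<Longrightarrow> 0 \<le> q \<Longrightarrow> Lint q K u \<le> Lint q K' v"
  unfolding Lint_def by (rule nn_integral_mono) (auto split: split_indicator intro!: ennreal_leI powr_mono2)

lemma Lint_add:
  fixes u v :: "'a::euclidean_space \<Rightarrow> 'b::euclidean_space"
  assumes [measurable]: "u \<in> borel_measurable borel" "v \<in> borel_measurable borel" "K \<in> sets borel"
    and q: "1 \<le> q" and t: "0 < t" "t < 1"
  shows "Lint q K (\<lambda>x. u x + v x) \<le> ennreal ((1 - t) powr (1 - q)) * Lint q K u + ennreal (t powr (1 - q)) * Lint q K v"
proof -
  have "Lint q K (\<lambda>x. u x + v x) \<le> (\<integral>\<^sup>+x. ennreal ((1 - t) powr (1 - q)) * (ennreal (norm (u x) powr q) * indicator K x)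
      + ennreal (t powr (1 - q)) * (ennreal (norm (v x) powr q) * indicator K x) \<partial>lborel)"
    unfolding Lint_def
  proof (rule nn_integral_mono)
    fix x
    have "ennreal (norm (u x + v x) powr q) \<le> ennreal ((1 - t) powr (1 - q) * norm (u x) powr q + t powr (1 - q) * norm (v x) powr q)"
      by (intro ennreal_leI norm_add_powr_le q t)
    then show "ennreal (norm (u x + v x) powr q) * indicator K x \<le> ennreal ((1 - t) powr (1 - q)) * (ennreal (norm (u x) powr q) * indicator K x)
      + ennreal (t powr (1 - q)) * (ennreal (norm (v x) powr q) * indicator K x)"
      by (auto simp: ennreal_mult split: split_indicator)
  qed
  also have "\<dots> = ennreal ((1 - t) powr (1 - q)) * Lint q K u + ennreal (t powr (1 - q)) * Lint q K v"
    unfolding Lint_def by (simp add: nn_integral_add nn_integral_cmult)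
  finally show ?thesis .
qed

lemma Lint_add_2:
  fixes u v :: "'a::euclidean_space \<Rightarrow> 'b::euclidean_space"
  assumes "u \<in> borel_measurable borel" "v \<in> borel_measurable borel" "K \<in> sets borel" "1 \<le> q"
  shows "Lint q K (\<lambda>x. u x + v x) \<le> ennreal (2 powr (q - 1)) * (Lint q K u + Lint q K v)"
proof -
  have "(1 / 2) powr (1 - q) = (2::real) powr (q - 1)" by (simp add: powr_divide powr_minus_divide[symmetric])
  then show ?thesis using Lint_add[OF assms, of "1/2"] by (simp add: distrib_left)
qed

lemma Lint_scale:
  fixes u :: "'a::euclidean_space \<Rightarrow> 'b::euclidean_space"
  assumes [measurable]: "u \<in> borel_measurable borel" "K \<in> sets borel"
  shows "Lint q K (\<lambda>x. c *\<^sub>R u x) = ennreal (\<bar>c\<bar> powr q) * Lint q K u"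
  unfolding Lint_def by (subst nn_integral_cmult[symmetric]) (auto simp: powr_mult ennreal_mult mult.assoc intro!: nn_integral_cong)

lemma Lint_1_le:
  fixes u :: "'a::euclidean_space \<Rightarrow> 'b::euclidean_space"
  assumes [measurable]: "u \<in> borel_measurable borel" "K \<in> sets borel" and q: "1 \<le> q"
  shows "Lint 1 K u \<le> emeasure lborel K + Lint q K u"
proof -
  have "norm (u x) \<le> 1 + norm (u x) powr q" for x
  proof (cases "norm (u x) \<le> 1")
    case False
    then have "norm (u x) powr 1 \<le> norm (u x) powr q" by (intro powr_mono q) auto
    then show ?thesis by simp
  qed (simp add: add_increasing2)
  then have "ennreal (norm (u x)) \<le> 1 + ennreal (norm (u x) powr q)" for x
    by (metis ennreal_1 ennreal_leI ennreal_plus powr_ge_zero zero_le_one)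
  then have "Lint 1 K u \<le> (\<integral>\<^sup>+x. indicator K x + ennreal (norm (u x) powr q) * indicator K x \<partial>lborel)"
    unfolding Lint_def by (intro nn_integral_mono) (auto split: split_indicator)
  also have "\<dots> = emeasure lborel K + Lint q K u"
    unfolding Lint_def by (subst nn_integral_add) auto
  finally show ?thesis .
qed

lemma emeasure_compact_finite: "compact K \<Longrightarrow> emeasure lborel K < \<infinity>" for K :: "'a::euclidean_space set"
  using emeasure_bounded_finite[of K] compact_imp_bounded by auto

lemma Lqloc_1: "Lqloc q u \<Longrightarrow> 1 \<le> q \<Longrightarrow> Lqloc 1 u"
  unfolding Lqloc_def
  by (metis Lint_1_le emeasure_compact_finite ennreal_add_eq_top infinity_ennreal_def compact_imp_closed borel_closed order_le_less_trans top.not_eq_extremum)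

lemma Lqloc_measurable: "Lqloc q u \<Longrightarrow> u \<in> borel_measurable borel"
  by (simp add: Lqloc_def)

lemma Lqloc_add: "Lqloc q u \<Longrightarrow> Lqloc q v \<Longrightarrow> 1 \<le> q \<Longrightarrow> Lqloc q (\<lambda>x. u x + v x)"
  unfolding Lqloc_def
proof (intro conjI allI impI)
  fix K :: "'a set"
  assume a: "u \<in> borel_measurable borel \<and> (\<forall>K. compact K \<longrightarrow> Lint q K u < \<infinity>)"
    "v \<in> borel_measurable borel \<and> (\<forall>K. compact K \<longrightarrow> Lint q K v < \<infinity>)" "1 \<le> q" "compact K"
  then have "ennreal (2 powr (q - 1)) * (Lint q K u + Lint q K v) < \<infinity>"
    by (simp add: ennreal_mult_less_top)
  then show "Lint q K (\<lambda>x. u x + v x) < \<infinity>"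
    using Lint_add_2[of u v K q] a by (simp add: borel_closed compact_imp_closed order_le_less_trans)
qed (auto intro: borel_measurable_add)

lemma Lqloc_scale: "Lqloc q u \<Longrightarrow> Lqloc q (\<lambda>x. c *\<^sub>R u x)"
  unfolding Lqloc_def
  by (auto simp: Lint_scale borel_closed compact_imp_closed ennreal_mult_less_top)

lemma Lqloc_continuous: "continuous_on UNIV u \<Longrightarrow> 0 \<le> q \<Longrightarrow> Lqloc q u"
  unfolding Lqloc_def
proof (intro conjI allI impI)
  assume u: "continuous_on UNIV u" and q: "0 \<le> q"
  show "u \<in> borel_measurable borel" using u by (rule borel_measurable_continuous_onI)
  fix K :: "'a set" assume K: "compact K"
  then obtain C where C: "\<And>x. x \<in> K \<Longrightarrow> norm (u x) \<le> C"
    using compact_imp_bounded[OF compact_continuous_image[OF continuous_on_subset[OF u] K]] by (auto simp: bounded_iff)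
  have "Lint q K u \<le> (\<integral>\<^sup>+x. ennreal (C powr q) * indicator K x \<partial>lborel)"
    unfolding Lint_def by (intro nn_integral_mono) (auto split: split_indicator intro!: ennreal_leI powr_mono2 q C)
  also have "\<dots> = ennreal (C powr q) * emeasure lborel K"
    using K by (simp add: nn_integral_cmult_indicator borel_closed compact_imp_closed)
  finally show "Lint q K u < \<infinity>"
    using emeasure_compact_finite[OF K] by (simp add: ennreal_mult_less_top order_le_less_trans)
qed

lemma ennreal_between_zero:
  assumes "0 < e" obtains r where "0 < r" "ennreal r < e"
proof -
  obtain z where z: "0 < z" "z < e" using dense[OF assms] by blast
  then have "z < top" by (metis less_top order_less_trans top.not_eq_extremum)
  then have "z = ennreal (enn2real z)" by simp
  then show ?thesis using z that[of "enn2real z"] by (metis ennreal_less_zero_iff)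
qed

text \<open>Truncation reduces to bounded functions, for which a.e. continuous approximations are clamped to
  the same bound.\<close>

lemma Lint_approx_continuous:
  fixes u :: "'a::euclidean_space \<Rightarrow> 'b::euclidean_space"
  assumes u[measurable]: "u \<in> borel_measurable borel" and K: "compact K" and fin: "Lint q K u < \<infinity>"
    and q: "1 \<le> q" and e: "e > 0"
  obtains v where "continuous_on UNIV v" "Lint q K (\<lambda>x. u x - v x) < e"
proof -
  have [measurable]: "K \<in> sets borel" using K by (simp add: borel_closed compact_imp_closed)
  define w where "w = (\<lambda>n x. if norm (u x) \<le> real n then u x else 0)"
  have [measurable]: "w n \<in> borel_measurable borel" for n unfolding w_def by measurable
  obtain r where r: "0 < r" "ennreal r < e" using ennreal_between_zero[OF e] .
  \<comment> \<open>The factor in \<open>Lint_add_2\<close>. Two errors below r/(2c) add up, after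
    multiplication with c, to at most r.\<close>
  define c where "c = (2::real) powr (q - 1)"
  have c: "c > 0" by (simp add: c_def)
  define e' where "e' = ennreal (r / (2 * c))"
  have e': "e' > 0" using r c by (simp add: e'_def)
  have e'e: "ennreal c * (a + b) < e" if "a < e'" "b < e'" for a b
  proof -
    have "ennreal c * (a + b) \<le> ennreal c * (e' + e')"
      using that by (intro mult_left_mono add_mono) auto
    also have "e' + e' = ennreal (r / c)"
      using r c by (simp add: e'_def ennreal_plus[symmetric] del: ennreal_plus)
    also have "ennreal c * ennreal (r / c) = ennreal r"
      using r c by (simp add: ennreal_mult[symmetric])
    finally show ?thesis using r by simp
  qed
  have "(\<lambda>n. \<integral>\<^sup>+x. ennreal (norm (u x - w n x) powr q) * indicator K x \<partial>lborel) \<longlonglongrightarrow> (\<integral>\<^sup>+x. 0 \<partial>(lborel::'a measure))"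
  proof (rule nn_integral_dominated_convergence[where w = "\<lambda>x. ennreal (norm (u x) powr q) * indicator K x"])
    show "AE x in lborel. ennreal (norm (u x - w n x) powr q) * indicator K x \<le> ennreal (norm (u x) powr q) * indicator K x" for n
      by (auto simp: w_def split: split_indicator)
    show "AE x in lborel. (\<lambda>n. ennreal (norm (u x - w n x) powr q) * indicator K x) \<longlonglongrightarrow> 0"
    proof (rule AE_I2, rule tendsto_eventually)
      fix x
      obtain n0 where "norm (u x) \<le> real n0" using real_arch_simple by blast
      then have "\<forall>n\<ge>n0. w n x = u x" by (auto simp: w_def)
      then show "eventually (\<lambda>n. ennreal (norm (u x - w n x) powr q) * indicator K x = 0) sequentially"
        unfolding eventually_sequentially by (intro exI[of _ n0]) (use q in simp)
    qed
  qed (use fin in \<open>simp_all add: Lint_def\<close>)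
  then have "(\<lambda>n. Lint q K (\<lambda>x. u x - w n x)) \<longlonglongrightarrow> 0" by (simp add: Lint_def)
  then have "eventually (\<lambda>n. Lint q K (\<lambda>x. u x - w n x) < e') sequentially"
    using e' by (simp add: order_tendsto_iff)
  then obtain n where n: "Lint q K (\<lambda>x. u x - w n x) < e'" by (auto simp: eventually_sequentially)
  have "w n \<in> borel_measurable lebesgue" by (simp add: measurable_completion)
  from lebesgue_measurable_imp_measurable_on[OF this, of UNIV]
  obtain N g where N: "negligible N" and g: "\<And>i. continuous_on UNIV (g i)" and lim: "\<And>x. x \<notin> N \<Longrightarrow> (\<lambda>i. g i x) \<longlonglongrightarrow> w n x"
    unfolding measurable_on_def by auto
  define C where "C = cball (0::'b) (real n)"
  have C: "convex C" "closed C" "C \<noteq> {}" by (auto simp: C_def)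
  have wC: "w n x \<in> C" for x by (auto simp: w_def C_def)
  define v where "v = (\<lambda>i x. closest_point C (g i x))"
  have vc: "continuous_on UNIV (v i)" for i unfolding v_def
    using continuous_on_compose2[OF continuous_on_closest_point[OF C, of UNIV] g] by auto
  then have [measurable]: "v i \<in> borel_measurable borel" for i by (rule borel_measurable_continuous_onI)
  have AEN: "AE x in lborel. x \<notin> N"
    using N by (metis AE_completion_iff AE_not_in negligible_iff_null_sets)
  have "(\<lambda>i. \<integral>\<^sup>+x. ennreal (norm (w n x - v i x) powr q) * indicator K x \<partial>lborel) \<longlonglongrightarrow> (\<integral>\<^sup>+x. 0 \<partial>(lborel::'a measure))"
  proof (rule nn_integral_dominated_convergence[where w = "\<lambda>x. ennreal ((2 * real n) powr q) * indicator K x"])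
    have "norm (w n x - v i x) \<le> 2 * real n" for i x
    proof -
      have "v i x \<in> C" unfolding v_def using C(2,3) by (rule closest_point_in_set)
      then show ?thesis using wC[of x] norm_triangle_ineq4[of "w n x" "v i x"] by (auto simp: C_def)
    qed
    then show "AE x in lborel. ennreal (norm (w n x - v i x) powr q) * indicator K x \<le> ennreal ((2 * real n) powr q) * indicator K x" for i
      using q by (auto split: split_indicator intro!: ennreal_leI powr_mono2)
    show "AE x in lborel. (\<lambda>i. ennreal (norm (w n x - v i x) powr q) * indicator K x) \<longlonglongrightarrow> 0"
      using AEN
    proof eventually_elim
      fix x assume x: "x \<notin> N"
      have "(\<lambda>i. v i x) \<longlonglongrightarrow> closest_point C (w n x)"
        unfolding v_def using continuous_on_tendsto_compose[OF continuous_on_closest_point[OF C, of UNIV] lim[OF x]] by simp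
      then have "(\<lambda>i. v i x) \<longlonglongrightarrow> w n x" using closest_point_self[OF wC] by simp
      then have "(\<lambda>i. norm (w n x - v i x)) \<longlonglongrightarrow> 0"
        using tendsto_norm[OF tendsto_diff[OF tendsto_const[of "w n x"]], of "\<lambda>i. v i x" "w n x"] by simp
      then have "(\<lambda>i. norm (w n x - v i x) powr q) \<longlonglongrightarrow> 0"
        using q by (intro tendsto_zero_powrI[where b = q]) auto
      then have "(\<lambda>i. ennreal (norm (w n x - v i x) powr q)) \<longlonglongrightarrow> ennreal 0" by (rule tendsto_ennrealI)
      then show "(\<lambda>i. ennreal (norm (w n x - v i x) powr q) * indicator K x) \<longlonglongrightarrow> 0"
        by (auto split: split_indicator)
    qed
    show "(\<integral>\<^sup>+x. ennreal ((2 * real n) powr q) * indicator K x \<partial>lborel) < \<infinity>"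
      using emeasure_compact_finite[OF K] by (simp add: nn_integral_cmult_indicator ennreal_mult_less_top)
  qed simp_all
  then have "(\<lambda>i. Lint q K (\<lambda>x. w n x - v i x)) \<longlonglongrightarrow> 0" by (simp add: Lint_def)
  then have "eventually (\<lambda>i. Lint q K (\<lambda>x. w n x - v i x) < e') sequentially"
    using e' by (simp add: order_tendsto_iff)
  then obtain i where i: "Lint q K (\<lambda>x. w n x - v i x) < e'" by (auto simp: eventually_sequentially)
  have "Lint q K (\<lambda>x. u x - v i x) = Lint q K (\<lambda>x. (u x - w n x) + (w n x - v i x))" by simp
  also have "\<dots> \<le> ennreal (2 powr (q - 1)) * (Lint q K (\<lambda>x. u x - w n x) + Lint q K (\<lambda>x. w n x - v i x))"
    by (rule Lint_add_2) (use q in measurable)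
  also have "\<dots> < e" using e'e[OF n i] by (simp add: c_def)
  finally show ?thesis using vc that by blast
qed

section \<open>Jensen's inequality and averages\<close>

text \<open>The point formed by the mean of \<open>h\<close> and the mean of f(h) lies in the
  epigraph of \<open>f\<close>, which is closed and convex: a separating hyperplane, integrated
  against \<rho>, would contradict itself. If the right side is infinite nothing is claimed.\<close>

lemma jensen_density:
  fixes f :: "'b::euclidean_space \<Rightarrow> real" and h :: "'a::euclidean_space \<Rightarrow> 'b"
  assumes cvx: "convex_on UNIV f" and pos: "\<And>z. 0 \<le> f z"
    and \<rho>[measurable]: "\<rho> \<in> borel_measurable borel" and \<rho>0: "\<And>y. 0 \<le> \<rho> y" and \<rho>1: "(\<integral>\<^sup>+y. ennreal (\<rho> y) \<partial>lborel) = 1"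
    and [measurable]: "h \<in> borel_measurable borel" and int: "integrable lborel (\<lambda>y. \<rho> y *\<^sub>R h y)"
  shows "ennreal (f (\<integral>y. \<rho> y *\<^sub>R h y \<partial>lborel)) \<le> (\<integral>\<^sup>+y. ennreal (\<rho> y) * ennreal (f (h y)) \<partial>lborel)"
proof (cases "(\<integral>\<^sup>+y. ennreal (\<rho> y) * ennreal (f (h y)) \<partial>lborel) < \<infinity>")
  case True
  have fc: "continuous_on UNIV f" using convex_on_continuous[OF open_UNIV cvx] .
  then have [measurable]: "f \<in> borel_measurable borel" by (rule borel_measurable_continuous_onI)
  have i1: "integrable lborel \<rho>" "(\<integral>y. \<rho> y \<partial>lborel) = 1"
    using \<rho>1 \<rho>0 by (auto intro!: integrableI_nonneg simp: integral_eq_nn_integral)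
  have i2: "integrable lborel (\<lambda>y. \<rho> y * f (h y))"
    using True \<rho>0 pos by (auto intro!: integrableI_nonneg simp: ennreal_mult)
  have eq: "(\<integral>\<^sup>+y. ennreal (\<rho> y) * ennreal (f (h y)) \<partial>lborel) = ennreal (\<integral>y. \<rho> y * f (h y) \<partial>lborel)"
    using nn_integral_eq_integral[OF i2] \<rho>0 pos by (simp add: ennreal_mult)
  define P where "P = (\<integral>y. \<rho> y *\<^sub>R h y \<partial>lborel, \<integral>y. \<rho> y * f (h y) \<partial>lborel)"
  have "P \<in> epigraph UNIV f"
  proof (rule ccontr)
    assume "P \<notin> epigraph UNIV f"
    moreover have "convex (epigraph UNIV f)" using cvx by (simp add: convex_epigraph)
    moreover have "closed (epigraph UNIV f)"
    proof -
      have "continuous_on UNIV (\<lambda>p. f (fst p))" "continuous_on UNIV (\<lambda>p. snd p :: real)"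
        by (auto intro!: continuous_intros continuous_on_compose2[OF fc])
      then have "closed {p. f (fst p) \<le> snd p}" by (rule closed_Collect_le)
      then show ?thesis by (simp add: epigraph_def)
    qed
    ultimately obtain a b where ab: "inner a P < b" "\<And>x. x \<in> epigraph UNIV f \<Longrightarrow> inner a x > b"
      using separating_hyperplane_closed_point[of "epigraph UNIV f" P] by blast
    have i3: "integrable lborel (\<lambda>y. fst a \<bullet> (\<rho> y *\<^sub>R h y) + snd a * (\<rho> y * f (h y)))"
      by (intro Bochner_Integration.integrable_add integrable_inner_right integrable_mult_right int i2)
    have "b = (\<integral>y. \<rho> y * b \<partial>lborel)" using i1 by simp
    also have "\<dots> \<le> (\<integral>y. fst a \<bullet> (\<rho> y *\<^sub>R h y) + snd a * (\<rho> y * f (h y)) \<partial>lborel)"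
    proof (rule integral_mono[OF _ i3])
      fix y
      have "b < inner a (h y, f (h y))" using ab(2) by (simp add: epigraph_def)
      then have "\<rho> y * b \<le> \<rho> y * inner a (h y, f (h y))" using \<rho>0 by (intro mult_left_mono) auto
      then show "\<rho> y * b \<le> fst a \<bullet> (\<rho> y *\<^sub>R h y) + snd a * (\<rho> y * f (h y))"
        by (simp add: inner_prod_def algebra_simps)
    qed (use i1 in simp)
    also have "\<dots> = inner a P"
      by (subst Bochner_Integration.integral_add[OF integrable_inner_right[OF int] integrable_mult_right[OF i2]])
         (simp only: integral_inner_right[OF int] Bochner_Integration.integral_mult_right_zero P_def inner_prod_def inner_real_def fst_conv snd_conv)
    finally show False using ab(1) by simp
  qed
  then show ?thesis by (simp add: eq P_def epigraph_def ennreal_leI)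
qed (simp add: top.not_eq_extremum[symmetric])

definition prob_weight :: "('a::euclidean_space \<Rightarrow> real) \<Rightarrow> bool" where
  "prob_weight \<rho> \<longleftrightarrow> \<rho> \<in> borel_measurable borel \<and> (\<forall>y. 0 \<le> \<rho> y) \<and> (\<integral>\<^sup>+y. ennreal (\<rho> y) \<partial>lborel) = 1"

lemma prob_weight_integral: "prob_weight \<rho> \<Longrightarrow> integrable lborel \<rho>" "prob_weight \<rho> \<Longrightarrow> (\<integral>y. \<rho> y \<partial>lborel) = 1"
  unfolding prob_weight_def by (auto intro!: integrableI_nonneg simp: integral_eq_nn_integral)

lemma sigma_pair_lborel: "pair_sigma_finite (lborel :: 'a::euclidean_space measure) (lborel :: 'b::euclidean_space measure)"
  by unfold_locales

text \<open>Jensen's inequality for the q-th power of the norm at each point, then Tonelli. Where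
  the inner integral does not exist its value is 0 by default, and the estimate still holds.\<close>

lemma Lint_average:
  fixes H :: "'a::euclidean_space \<Rightarrow> 'c::euclidean_space \<Rightarrow> 'b::euclidean_space"
  assumes H[measurable]: "(\<lambda>(x, y). H x y) \<in> borel_measurable (borel \<Otimes>\<^sub>M borel)" and \<rho>: "prob_weight \<rho>" and q: "1 \<le> q"
    and K[measurable]: "K \<in> sets borel"
  shows "Lint q K (\<lambda>x. \<integral>y. \<rho> y *\<^sub>R H x y \<partial>lborel) \<le> (\<integral>\<^sup>+y. ennreal (\<rho> y) * Lint q K (\<lambda>x. H x y) \<partial>lborel)"
proof -
  have [measurable]: "\<rho> \<in> borel_measurable borel" using \<rho> by (simp add: prob_weight_def)
  have "Lint q K (\<lambda>x. \<integral>y. \<rho> y *\<^sub>R H x y \<partial>lborel) \<le> (\<integral>\<^sup>+x. (\<integral>\<^sup>+y. ennreal (\<rho> y) * (ennreal (norm (H x y) powr q) * indicator K x) \<partial>lborel) \<partial>lborel)"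
    unfolding Lint_def
  proof (rule nn_integral_mono)
    fix x :: 'a
    have [measurable]: "H x \<in> borel_measurable borel" using measurable_Pair2[OF H, of x] by simp
    have "ennreal (norm (\<integral>y. \<rho> y *\<^sub>R H x y \<partial>lborel) powr q) \<le> (\<integral>\<^sup>+y. ennreal (\<rho> y) * ennreal (norm (H x y) powr q) \<partial>lborel)"
    proof (cases "integrable lborel (\<lambda>y. \<rho> y *\<^sub>R H x y)")
      case True
      show ?thesis
        by (rule jensen_density[OF convex_on_norm_powr[OF q] _ _ _ _ _ True])
           (use \<rho> in \<open>auto simp: prob_weight_def\<close>)
    qed (simp add: not_integrable_integral_eq)
    then show "ennreal (norm (\<integral>y. \<rho> y *\<^sub>R H x y \<partial>lborel) powr q) * indicator K x
      \<le> (\<integral>\<^sup>+y. ennreal (\<rho> y) * (ennreal (norm (H x y) powr q) * indicator K x) \<partial>lborel)"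
      by (auto split: split_indicator)
  qed
  also have "\<dots> = (\<integral>\<^sup>+y. (\<integral>\<^sup>+x. ennreal (\<rho> y) * (ennreal (norm (H x y) powr q) * indicator K x) \<partial>lborel) \<partial>lborel)"
    by (rule pair_sigma_finite.Fubini'[OF sigma_pair_lborel, symmetric]) (unfold split_beta', measurable)
  also have "\<dots> = (\<integral>\<^sup>+y. ennreal (\<rho> y) * Lint q K (\<lambda>x. H x y) \<partial>lborel)"
    unfolding Lint_def
  proof (rule nn_integral_cong)
    fix y :: 'c
    have [measurable]: "(\<lambda>x. H x y) \<in> borel_measurable borel" using measurable_Pair1[OF H, of y] by simp
    show "(\<integral>\<^sup>+x. ennreal (\<rho> y) * (ennreal (norm (H x y) powr q) * indicator K x) \<partial>lborel) =
       ennreal (\<rho> y) * (\<integral>\<^sup>+x. ennreal (norm (H x y) powr q) * indicator K x \<partial>lborel)"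
      by (rule nn_integral_cmult) measurable
  qed
  finally show ?thesis .
qed

section \<open>Convolution on the group\<close>

context carnot_group
begin

section \<open>Translations in local L^q\<close>

text \<open>The domain of dependence: values on \<open>K\<close> of a convolution whose kernel is
  supported in \<open>B\<close> only involve the function on this set.\<close>

definition tset :: "(real^'n) set \<Rightarrow> (real^'n) set \<Rightarrow> (real^'n) set" where
  "tset B K = (\<lambda>(y, x). mul (- y) x) ` (B \<times> K)"

lemma tsetI: "y \<in> B \<Longrightarrow> x \<in> K \<Longrightarrow> mul (- y) x \<in> tset B K"
  by (auto simp: tset_def)

lemma compact_tset: "compact B \<Longrightarrow> compact K \<Longrightarrow> compact (tset B K)"
  unfolding tset_def split_beta' by (intro compact_continuous_image compact_Times continuous_intros)

lemma Lint_translate_le: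
  fixes u :: "real^'n \<Rightarrow> 'b::euclidean_space"
  assumes [measurable]: "u \<in> borel_measurable borel" "K' \<in> sets borel" and sub: "\<And>x. x \<in> K \<Longrightarrow> mul y x \<in> K'"
  shows "Lint q K (\<lambda>x. u (mul y x)) \<le> Lint q K' u"
proof -
  have "Lint q K (\<lambda>x. u (mul y x)) \<le> (\<integral>\<^sup>+x. ennreal (norm (u (mul y x)) powr q) * indicator K' (mul y x) \<partial>lborel)"
    unfolding Lint_def by (intro nn_integral_mono) (auto split: split_indicator dest: sub)
  also have "\<dots> = Lint q K' u"
    unfolding Lint_def by (rule nn_integral_mul_left[of "\<lambda>x. ennreal (norm (u x) powr q) * indicator K' x"]) measurable
  finally show ?thesis .
qed

lemma Lqloc_translate:
  fixes u :: "real^'n \<Rightarrow> 'b::euclidean_space"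
  assumes u: "Lqloc q u" shows "Lqloc q (\<lambda>x. u (mul y x))"
  unfolding Lqloc_def
proof (intro conjI allI impI)
  have [measurable]: "u \<in> borel_measurable borel" using u by (rule Lqloc_measurable)
  show "(\<lambda>x. u (mul y x)) \<in> borel_measurable borel" by measurable
  fix K :: "(real^'n) set" assume K: "compact K"
  have "compact (mul y ` K)" by (intro compact_continuous_image K continuous_intros)
  then show "Lint q K (\<lambda>x. u (mul y x)) < \<infinity>"
    using Lint_translate_le[of u "mul y ` K" K y q] u
    by (auto simp: Lqloc_def borel_closed compact_imp_closed intro: order_le_less_trans)
qed

text \<open>Three-term estimate through a continuous approximation \<open>v\<close>. Group
  translations are not uniformly close to the identity on unbounded sets, so compactness in
  \<open>(y, x)\<close> jointly provides the uniform continuity of v(y^-1 x).\<close>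

lemma translation_continuity:
  fixes u :: "real^'n \<Rightarrow> 'b::euclidean_space"
  assumes u: "Lqloc q u" and K: "compact K" and q: "1 \<le> q" and e: "e > 0"
  shows "\<exists>d>0. \<forall>y. norm y < d \<longrightarrow> Lint q K (\<lambda>x. u (mul (- y) x) - u x) < e"
proof -
  have um[measurable]: "u \<in> borel_measurable borel" using u by (rule Lqloc_measurable)
  have Kb[measurable]: "K \<in> sets borel" using K by (simp add: borel_closed compact_imp_closed)
  define K' where "K' = tset (cball 0 1) K"
  have K': "compact K'" unfolding K'_def by (intro compact_tset K) simp
  then have K'b[measurable]: "K' \<in> sets borel" by (simp add: borel_closed compact_imp_closed)
  have sub: "mul (- y) x \<in> K'" if "norm y \<le> 1" "x \<in> K" for x y
    using that by (auto simp: K'_def intro!: tsetI)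
  obtain r where r: "0 < r" "ennreal r < e" using ennreal_between_zero[OF e] .
  define c where "c = (2::real) powr (q - 1)"
  have c: "c > 0" by (simp add: c_def)
  \<comment> \<open>Two nested uses of \<open>Lint_add_2\<close> with three errors of size r1 give c
    (r1 + c (r1 + r1)), which this choice makes equal to r.\<close>
  define r1 where "r1 = r / (c * (1 + 2 * c))"
  have r1: "r1 > 0" using r c by (simp add: r1_def)
  obtain v where vc: "continuous_on UNIV v" and v: "Lint q K' (\<lambda>x. u x - v x) < ennreal r1"
    using Lint_approx_continuous[OF um K' _ q, of "ennreal r1"] u K' r1 unfolding Lqloc_def by auto
  have vm[measurable]: "v \<in> borel_measurable borel" using vc by (rule borel_measurable_continuous_onI)
  define m where "m = measure lborel K"
  have m: "emeasure lborel K = ennreal m" "m \<ge> 0"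
    using emeasure_compact_finite[OF K] by (simp_all add: m_def emeasure_eq_ennreal_measure top.not_eq_extremum)
  \<comment> \<open>Makes \<epsilon>^q times the measure of \<open>K\<close> at most r1; the summand
    1 covers null sets \<open>K\<close>.\<close>
  define \<epsilon> where "\<epsilon> = (r1 / (m + 1)) powr (1 / q)"
  have \<epsilon>: "\<epsilon> > 0" "\<epsilon> powr q = r1 / (m + 1)" using r1 m q by (simp_all add: \<epsilon>_def powr_powr)
  have "uniformly_continuous_on (cball 0 1 \<times> K) (\<lambda>z. v (mul (- fst z) (snd z)))"
    by (intro compact_uniformly_continuous compact_Times K compact_cball continuous_on_compose2[OF vc] continuous_intros) simp
  then obtain d0 where d0: "d0 > 0" "\<And>z z'. z \<in> cball 0 1 \<times> K \<Longrightarrow> z' \<in> cball 0 1 \<times> K \<Longrightarrow> dist z' z < d0 \<Longrightarrow>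
      dist (v (mul (- fst z') (snd z'))) (v (mul (- fst z) (snd z))) < \<epsilon>"
    using \<epsilon>(1) unfolding uniformly_continuous_on_def by metis
  show ?thesis
  proof (intro exI[of _ "min d0 1"] conjI allI impI)
    show "0 < min d0 1" using d0 by simp
    fix y :: "real^'n" assume y: "norm y < min d0 1"
    have vv: "norm (v (mul (- y) x) - v x) \<le> \<epsilon>" if "x \<in> K" for x
      using d0(2)[of "(0, x)" "(y, x)"] y that by (simp add: dist_Pair_Pair dist_norm less_imp_le)
    have 1: "Lint q K (\<lambda>x. u (mul (- y) x) - v (mul (- y) x)) \<le> ennreal r1"
      using Lint_translate_le[of "\<lambda>x. u x - v x" K' K "- y" q] sub[of y] y v by simp
    have "Lint q K (\<lambda>x. v (mul (- y) x) - v x) \<le> (\<integral>\<^sup>+x. ennreal (\<epsilon> powr q) * indicator K x \<partial>lborel)"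
      unfolding Lint_def using q by (intro nn_integral_mono) (auto split: split_indicator intro!: ennreal_leI powr_mono2 vv)
    also have "\<dots> = ennreal (r1 / (m + 1) * m)" using m r1 by (simp add: nn_integral_cmult_indicator \<epsilon> ennreal_mult[symmetric])
    also have "\<dots> \<le> ennreal r1" using m r1 by (intro ennreal_leI) (simp add: field_simps)
    finally have 2: "Lint q K (\<lambda>x. v (mul (- y) x) - v x) \<le> ennreal r1" .
    have "Lint q K (\<lambda>x. v x - u x) \<le> Lint q K' (\<lambda>x. u x - v x)"
      using sub[of 0] q by (intro Lint_mono) (auto simp: norm_minus_commute)
    then have 3: "Lint q K (\<lambda>x. v x - u x) \<le> ennreal r1" using v by simp
    have "Lint q K (\<lambda>x. u (mul (- y) x) - u x) =
      Lint q K (\<lambda>x. (u (mul (- y) x) - v (mul (- y) x)) + ((v (mul (- y) x) - v x) + (v x - u x)))" by simp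
    also have "\<dots> \<le> ennreal c * (Lint q K (\<lambda>x. u (mul (- y) x) - v (mul (- y) x)) + Lint q K (\<lambda>x. (v (mul (- y) x) - v x) + (v x - u x)))"
      unfolding c_def by (rule Lint_add_2) (use q in measurable)
    also have "\<dots> \<le> ennreal c * (ennreal r1 + ennreal c * (ennreal r1 + ennreal r1))"
    proof (intro mult_left_mono add_mono 1)
      have "Lint q K (\<lambda>x. (v (mul (- y) x) - v x) + (v x - u x)) \<le>
          ennreal c * (Lint q K (\<lambda>x. v (mul (- y) x) - v x) + Lint q K (\<lambda>x. v x - u x))"
        unfolding c_def by (rule Lint_add_2) (use q in measurable)
      also have "\<dots> \<le> ennreal c * (ennreal r1 + ennreal r1)" by (intro mult_left_mono add_mono 2 3) auto
      finally show "Lint q K (\<lambda>x. (v (mul (- y) x) - v x) + (v x - u x)) \<le> ennreal c * (ennreal r1 + ennreal r1)" .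
    qed auto
    also have "\<dots> = ennreal (c * (r1 + c * (r1 + r1)))"
      using c r1 by (simp add: ennreal_mult[symmetric] ennreal_plus[symmetric] del: ennreal_plus)
    also have "c * (r1 + c * (r1 + r1)) = r1 * (c * (1 + 2 * c))" by (simp add: algebra_simps)
    also have "\<dots> = r" unfolding r1_def using c by (simp add: add_pos_pos less_imp_neq[symmetric])
    finally show "Lint q K (\<lambda>x. u (mul (- y) x) - u x) < e" using r by simp
  qed
qed

section \<open>Mollifiers and regularisation\<close>

text \<open>Continuity of the kernel is enough: regularised functions are differentiated only in the
  weak sense, and their gradients need to be continuous, not smooth.\<close>

definition mollifier :: "real \<Rightarrow> (real^'n \<Rightarrow> real) \<Rightarrow> bool" where
  "mollifier \<delta> \<rho> \<longleftrightarrow> continuous_on UNIV \<rho> \<and> prob_weight \<rho> \<and> (\<forall>y. \<delta> \<le> norm y \<longrightarrow> \<rho> y = 0)"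

text \<open>The mean of the left translates of \<open>u\<close>. Left translates are the ones that
  commute with left-invariant fields and with the functional.\<close>

definition conv :: "(real^'n \<Rightarrow> real) \<Rightarrow> (real^'n \<Rightarrow> 'b::euclidean_space) \<Rightarrow> real^'n \<Rightarrow> 'b" where
  "conv \<rho> u x = (\<integral>y. \<rho> y *\<^sub>R u (mul (- y) x) \<partial>lborel)"

lemma ex_mollifier:
  assumes "\<delta> > 0" obtains \<rho> where "mollifier \<delta> \<rho>"
proof -
  define t where "t = (\<lambda>y::real^'n. max 0 (\<delta> - norm y))"
  have tc: "continuous_on UNIV t" unfolding t_def by (intro continuous_intros)
  then have [measurable]: "t \<in> borel_measurable borel" by (rule borel_measurable_continuous_onI)
  define I where "I = (\<integral>\<^sup>+y. ennreal (t y) \<partial>lborel)"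
  have "I \<le> (\<integral>\<^sup>+y. ennreal \<delta> * indicator (cball (0::real^'n) \<delta>) y \<partial>lborel)"
    unfolding I_def using assms by (intro nn_integral_mono) (auto simp: t_def split: split_indicator intro!: ennreal_leI)
  also have "\<dots> < \<infinity>"
    using emeasure_compact_finite[OF compact_cball[of "0::real^'n" \<delta>]] by (simp add: nn_integral_cmult_indicator ennreal_mult_less_top)
  finally have fin: "I < \<infinity>" .
  have pos: "I > 0"
  proof -
    have "ennreal (\<delta> / 2) * emeasure lborel (ball (0::real^'n) (\<delta> / 2)) = (\<integral>\<^sup>+y. ennreal (\<delta> / 2) * indicator (ball (0::real^'n) (\<delta> / 2)) y \<partial>lborel)"
      by (simp add: nn_integral_cmult_indicator)
    also have "\<dots> \<le> I" unfolding I_def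
      using assms by (intro nn_integral_mono) (auto simp: t_def max_def split: split_indicator intro!: ennreal_leI)
    finally have "ennreal (\<delta> / 2) * emeasure lborel (ball (0::real^'n) (\<delta> / 2)) \<le> I" .
    moreover have "emeasure lborel (ball (0::real^'n) (\<delta> / 2)) > 0"
      using content_ball_pos[of "\<delta> / 2" "0::real^'n"] assms
      by (simp add: measure_def enn2real_positive_iff)
    ultimately show ?thesis using assms by (metis ennreal_zero_less_mult_iff ennreal_less_zero_iff half_gt_zero order_less_le_trans)
  qed
  define i where "i = enn2real I"
  have i: "I = ennreal i" "i > 0" using fin pos by (simp_all add: i_def enn2real_positive_iff)
  have "mollifier \<delta> (\<lambda>y. t y / i)"
    unfolding mollifier_def prob_weight_def
  proof (intro conjI allI impI)
    have "(\<integral>\<^sup>+y. ennreal (t y / i) \<partial>lborel) = (\<integral>\<^sup>+y. ennreal (1 / i) * ennreal (t y) \<partial>lborel)"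
      using i by (intro nn_integral_cong) (simp add: ennreal_mult[symmetric] t_def)
    also have "\<dots> = ennreal (1 / i) * ennreal i" by (subst nn_integral_cmult) (auto simp: I_def[symmetric] i)
    also have "\<dots> = 1" using i by (simp add: ennreal_mult[symmetric])
    finally show "(\<integral>\<^sup>+y. ennreal (t y / i) \<partial>lborel) = 1" .
  qed (use tc i in \<open>auto simp: t_def intro!: continuous_intros\<close>)
  then show ?thesis using that by blast
qed

text \<open>The map y \<mapsto> y^-1 x is inversion followed by a right translation, so invariance
  on the right is needed as well as on the left.\<close>

lemma nn_integral_reflect:
  assumes "f \<in> borel_measurable borel"
  shows "(\<integral>\<^sup>+y. f (mul (- y) x) \<partial>lborel) = (\<integral>\<^sup>+y. f y \<partial>lborel)"
proof -
  have m: "(\<lambda>y. f (mul y x)) \<in> borel_measurable borel" using assms by measurable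
  show ?thesis using nn_integral_neg[OF m] nn_integral_mul_right[OF assms] by simp
qed

lemma mollifierD:
  assumes "mollifier \<delta> \<rho>"
  shows "continuous_on UNIV \<rho>" "prob_weight \<rho>" "\<And>y. \<delta> \<le> norm y \<Longrightarrow> \<rho> y = 0" "\<rho> \<in> borel_measurable borel"
    "\<And>y. 0 \<le> \<rho> y" "(\<integral>\<^sup>+y. ennreal (\<rho> y) \<partial>lborel) = 1"
  using assms by (auto simp: mollifier_def prob_weight_def)

lemma mollifier_bounded: "mollifier \<delta> \<rho> \<Longrightarrow> \<exists>C\<ge>0. \<forall>y. \<rho> y \<le> C"
proof -
  assume \<rho>: "mollifier \<delta> \<rho>"
  have "bounded (\<rho> ` cball 0 \<delta>)"
    by (intro compact_imp_bounded compact_continuous_image continuous_on_subset[OF mollifierD(1)[OF \<rho>]] compact_cball subset_UNIV)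
  then obtain C where C: "\<And>x. x \<in> cball 0 \<delta> \<Longrightarrow> norm (\<rho> x) \<le> C"
    unfolding bounded_iff by blast
  have "\<rho> y \<le> max C 0" for y
    using C[of y] mollifierD(3)[OF \<rho>, of y] by (cases "norm y \<le> \<delta>") auto
  then show ?thesis by (intro exI[of _ "max C 0"]) auto
qed

lemma conv_integrable:
  fixes u :: "real^'n \<Rightarrow> 'b::euclidean_space"
  assumes u: "Lqloc 1 u" and \<rho>: "mollifier \<delta> \<rho>"
  shows "integrable lborel (\<lambda>y. \<rho> y *\<^sub>R u (mul (- y) x))"
proof (rule integrableI_bounded)
  have [measurable]: "u \<in> borel_measurable borel" using u by (rule Lqloc_measurable)
  have [measurable]: "\<rho> \<in> borel_measurable borel" using mollifierD[OF \<rho>] by simp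
  show "(\<lambda>y. \<rho> y *\<^sub>R u (mul (- y) x)) \<in> borel_measurable lborel" by measurable
  obtain C where C: "C \<ge> 0" "\<And>y. \<rho> y \<le> C" using mollifier_bounded[OF \<rho>] by blast
  define S where "S = tset (cball 0 \<delta>) {x}"
  have S: "compact S" unfolding S_def by (intro compact_tset) auto
  then have [measurable]: "S \<in> sets borel" by (simp add: borel_closed compact_imp_closed)
  have "(\<integral>\<^sup>+y. ennreal (norm (\<rho> y *\<^sub>R u (mul (- y) x))) \<partial>lborel) \<le>
      (\<integral>\<^sup>+y. (\<lambda>z. ennreal C * (ennreal (norm (u z) powr 1) * indicator S z)) (mul (- y) x) \<partial>lborel)"
  proof (rule nn_integral_mono)
    fix y :: "real^'n"
    show "ennreal (norm (\<rho> y *\<^sub>R u (mul (- y) x))) \<le> (\<lambda>z. ennreal C * (ennreal (norm (u z) powr 1) * indicator S z)) (mul (- y) x)"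
    proof (cases "norm y \<le> \<delta>")
      case True
      then have "mul (- y) x \<in> S" by (auto simp: S_def intro!: tsetI)
      then show ?thesis using C mollifierD(5)[OF \<rho>, of y] by (auto simp: ennreal_mult[symmetric] intro!: ennreal_leI mult_right_mono)
    qed (use mollifierD(3)[OF \<rho>, of y] in simp)
  qed
  also have "\<dots> = (\<integral>\<^sup>+z. ennreal C * (ennreal (norm (u z) powr 1) * indicator S z) \<partial>lborel)"
    by (rule nn_integral_reflect) measurable
  also have "\<dots> = ennreal C * Lint 1 S u" unfolding Lint_def by (rule nn_integral_cmult) measurable
  also have "\<dots> < \<infinity>" using u S by (simp add: Lqloc_def ennreal_mult_less_top)
  finally show "(\<integral>\<^sup>+y. ennreal (norm (\<rho> y *\<^sub>R u (mul (- y) x))) \<partial>lborel) < \<infinity>" .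
qed

lemma conv_measurable_pair:
  fixes u :: "real^'n \<Rightarrow> 'b::euclidean_space"
  assumes [measurable]: "u \<in> borel_measurable borel"
  shows "(\<lambda>(x, y). u (mul (- y) x)) \<in> borel_measurable (borel \<Otimes>\<^sub>M borel)"
  by measurable

lemma conv_measurable:
  fixes u :: "real^'n \<Rightarrow> 'b::euclidean_space"
  assumes [measurable]: "u \<in> borel_measurable borel" "\<rho> \<in> borel_measurable borel"
  shows "conv \<rho> u \<in> borel_measurable borel"
  unfolding conv_def[abs_def] by measurable

lemma Lint_conv_le:
  fixes u :: "real^'n \<Rightarrow> 'b::euclidean_space"
  assumes u: "u \<in> borel_measurable borel" and \<rho>: "mollifier \<delta> \<rho>" and q: "1 \<le> q" and K: "compact K"
  shows "Lint q K (conv \<rho> u) \<le> Lint q (tset (cball 0 \<delta>) K) u"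
proof -
  have [measurable]: "\<rho> \<in> borel_measurable borel" using mollifierD[OF \<rho>] by simp
  define L where "L = Lint q (tset (cball 0 \<delta>) K) u"
  have S: "tset (cball 0 \<delta>) K \<in> sets borel"
    by (intro borel_closed compact_imp_closed compact_tset K compact_cball)
  have "Lint q K (conv \<rho> u) \<le> (\<integral>\<^sup>+y. ennreal (\<rho> y) * Lint q K (\<lambda>x. u (mul (- y) x)) \<partial>lborel)"
    unfolding conv_def[abs_def] using K
    by (intro Lint_average conv_measurable_pair u mollifierD[OF \<rho>] q) (simp add: borel_closed compact_imp_closed)
  also have "\<dots> \<le> (\<integral>\<^sup>+y. ennreal (\<rho> y) * L \<partial>lborel)"
  proof (rule nn_integral_mono)
    fix y :: "real^'n"
    show "ennreal (\<rho> y) * Lint q K (\<lambda>x. u (mul (- y) x)) \<le> ennreal (\<rho> y) * L"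
    proof (cases "norm y \<le> \<delta>")
      case True
      then show ?thesis unfolding L_def using u S by (intro mult_left_mono Lint_translate_le) (auto intro!: tsetI)
    qed (use mollifierD(3)[OF \<rho>, of y] in simp)
  qed
  also have "\<dots> = L" using mollifierD(6)[OF \<rho>] by (simp add: nn_integral_multc)
  finally show ?thesis by (simp add: L_def)
qed

lemma Lqloc_conv:
  fixes u :: "real^'n \<Rightarrow> 'b::euclidean_space"
  assumes u: "Lqloc q u" and \<rho>: "mollifier \<delta> \<rho>" and q: "1 \<le> q"
  shows "Lqloc q (conv \<rho> u)"
  unfolding Lqloc_def
proof (intro conjI allI impI)
  show "conv \<rho> u \<in> borel_measurable borel" using conv_measurable Lqloc_measurable[OF u] mollifierD[OF \<rho>] by blast
  fix K :: "(real^'n) set" assume K: "compact K"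
  have "Lint q (tset (cball 0 \<delta>) K) u < \<infinity>"
    using u compact_tset[OF compact_cball K] unfolding Lqloc_def by blast
  then show "Lint q K (conv \<rho> u) < \<infinity>"
    using Lint_conv_le[OF Lqloc_measurable[OF u] \<rho> q K] by simp
qed

text \<open>The difference of \<open>conv \<rho> u\<close> and \<open>u\<close> is the mean of the
  increments u(y^-1 x) - u(x), to which \<open>Lint_average\<close> and
  \<open>translation_continuity\<close> apply.\<close>

lemma conv_tendsto:
  fixes u :: "real^'n \<Rightarrow> 'b::euclidean_space"
  assumes u: "Lqloc q u" and K: "compact K" and q: "1 \<le> q" and e: "e > 0"
  shows "\<exists>d>0. \<forall>\<delta>\<le>d. \<forall>\<rho>. mollifier \<delta> \<rho> \<longrightarrow> Lint q K (\<lambda>x. conv \<rho> u x - u x) \<le> e"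
proof -
  have [measurable]: "u \<in> borel_measurable borel" using u by (rule Lqloc_measurable)
  obtain d where d: "d > 0" "\<And>y. norm y < d \<Longrightarrow> Lint q K (\<lambda>x. u (mul (- y) x) - u x) < e"
    using translation_continuity[OF u K q e] by blast
  have "Lint q K (\<lambda>x. conv \<rho> u x - u x) \<le> e" if \<delta>: "\<delta> \<le> d" and \<rho>: "mollifier \<delta> \<rho>" for \<delta> \<rho>
  proof -
    have [measurable]: "\<rho> \<in> borel_measurable borel" using mollifierD[OF \<rho>] by simp
    have "conv \<rho> u x - u x = (\<integral>y. \<rho> y *\<^sub>R (u (mul (- y) x) - u x) \<partial>lborel)" for x
    proof -
      have "(\<integral>y. \<rho> y *\<^sub>R (u (mul (- y) x) - u x) \<partial>lborel) = conv \<rho> u x - (\<integral>y. \<rho> y *\<^sub>R u x \<partial>lborel)"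
        unfolding conv_def scaleR_diff_right
        by (rule Bochner_Integration.integral_diff[OF conv_integrable[OF Lqloc_1[OF u q] \<rho>]])
           (use prob_weight_integral[OF mollifierD(2)[OF \<rho>]] in simp)
      then show ?thesis using prob_weight_integral[OF mollifierD(2)[OF \<rho>]] by simp
    qed
    then have "Lint q K (\<lambda>x. conv \<rho> u x - u x) = Lint q K (\<lambda>x. \<integral>y. \<rho> y *\<^sub>R (u (mul (- y) x) - u x) \<partial>lborel)" by simp
    also have "\<dots> \<le> (\<integral>\<^sup>+y. ennreal (\<rho> y) * Lint q K (\<lambda>x. u (mul (- y) x) - u x) \<partial>lborel)"
      using K by (intro Lint_average mollifierD[OF \<rho>] q) (measurable, simp add: borel_closed compact_imp_closed)
    also have "\<dots> \<le> (\<integral>\<^sup>+y. ennreal (\<rho> y) * e \<partial>lborel)"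
    proof (rule nn_integral_mono)
      fix y :: "real^'n"
      show "ennreal (\<rho> y) * Lint q K (\<lambda>x. u (mul (- y) x) - u x) \<le> ennreal (\<rho> y) * e"
        using d(2)[of y] mollifierD(3)[OF \<rho>, of y] \<delta> by (cases "norm y < d") (auto intro!: mult_left_mono)
    qed
    also have "\<dots> = e" using mollifierD(6)[OF \<rho>] by (simp add: nn_integral_multc)
    finally show ?thesis .
  qed
  then show ?thesis using d(1) by blast
qed

text \<open>The substitution y = x z^-1 moves \<open>x\<close> from \<open>u\<close>, of which
  nothing pointwise is known, into the continuous kernel.\<close>

lemma conv_eq_right:
  fixes u :: "real^'n \<Rightarrow> 'b::euclidean_space"
  assumes [measurable]: "u \<in> borel_measurable borel" "\<rho> \<in> borel_measurable borel"
  shows "conv \<rho> u x = (\<integral>z. \<rho> (mul x (- z)) *\<^sub>R u z \<partial>lborel)"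
proof -
  have "distr lborel borel (\<lambda>z. mul x (- z)) = distr (distr lborel borel uminus) borel (mul x)"
    by (subst distr_distr) (auto simp: o_def)
  then have "conv \<rho> u x = (\<integral>y. \<rho> y *\<^sub>R u (mul (- y) x) \<partial>distr lborel borel (\<lambda>z. mul x (- z)))"
    by (simp add: conv_def distr_lborel_uminus distr_mul_left)
  also have "\<dots> = (\<integral>z. \<rho> (mul x (- z)) *\<^sub>R u (mul (- mul x (- z)) x) \<partial>lborel)"
    by (rule integral_distr) measurable
  finally show ?thesis by (simp add: neg_mul)
qed

lemma conv_continuous:
  fixes u :: "real^'n \<Rightarrow> 'b::euclidean_space"
  assumes u: "Lqloc 1 u" and \<rho>: "mollifier \<delta> \<rho>"
  shows "continuous_on UNIV (conv \<rho> u)"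
  unfolding continuous_on_sequentially
proof (intro allI ballI impI)
  fix X and x :: "real^'n" assume "(\<forall>n. X n \<in> UNIV) \<and> X \<longlonglongrightarrow> x"
  then have X: "X \<longlonglongrightarrow> x" by simp
  have um[measurable]: "u \<in> borel_measurable borel" using u by (rule Lqloc_measurable)
  have rm[measurable]: "\<rho> \<in> borel_measurable borel" using mollifierD[OF \<rho>] by simp
  obtain C where C: "C \<ge> 0" "\<And>y. \<rho> y \<le> C" using mollifier_bounded[OF \<rho>] by blast
  \<comment> \<open>A convergent sequence with its limit is compact, so one compact set contains the
    supports of all the kernels and yields a common integrable bound.\<close>
  define S where "S = tset (cball 0 \<delta>) (insert x (range X))"
  have "compact (insert x (range X))" using X by (rule compact_sequence_with_limit)
  then have S: "compact S" unfolding S_def by (intro compact_tset) auto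
  then have [measurable]: "S \<in> sets borel" by (simp add: borel_closed compact_imp_closed)
  have z: "\<rho> (mul (X n) (- z)) = 0" if "z \<notin> S" for n z
  proof (rule mollifierD(3)[OF \<rho>], rule ccontr)
    assume "\<not> \<delta> \<le> norm (mul (X n) (- z))"
    then have "mul (- mul (X n) (- z)) (X n) \<in> S" unfolding S_def by (intro tsetI) auto
    then show False using that by (simp add: neg_mul)
  qed
  have "(\<lambda>n. \<integral>z. \<rho> (mul (X n) (- z)) *\<^sub>R u z \<partial>lborel) \<longlonglongrightarrow> (\<integral>z. \<rho> (mul x (- z)) *\<^sub>R u z \<partial>lborel)"
  proof (rule integral_dominated_convergence[where w = "\<lambda>z. C * (indicator S z * norm (u z))"])
    have "integrable lborel (\<lambda>z. indicator S z * norm (u z))"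
    proof (rule integrableI_nonneg)
      have "(\<integral>\<^sup>+z. ennreal (indicator S z * norm (u z)) \<partial>lborel) = Lint 1 S u"
        unfolding Lint_def by (rule nn_integral_cong) (auto split: split_indicator)
      then show "(\<integral>\<^sup>+z. ennreal (indicator S z * norm (u z)) \<partial>lborel) < \<infinity>" using u S by (simp add: Lqloc_def)
    qed auto
    then show "integrable lborel (\<lambda>z. C * (indicator S z * norm (u z)))" by simp
    show "AE z in lborel. (\<lambda>n. \<rho> (mul (X n) (- z)) *\<^sub>R u z) \<longlonglongrightarrow> \<rho> (mul x (- z)) *\<^sub>R u z"
    proof (rule AE_I2)
      fix z
      have "continuous_on UNIV (\<lambda>x. \<rho> (mul x (- z)) *\<^sub>R u z)"
        by (intro continuous_intros continuous_on_compose2[OF mollifierD(1)[OF \<rho>]]) auto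
      then show "(\<lambda>n. \<rho> (mul (X n) (- z)) *\<^sub>R u z) \<longlonglongrightarrow> \<rho> (mul x (- z)) *\<^sub>R u z"
        using X by (rule continuous_on_tendsto_compose) auto
    qed
    show "AE z in lborel. norm (\<rho> (mul (X n) (- z)) *\<^sub>R u z) \<le> C * (indicator S z * norm (u z))" for n
      using z C mollifierD(5)[OF \<rho>] by (auto split: split_indicator intro!: mult_right_mono)
  qed measurable
  then show "(conv \<rho> u \<circ> X) \<longlonglongrightarrow> conv \<rho> u x"
    by (simp add: o_def conv_eq_right)
qed

text \<open>Each \<open>y\<close> is replaced by the node y' of a cell in which the increment y'^-1
  y is small. Measured in this left-invariant way, the error is a translation increment of
  \<open>u\<close> on the fixed compact set \<open>K'\<close>, whatever the node.\<close>

lemma riemann_sums: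
  fixes u :: "real^'n \<Rightarrow> 'b::euclidean_space"
  assumes u: "Lqloc q u" and K: "compact K" and q: "1 \<le> q" and e: "e > 0" and \<rho>: "mollifier \<delta> \<rho>"
  obtains n :: nat and ys c where "\<And>i. i < n \<Longrightarrow> norm (ys i) \<le> \<delta>" "\<And>i. i < n \<Longrightarrow> 0 \<le> c i" "(\<Sum>i<n. c i) = 1"
    "Lint q K (\<lambda>x. conv \<rho> u x - (\<Sum>i<n. c i *\<^sub>R u (mul (- ys i) x))) \<le> e"
proof -
  have um[measurable]: "u \<in> borel_measurable borel" using u by (rule Lqloc_measurable)
  have rm[measurable]: "\<rho> \<in> borel_measurable borel" using mollifierD[OF \<rho>] by simp
  note \<rho>i = prob_weight_integral[OF mollifierD(2)[OF \<rho>]]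
  define B where "B = cball (0::real^'n) \<delta>"
  have B: "compact B" by (simp add: B_def)
  define K' where "K' = tset B K"
  have K': "compact K'" unfolding K'_def by (intro compact_tset B K)
  obtain d where d: "d > 0" "\<And>h. norm h < d \<Longrightarrow> Lint q K' (\<lambda>x. u (mul (- h) x) - u x) < e"
    using translation_continuity[OF u K' q e] by blast
  define U where "U = (\<lambda>y'. {y. norm (mul (- y') y) < d})"
  have Uo: "open (U y')" for y' unfolding U_def by (intro open_Collect_less continuous_intros)
  have "B \<subseteq> (\<Union>y\<in>B. U y)" using d by (auto simp: U_def)
  then obtain I where I: "I \<subseteq> B" "finite I" "B \<subseteq> (\<Union>y\<in>I. U y)"
    using compactE_image[OF B, of B U] Uo by blast
  obtain n :: nat and ys where ys: "I = ys ` {..<n}"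
    using finite_imp_nat_seg_image_inj_on[OF I(2)] by (auto simp: lessThan_def)
  \<comment> \<open>The cover made disjoint. The step function \<open>a\<close> below sends a point
    of \<open>B\<close> to the node of its cell.\<close>
  define E where "E = (\<lambda>i. U (ys i) - (\<Union>j<i. U (ys j)))"
  have Em[measurable]: "E i \<in> sets borel" for i unfolding E_def using Uo by (intro sets.Diff sets.finite_UN) auto
  have Eu: "\<exists>i<n. y \<in> E i" if yB: "y \<in> B" for y
  proof -
    obtain j where j: "j < n" "y \<in> U (ys j)" using subsetD[OF I(3) yB] ys by auto
    define i where "i = (LEAST i. y \<in> U (ys i))"
    have "y \<in> U (ys i)" "i \<le> j" unfolding i_def using j LeastI[of "\<lambda>i. y \<in> U (ys i)" j] Least_le[of "\<lambda>i. y \<in> U (ys i)" j] by auto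
    moreover have "y \<notin> U (ys l)" if "l < i" for l using not_less_Least[of l "\<lambda>i. y \<in> U (ys i)"] that by (simp add: i_def)
    ultimately show ?thesis using j by (auto simp: E_def intro!: exI[of _ i])
  qed
  have Ed: "y \<in> E i \<Longrightarrow> y \<in> E j \<Longrightarrow> i = j" for i j y
    unfolding E_def by (cases i j rule: linorder_cases) auto
  define a where "a = (\<lambda>y. \<Sum>i<n. indicator (E i) y *\<^sub>R ys i)"
  have am[measurable]: "a \<in> borel_measurable borel" unfolding a_def by measurable
  have sumE: "(\<Sum>i<n. indicator (E i) y *\<^sub>R g i) = g j" if "j < n" "y \<in> E j" for j y and g :: "nat \<Rightarrow> 'c::real_vector"
  proof -
    have "(\<Sum>i<n. indicator (E i) y *\<^sub>R g i) = (\<Sum>i<n. if i = j then g j else 0)"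
      using that Ed by (intro sum.cong) (auto split: split_indicator)
    then show ?thesis using that by simp
  qed
  define c where "c = (\<lambda>i. \<integral>y. \<rho> y * indicator (E i) y \<partial>lborel)"
  have ci: "integrable lborel (\<lambda>y. \<rho> y * indicator (E i) y)" for i
    by (rule integrable_real_mult_indicator) (use \<rho>i in auto)
  have out: "\<rho> y = 0" if "y \<notin> B" for y using that mollifierD(3)[OF \<rho>, of y] by (simp add: B_def)
  have split: "\<rho> y *\<^sub>R g (a y) = (\<Sum>i<n. (\<rho> y * indicator (E i) y) *\<^sub>R g (ys i))" for y and g :: "real^'n \<Rightarrow> 'c::real_vector"
  proof (cases "y \<in> B")
    case True
    then obtain j where j: "j < n" "y \<in> E j" using Eu by blast
    have "(\<Sum>i<n. (\<rho> y * indicator (E i) y) *\<^sub>R g (ys i)) = \<rho> y *\<^sub>R (\<Sum>i<n. indicator (E i) y *\<^sub>R g (ys i))"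
      by (simp only: scaleR_sum_right scaleR_scaleR)
    then show ?thesis using sumE[OF j, of ys] sumE[OF j, of "\<lambda>i. g (ys i)"] by (simp add: a_def)
  qed (simp add: out)
  show ?thesis
  proof (rule that)
    show "norm (ys i) \<le> \<delta>" if "i < n" for i using I(1) ys that by (auto simp: B_def)
    show "0 \<le> c i" for i unfolding c_def using mollifierD(5)[OF \<rho>] by (intro integral_nonneg_AE) auto
    have "(\<Sum>i<n. c i) = (\<integral>y. (\<Sum>i<n. \<rho> y * indicator (E i) y) \<partial>lborel)"
      unfolding c_def by (rule Bochner_Integration.integral_sum[symmetric]) (rule ci)
    also have "\<dots> = (\<integral>y. \<rho> y \<partial>lborel)"
      by (rule Bochner_Integration.integral_cong[OF refl]) (use split[of _ "\<lambda>_. 1::real"] in \<open>simp only: real_scaleR_def mult_1_right\<close>)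
    finally show "(\<Sum>i<n. c i) = 1" using \<rho>i by simp
    define H where "H = (\<lambda>x y. u (mul (- y) x) - u (mul (- a y) x))"
    have Hm: "(\<lambda>(x, y). H x y) \<in> borel_measurable (borel \<Otimes>\<^sub>M borel)" unfolding H_def by measurable
    have "conv \<rho> u x - (\<Sum>i<n. c i *\<^sub>R u (mul (- ys i) x)) = (\<integral>y. \<rho> y *\<^sub>R H x y \<partial>lborel)" for x
    proof -
      have i1: "integrable lborel (\<lambda>y. (\<rho> y * indicator (E i) y) *\<^sub>R u (mul (- ys i) x))" for i
        using ci by (intro integrable_scaleR_left) auto
      have eq: "(\<lambda>y. \<rho> y *\<^sub>R u (mul (- a y) x)) = (\<lambda>y. \<Sum>i<n. (\<rho> y * indicator (E i) y) *\<^sub>R u (mul (- ys i) x))"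
        using split[of _ "\<lambda>b. u (mul (- b) x)"] by blast
      have "(\<integral>y. \<rho> y *\<^sub>R u (mul (- a y) x) \<partial>lborel) = (\<Sum>i<n. c i *\<^sub>R u (mul (- ys i) x))"
        unfolding eq c_def using ci i1 by (subst Bochner_Integration.integral_sum) auto
      moreover have "integrable lborel (\<lambda>y. \<rho> y *\<^sub>R u (mul (- a y) x))"
        unfolding eq using i1 by simp
      ultimately show ?thesis
        unfolding H_def scaleR_diff_right conv_def
        by (subst Bochner_Integration.integral_diff[OF conv_integrable[OF Lqloc_1[OF u q] \<rho>]]) auto
    qed
    then have "Lint q K (\<lambda>x. conv \<rho> u x - (\<Sum>i<n. c i *\<^sub>R u (mul (- ys i) x))) = Lint q K (\<lambda>x. \<integral>y. \<rho> y *\<^sub>R H x y \<partial>lborel)" by simp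
    also have "\<dots> \<le> (\<integral>\<^sup>+y. ennreal (\<rho> y) * Lint q K (\<lambda>x. H x y) \<partial>lborel)"
      using K by (intro Lint_average[OF Hm] mollifierD[OF \<rho>] q) (simp add: borel_closed compact_imp_closed)
    also have "\<dots> \<le> (\<integral>\<^sup>+y. ennreal (\<rho> y) * e \<partial>lborel)"
    proof (rule nn_integral_mono)
      fix y
      show "ennreal (\<rho> y) * Lint q K (\<lambda>x. H x y) \<le> ennreal (\<rho> y) * e"
      proof (cases "y \<in> B")
        case True
        then obtain j where j: "j < n" "y \<in> E j" using Eu by blast
        define y' where "y' = ys j"
        have ay: "a y = y'" using sumE[OF j, of ys] by (simp add: a_def y'_def)
        have y': "y' \<in> B" using I(1) ys j by (auto simp: y'_def)
        define h where "h = mul (- y') y"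
        have h: "norm h < d" using j by (simp add: E_def U_def h_def y'_def)
        \<comment> \<open>Translating by \<open>y\<close> is translating by y' and then by the small
          increment \<open>h\<close>; the first translation is absorbed in the passage from
          \<open>K\<close> to \<open>K'\<close>.\<close>
        have "mul (- h) (mul (- y') x) = mul (- y) x" for x by (simp add: h_def neg_mul assoc)
        then have "Lint q K (\<lambda>x. H x y) = Lint q K (\<lambda>x. (\<lambda>z. u (mul (- h) z) - u z) (mul (- y') x))"
          by (simp add: H_def ay)
        also have "\<dots> \<le> Lint q K' (\<lambda>z. u (mul (- h) z) - u z)"
          using K' y' by (intro Lint_translate_le) (measurable, auto simp: borel_closed compact_imp_closed K'_def intro!: tsetI)
        also have "\<dots> \<le> e" using d(2)[OF h] by simp
        finally show ?thesis by (intro mult_left_mono) auto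
      qed (simp add: out)
    qed
    also have "\<dots> = e" using mollifierD(6)[OF \<rho>] by (simp add: nn_integral_multc)
    finally show "Lint q K (\<lambda>x. conv \<rho> u x - (\<Sum>i<n. c i *\<^sub>R u (mul (- ys i) x))) \<le> e" .
  qed
qed

text \<open>Jensen's inequality at each point, then Tonelli; for every \<open>y\<close> in the
  support of the kernel the translate of \<open>A'\<close> by y^-1 lies in \<open>A\<close>, and
  translation preserves the integral.\<close>

lemma nn_integral_conv_convex_le:
  fixes g :: "real^'n \<Rightarrow> 'b::euclidean_space" and f :: "'b \<Rightarrow> real"
  assumes f: "convex_on UNIV f" "\<And>z. 0 \<le> f z" and g: "Lqloc 1 g" and \<rho>: "mollifier \<delta> \<rho>"
    and A[measurable]: "A \<in> sets borel" "A' \<in> sets borel" and sub: "tset (cball 0 \<delta>) A' \<subseteq> A"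
  shows "(\<integral>\<^sup>+x\<in>A'. ennreal (f (conv \<rho> g x)) \<partial>lborel) \<le> (\<integral>\<^sup>+x\<in>A. ennreal (f (g x)) \<partial>lborel)"
proof -
  have gm[measurable]: "g \<in> borel_measurable borel" using g by (rule Lqloc_measurable)
  have rm[measurable]: "\<rho> \<in> borel_measurable borel" using mollifierD[OF \<rho>] by simp
  have [measurable]: "f \<in> borel_measurable borel"
    by (intro borel_measurable_continuous_onI convex_on_continuous f open_UNIV)
  define L where "L = (\<integral>\<^sup>+x\<in>A. ennreal (f (g x)) \<partial>lborel)"
  have "(\<integral>\<^sup>+x\<in>A'. ennreal (f (conv \<rho> g x)) \<partial>lborel) \<le>
     (\<integral>\<^sup>+x. (\<integral>\<^sup>+y. ennreal (\<rho> y) * (ennreal (f (g (mul (- y) x))) * indicator A' x) \<partial>lborel) \<partial>lborel)"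
  proof (rule nn_integral_mono)
    fix x :: "real^'n"
    have "ennreal (f (conv \<rho> g x)) \<le> (\<integral>\<^sup>+y. ennreal (\<rho> y) * ennreal (f (g (mul (- y) x))) \<partial>lborel)"
      unfolding conv_def by (rule jensen_density[OF f rm _ _ _ conv_integrable[OF g \<rho>]]) (use mollifierD[OF \<rho>] in auto)
    then show "ennreal (f (conv \<rho> g x)) * indicator A' x \<le> (\<integral>\<^sup>+y. ennreal (\<rho> y) * (ennreal (f (g (mul (- y) x))) * indicator A' x) \<partial>lborel)"
      by (auto split: split_indicator)
  qed
  also have "\<dots> = (\<integral>\<^sup>+y. (\<integral>\<^sup>+x. ennreal (\<rho> y) * (ennreal (f (g (mul (- y) x))) * indicator A' x) \<partial>lborel) \<partial>lborel)"
    by (rule pair_sigma_finite.Fubini'[OF sigma_pair_lborel, symmetric]) (unfold split_beta', measurable)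
  also have "\<dots> \<le> (\<integral>\<^sup>+y. ennreal (\<rho> y) * L \<partial>lborel)"
  proof (rule nn_integral_mono)
    fix y :: "real^'n"
    show "(\<integral>\<^sup>+x. ennreal (\<rho> y) * (ennreal (f (g (mul (- y) x))) * indicator A' x) \<partial>lborel) \<le> ennreal (\<rho> y) * L"
    proof (cases "norm y \<le> \<delta>")
      case True
      have "(\<integral>\<^sup>+x. ennreal (f (g (mul (- y) x))) * indicator A' x \<partial>lborel) \<le> (\<integral>\<^sup>+x. (\<lambda>z. ennreal (f (g z)) * indicator A z) (mul (- y) x) \<partial>lborel)"
      proof (rule nn_integral_mono)
        fix x
        have "x \<in> A' \<Longrightarrow> mul (- y) x \<in> A" using tsetI[of y "cball 0 \<delta>" x A'] True sub by auto
        then show "ennreal (f (g (mul (- y) x))) * indicator A' x \<le> (\<lambda>z. ennreal (f (g z)) * indicator A z) (mul (- y) x)"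
          by (auto split: split_indicator)
      qed
      also have "\<dots> = L" unfolding L_def by (rule nn_integral_mul_left) measurable
      finally have "ennreal (\<rho> y) * (\<integral>\<^sup>+x. ennreal (f (g (mul (- y) x))) * indicator A' x \<partial>lborel) \<le> ennreal (\<rho> y) * L"
        by (rule mult_left_mono) simp
      then show ?thesis by (simp add: nn_integral_cmult)
    qed (use mollifierD(3)[OF \<rho>, of y] in simp)
  qed
  also have "\<dots> = L" using mollifierD(6)[OF \<rho>] by (simp add: nn_integral_multc)
  finally show ?thesis by (simp add: L_def)
qed

end

section \<open>Test functions and weak derivatives\<close>

text \<open>Dividing by powers of t makes the family closed under differentiation up to linear
  combinations, so smoothness is one induction over all \<open>n\<close> at once.\<close>

definition hexp :: "nat \<Rightarrow> real \<Rightarrow> real" where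
  "hexp n t = (if t > 0 then exp (- (1 / t)) / t ^ n else 0)"

lemma hexp_tendsto_0: "(hexp n \<longlongrightarrow> 0) (at 0)"
proof -
  have "((\<lambda>t. inverse t ^ n / exp (inverse t)) \<longlongrightarrow> (0::real)) (at_right 0)"
    using filterlim_compose[OF tendsto_power_div_exp_0 filterlim_inverse_at_top_right] .
  then have r: "(hexp n \<longlongrightarrow> 0) (at_right 0)"
    by (rule Lim_transform_eventually)
       (auto simp: eventually_at_filter hexp_def exp_minus divide_inverse power_inverse mult.commute)
  have l: "(hexp n \<longlongrightarrow> 0) (at_left 0)"
    by (rule Lim_transform_eventually[OF tendsto_const]) (auto simp: eventually_at_filter hexp_def)
  show ?thesis using l r by (simp add: filterlim_split_at)
qed

lemma hexp_has_derivative: "(hexp n has_real_derivative (hexp (n + 2) t - real n * hexp (n + 1) t)) (at t)"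
proof -
  consider "t > 0" | "t < 0" | "t = 0" by linarith
  then show ?thesis
  proof cases
    case 1
    have "((\<lambda>t. exp (- (1 / t)) / t ^ n) has_real_derivative (hexp (n + 2) t - real n * hexp (n + 1) t)) (at t)"
    proof (cases n)
      case 0
      then show ?thesis using 1 by (auto intro!: derivative_eq_intros simp: hexp_def field_simps power2_eq_square)
    next
      case (Suc m)
      then show ?thesis using 1
        apply (cases m)
         apply (auto intro!: derivative_eq_intros simp: hexp_def field_simps power2_eq_square)
        subgoal for l by (cases l) simp_all
        done
    qed
    then show ?thesis
      by (rule has_field_derivative_transform_within_open[where S = "{0<..}"]) (use 1 in \<open>auto simp: hexp_def\<close>)
  next
    case 2
    have "((\<lambda>t. 0) has_real_derivative (hexp (n + 2) t - real n * hexp (n + 1) t)) (at t)"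
      using 2 by (simp add: hexp_def)
    then show ?thesis
      by (rule has_field_derivative_transform_within_open[where S = "{..<0}"]) (use 2 in \<open>auto simp: hexp_def\<close>)
  next
    case 3
    \<comment> \<open>At 0 the difference quotient of \<open>hexp n\<close> is
      \<open>hexp (n + 1)\<close> itself.\<close>
    have "((\<lambda>h. hexp (n + 1) h) \<longlongrightarrow> 0) (at 0)" by (rule hexp_tendsto_0)
    then have "((\<lambda>h. (hexp n (0 + h) - hexp n 0) / h) \<longlongrightarrow> 0) (at 0)"
      by (rule Lim_transform_eventually) (auto simp: eventually_at_filter hexp_def)
    then show ?thesis using 3 by (simp add: DERIV_def hexp_def)
  qed
qed

lemma smooth_hexp: "smooth_map (hexp n)"
proof -
  have "Ck_map k (hexp n)" for k
  proof (induction k arbitrary: n)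
    case 0
    have "continuous_on UNIV (hexp n)"
      by (rule DERIV_continuous_on) (rule has_field_derivative_at_within[OF hexp_has_derivative])
    then show ?case by simp
  next
    case (Suc k)
    show ?case
    proof (rule Ck_mapI)
      show "(hexp n has_derivative (\<lambda>v. (hexp (n + 2) x + (- real n) * hexp (n + 1) x) * v)) (at x)" for x
        using hexp_has_derivative[of n x] by (simp add: has_field_derivative_def)
      show "Ck_map k (\<lambda>x. (hexp (n + 2) x + (- real n) * hexp (n + 1) x) * v)" for v
        by (intro Ck_map_bilinear[OF bounded_bilinear_mult] Ck_map_add Ck_map_const Suc)
    qed
  qed
  then show ?thesis by (simp add: smooth_map_def)
qed

lemma smooth_map_prod:
  fixes f :: "'i \<Rightarrow> 'a::euclidean_space \<Rightarrow> real"
  assumes "\<And>i. i \<in> I \<Longrightarrow> smooth_map (f i)" shows "smooth_map (\<lambda>x. \<Prod>i\<in>I. f i x)"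
  using assms by (induction I rule: infinite_finite_induct) (auto intro: smooth_map_const smooth_map_mult)

text \<open>Vanishes outside the box and tends to 1 inside it, since the factor \<open>Suc n\<close>
  pushes the arguments of \<open>hexp 0\<close> to infinity: indicators of boxes become limits of
  test functions below them.\<close>

definition box_bump :: "'a::euclidean_space \<Rightarrow> 'a \<Rightarrow> nat \<Rightarrow> 'a \<Rightarrow> real" where
  "box_bump a b n x = (\<Prod>i\<in>Basis. hexp 0 (real (Suc n) * (x \<bullet> i - a \<bullet> i)) * hexp 0 (real (Suc n) * (b \<bullet> i - x \<bullet> i)))"

lemma smooth_box_bump: "smooth_map (box_bump a b n)"
proof -
  have "smooth_map (\<lambda>x::'a. hexp 0 (c * (x \<bullet> i) + d))" for c d i
    by (rule smooth_map_compose[OF smooth_hexp, of "\<lambda>x. c * (x \<bullet> i) + d"])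
       (intro smooth_map_add smooth_map_const smooth_map_bounded_linear
          bounded_linear_mult_right[THEN bounded_linear_compose] bounded_linear_inner_left)
  from this[of "real (Suc n)"] this[of "- real (Suc n)"]
  have 1: "smooth_map (\<lambda>x::'a. hexp 0 (real (Suc n) * (x \<bullet> i) + d))" "smooth_map (\<lambda>x::'a. hexp 0 (- real (Suc n) * (x \<bullet> i) + d))" for i d
    by blast+
  have 2: "real (Suc n) * (x \<bullet> i - a \<bullet> i) = real (Suc n) * (x \<bullet> i) + - (real (Suc n) * (a \<bullet> i))"
    "real (Suc n) * (b \<bullet> i - x \<bullet> i) = - real (Suc n) * (x \<bullet> i) + real (Suc n) * (b \<bullet> i)" for x i
    by (simp_all add: algebra_simps)
  have "smooth_map (\<lambda>x. hexp 0 (real (Suc n) * (x \<bullet> i - a \<bullet> i)))" "smooth_map (\<lambda>x. hexp 0 (real (Suc n) * (b \<bullet> i - x \<bullet> i)))" for i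
    unfolding 2 by (rule 1)+
  then show ?thesis unfolding box_bump_def[abs_def] by (intro smooth_map_prod smooth_map_mult)
qed

lemma hexp_0_bounds: "0 \<le> hexp 0 t" "hexp 0 t \<le> 1" "t \<le> 0 \<Longrightarrow> hexp 0 t = 0"
  by (auto simp: hexp_def)

lemma box_bump_outside: "x \<notin> box a b \<Longrightarrow> box_bump a b n x = 0"
proof -
  assume "x \<notin> box a b"
  then obtain i where i: "i \<in> Basis" "x \<bullet> i \<le> a \<bullet> i \<or> b \<bullet> i \<le> x \<bullet> i" by (auto simp: mem_box not_less)
  then have "hexp 0 (real (Suc n) * (x \<bullet> i - a \<bullet> i)) * hexp 0 (real (Suc n) * (b \<bullet> i - x \<bullet> i)) = 0"
    by (auto intro!: hexp_0_bounds(3) mult_nonneg_nonpos)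
  then show ?thesis unfolding box_bump_def using i(1) by (intro prod_zero) auto
qed

lemma box_bump_bounds: "0 \<le> box_bump a b n x" "box_bump a b n x \<le> 1"
  unfolding box_bump_def by (auto intro!: prod_nonneg prod_le_1 mult_nonneg_nonneg mult_le_one simp: hexp_0_bounds)

lemma box_bump_tendsto: "(\<lambda>n. box_bump a b n x) \<longlonglongrightarrow> indicator (box a b) x"
proof (cases "x \<in> box a b")
  case True
  have h: "(\<lambda>n. hexp 0 (real (Suc n) * s)) \<longlonglongrightarrow> 1" if "s > 0" for s
  proof -
    have "(\<lambda>n. exp (- ((1 / s) * inverse (real (Suc n))))) \<longlonglongrightarrow> exp (- ((1 / s) * 0))"
      by (intro tendsto_intros LIMSEQ_inverse_real_of_nat)
    moreover have "exp (- ((1 / s) * inverse (real (Suc n)))) = hexp 0 (real (Suc n) * s)" for n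
    proof -
      have p: "real (Suc n) * s > 0" using that by (intro mult_pos_pos) auto
      then have "hexp 0 (real (Suc n) * s) = exp (- (1 / (real (Suc n) * s)))"
        unfolding hexp_def by (simp only: if_True power_0 div_by_1)
      then show ?thesis by (simp add: divide_inverse del: of_nat_Suc)
    qed
    ultimately show ?thesis by simp
  qed
  have "(\<lambda>n. box_bump a b n x) \<longlonglongrightarrow> (\<Prod>i\<in>(Basis::'a set). 1 * 1)"
    unfolding box_bump_def using True by (intro tendsto_prod tendsto_mult h) (auto simp: mem_box)
  then show ?thesis using True by simp
qed (simp add: box_bump_outside)

lemma box_bump_test: "cbox a b \<subseteq> \<Omega> \<Longrightarrow> box_bump a b n \<in> test_functions \<Omega>"
proof -
  assume \<Omega>: "cbox a b \<subseteq> \<Omega>"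
  have "closure (support_on UNIV (box_bump a b n)) \<subseteq> cbox a b"
  proof (rule closure_minimal)
    show "support_on UNIV (box_bump a b n) \<subseteq> cbox a b"
      using box_bump_outside[of _ a b n] box_subset_cbox[of a b] unfolding support_on_def by blast
  qed (rule closed_cbox)
  then show ?thesis
    using \<Omega> bounded_subset[OF bounded_cbox] by (auto simp: test_functions_def smooth_box_bump compact_eq_bounded_closed)
qed

lemma enn2real_inj: "enn2real a = enn2real b \<Longrightarrow> a \<noteq> \<infinity> \<Longrightarrow> b \<noteq> \<infinity> \<Longrightarrow> a = b"
  by (cases a; cases b) auto

section \<open>The fundamental lemma of the calculus of variations\<close>

text \<open>The positive and the negative part of \<open>D\<close> are densities of finite measures
  that agree on boxes, an intersection-stable generator of the Borel sets.\<close>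

lemma AE_zero_of_box_integrals:
  fixes D :: "'a::euclidean_space \<Rightarrow> real"
  assumes D: "integrable lborel D" and z: "\<And>a b. (\<integral>x. D x * indicator (box a b) x \<partial>lborel) = 0"
  shows "AE x in lborel. D x = 0"
proof -
  have [measurable]: "D \<in> borel_measurable borel" using D by simp
  define P where "P = density lborel (\<lambda>x. ennreal (D x))"
  define N where "N = density lborel (\<lambda>x. ennreal (- D x))"
  have eq: "emeasure P (box a b) = emeasure N (box a b)" for a b
  proof -
    have i: "integrable lborel (\<lambda>x. D x * indicator (box a b) x)"
      using D by (intro integrable_real_mult_indicator) auto
    have "enn2real (\<integral>\<^sup>+x. ennreal (D x * indicator (box a b) x) \<partial>lborel) = enn2real (\<integral>\<^sup>+x. ennreal (- (D x * indicator (box a b) x)) \<partial>lborel)"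
      using z[of a b] real_lebesgue_integral_def[OF i] by simp
    moreover have "(\<integral>\<^sup>+x. ennreal (D x * indicator (box a b) x) \<partial>lborel) \<noteq> \<infinity>" "(\<integral>\<^sup>+x. ennreal (- (D x * indicator (box a b) x)) \<partial>lborel) \<noteq> \<infinity>"
      using real_integrable_def[of lborel] i by auto
    ultimately have "(\<integral>\<^sup>+x. ennreal (D x * indicator (box a b) x) \<partial>lborel) = (\<integral>\<^sup>+x. ennreal (- (D x * indicator (box a b) x)) \<partial>lborel)"
      by (rule enn2real_inj)
    moreover have "ennreal (D x * indicator (box a b) x) = ennreal (D x) * indicator (box a b) x"
      "ennreal (- (D x * indicator (box a b) x)) = ennreal (- D x) * indicator (box a b) x" for x
      by (auto split: split_indicator)
    ultimately show ?thesis by (simp add: P_def N_def emeasure_density)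
  qed
  have fin: "emeasure P S \<noteq> \<infinity>" for S
  proof -
    have "emeasure P S \<le> emeasure P UNIV" by (intro emeasure_mono) (auto simp: P_def)
    also have "\<dots> < \<infinity>" using D by (auto simp: P_def emeasure_density real_integrable_def top.not_eq_extremum)
    finally show ?thesis by simp
  qed
  have "P = N"
  proof (rule measure_eqI_generator_eq[where E = "range (\<lambda>(a, b). box a b)" and \<Omega> = UNIV and A = "\<lambda>n. box (- (real n *\<^sub>R One)) (real n *\<^sub>R One)"])
    show "Int_stable (range (\<lambda>(a, b). box a b :: 'a set))"
      by (auto simp: Int_stable_def box_Int_box)
    show "sets P = sigma_sets UNIV (range (\<lambda>(a, b). box a b))" "sets N = sigma_sets UNIV (range (\<lambda>(a, b). box a b))"
      by (simp_all add: P_def N_def borel_eq_box)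
    show "(\<Union>n. box (- (real n *\<^sub>R One)) (real n *\<^sub>R One)) = (UNIV :: 'a set)"
      by (rule UN_box_eq_UNIV)
    show "emeasure P (box (- (real n *\<^sub>R One)) (real n *\<^sub>R One)) \<noteq> \<infinity>" for n by (rule fin)
    show "emeasure P X = emeasure N X" if "X \<in> range (\<lambda>(a, b). box a b)" for X using that eq by auto
  qed auto
  \<comment> \<open>\<open>ennreal\<close> truncates at 0, so this equates the positive with the
    negative part, and at least one of them is zero.\<close>
  then have "AE x in lborel. ennreal (D x) = ennreal (- D x)"
    unfolding P_def N_def by (intro sigma_finite_measure.density_unique) (auto intro: sigma_finite_lborel)
  then show ?thesis
  proof eventually_elim
    fix x assume e: "ennreal (D x) = ennreal (- D x)"
    consider "D x > 0" | "D x < 0" | "D x = 0" by linarith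
    then show "D x = 0"
      by cases (use e in \<open>auto simp: ennreal_neg ennreal_eq_0_iff eq_commute[of 0]\<close>)
  qed
qed

definition Lloc1 :: "'a::euclidean_space set \<Rightarrow> ('a \<Rightarrow> 'b::euclidean_space) \<Rightarrow> bool" where
  "Lloc1 \<Omega> u \<longleftrightarrow> u \<in> borel_measurable borel \<and> (\<forall>K. compact K \<longrightarrow> K \<subseteq> \<Omega> \<longrightarrow> Lint 1 K u < \<infinity>)"

lemma integrable_of_Lint:
  fixes u :: "'a::euclidean_space \<Rightarrow> real"
  assumes u[measurable]: "u \<in> borel_measurable borel" and Z[measurable]: "Z \<in> borel_measurable borel"
    and K[measurable]: "K \<in> sets borel" and fin: "Lint 1 K u < \<infinity>"
    and out: "\<And>x. x \<notin> K \<Longrightarrow> Z x = 0" and C: "\<And>x. \<bar>Z x\<bar> \<le> C"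
  shows "integrable lborel (\<lambda>x. u x * Z x)"
proof (rule integrableI_bounded)
  have "0 \<le> C" using C[of undefined] by linarith
  have "(\<integral>\<^sup>+x. ennreal (norm (u x * Z x)) \<partial>lborel) \<le> (\<integral>\<^sup>+x. ennreal C * (ennreal (norm (u x) powr 1) * indicator K x) \<partial>lborel)"
  proof (rule nn_integral_mono)
    fix x
    show "ennreal (norm (u x * Z x)) \<le> ennreal C * (ennreal (norm (u x) powr 1) * indicator K x)"
    proof (cases "x \<in> K")
      case True
      have "\<bar>u x\<bar> * \<bar>Z x\<bar> \<le> C * \<bar>u x\<bar>" using C[of x] by (subst mult.commute) (rule mult_right_mono, auto)
      then show ?thesis using True \<open>0 \<le> C\<close> by (simp add: abs_mult ennreal_mult[symmetric] ennreal_leI)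
    qed (simp add: out)
  qed
  also have "\<dots> = ennreal C * Lint 1 K u" unfolding Lint_def by (rule nn_integral_cmult) measurable
  also have "\<dots> < \<infinity>" using fin by (simp add: ennreal_mult_less_top)
  finally show "(\<integral>\<^sup>+x. ennreal (norm (u x * Z x)) \<partial>lborel) < \<infinity>" .
qed measurable

text \<open>Test functions approximate indicators of boxes whose closure lies in \<Omega>; this
  gives zero integrals over such boxes, hence a null function on each of them, and countably many
  closed boxes exhaust \<Omega>.\<close>

lemma fundamental_lemma:
  fixes d :: "'a::euclidean_space \<Rightarrow> real"
  assumes \<Omega>: "open \<Omega>" and d: "Lloc1 \<Omega> d" and z: "\<And>\<phi>. \<phi> \<in> test_functions \<Omega> \<Longrightarrow> (\<integral>x. d x * \<phi> x \<partial>lborel) = 0"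
  shows "AE x in lborel. x \<in> \<Omega> \<longrightarrow> d x = 0"
proof -
  have dm[measurable]: "d \<in> borel_measurable borel" using d by (simp add: Lloc1_def)
  have int: "integrable lborel (\<lambda>x. d x * Z x)" if "cbox a b \<subseteq> \<Omega>" "Z \<in> borel_measurable borel" "\<And>x. x \<notin> cbox a b \<Longrightarrow> Z x = 0" "\<And>x. \<bar>Z x\<bar> \<le> 1" for a b Z
    by (rule integrable_of_Lint[where K = "cbox a b"]) (use d that in \<open>auto simp: Lloc1_def\<close>)
  have bz: "(\<integral>x. d x * indicator (box a b) x \<partial>lborel) = 0" if ab: "cbox a b \<subseteq> \<Omega>" for a b
  proof -
    have bm[measurable]: "box_bump a b n \<in> borel_measurable borel" for n
      by (intro borel_measurable_continuous_onI smooth_map_continuous smooth_box_bump)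
    have "(\<lambda>n. \<integral>x. d x * box_bump a b n x \<partial>lborel) \<longlonglongrightarrow> (\<integral>x. d x * indicator (box a b) x \<partial>lborel)"
    proof (rule integral_dominated_convergence[where w = "\<lambda>x. \<bar>d x * indicator (cbox a b) x\<bar>"])
      show "integrable lborel (\<lambda>x. \<bar>d x * indicator (cbox a b) x\<bar>)"
        by (intro integrable_abs int[OF ab]) (auto split: split_indicator)
      show "AE x in lborel. (\<lambda>n. d x * box_bump a b n x) \<longlonglongrightarrow> d x * indicator (box a b) x"
        by (intro AE_I2 tendsto_mult tendsto_const box_bump_tendsto)
      show "AE x in lborel. norm (d x * box_bump a b n x) \<le> \<bar>d x * indicator (cbox a b) x\<bar>" for n
      proof (rule AE_I2)
        fix x
        show "norm (d x * box_bump a b n x) \<le> \<bar>d x * indicator (cbox a b) x\<bar>"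
          using box_bump_bounds[of a b n x] box_bump_outside[of x a b n] box_subset_cbox[of a b]
          by (cases "x \<in> box a b") (auto simp: abs_mult mult_left_le)
      qed
    qed measurable
    then show ?thesis using z[OF box_bump_test[OF ab]] by (simp add: LIMSEQ_const_iff)
  qed
  have AE_box: "AE x in lborel. x \<in> cbox a b \<longrightarrow> d x = 0" if ab: "cbox a b \<subseteq> \<Omega>" for a b
  proof -
    have "AE x in lborel. d x * indicator (box a b) x = 0"
    proof (rule AE_zero_of_box_integrals)
      show "integrable lborel (\<lambda>x. d x * indicator (box a b) x)"
        using box_subset_cbox[of a b] by (intro int[OF ab]) (auto split: split_indicator)
      fix c e :: 'a
      obtain a' b' where ab': "box a b \<inter> box c e = box a' b'" using box_Int_box by blast
      have "(\<integral>x. d x * indicator (box a b) x * indicator (box c e) x \<partial>lborel) = (\<integral>x. d x * indicator (box a' b') x \<partial>lborel)"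
        by (rule Bochner_Integration.integral_cong) (auto simp: ab'[symmetric] indicator_inter_arith)
      also have "\<dots> = 0"
      proof (cases "box a' b' = {}")
        case False
        then have "cbox a' b' \<subseteq> cbox a b" unfolding closure_box[OF False, symmetric] ab'[symmetric]
          by (metis closure_mono Int_lower1 closure_minimal closed_cbox box_subset_cbox subset_trans)
        then show ?thesis using bz ab by blast
      qed simp
      finally show "(\<integral>x. d x * indicator (box a b) x * indicator (box c e) x \<partial>lborel) = 0" .
    qed
    moreover have "AE x in lborel. x \<notin> cbox a b - box a b"
      using negligible_frontier_interval[of a b] by (metis AE_completion_iff AE_not_in negligible_iff_null_sets)
    ultimately show ?thesis by eventually_elim (auto split: split_indicator_asm)
  qed
  obtain \<D> where D: "countable \<D>" "\<And>X. X \<in> \<D> \<Longrightarrow> X \<subseteq> \<Omega>" "\<And>X. X \<in> \<D> \<Longrightarrow> \<exists>a b. X = cbox a b" "\<Union>\<D> = \<Omega>"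
    using open_countable_Union_open_cbox[OF \<Omega>] by (metis PowD subsetD)
  have "AE x in lborel. \<forall>X\<in>\<D>. x \<in> X \<longrightarrow> d x = 0"
    using D AE_box by (subst AE_ball_countable[OF D(1)]) metis
  then show ?thesis by eventually_elim (use D(4) in blast)
qed

section \<open>Borel representatives\<close>

text \<open>\<open>Lp_loc\<close> gives measurability on compact subsets only. A compact exhaustion
  extends it to \<Omega>, and a Lebesgue measurable function agrees almost everywhere with a Borel
  one.\<close>

lemma lebesgue_representative:
  fixes u :: "'a::euclidean_space \<Rightarrow> real"
  assumes \<Omega>: "open \<Omega>" and u: "u \<in> Lp_loc q \<Omega>"
  obtains v where "v \<in> borel_measurable borel" "\<And>x. x \<notin> \<Omega> \<Longrightarrow> v x = 0" "AE x in lebesgue. x \<in> \<Omega> \<longrightarrow> u x = v x"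
    "\<And>K. compact K \<Longrightarrow> K \<subseteq> \<Omega> \<Longrightarrow> Lint q K v < \<infinity>"
proof -
  obtain C where C: "\<And>n. compact (C n)" "\<And>n. C n \<subseteq> \<Omega>" "\<And>n. C n \<subseteq> interior (C (Suc n))" "\<Union>(range C) = \<Omega>"
      "\<And>K. compact K \<Longrightarrow> K \<subseteq> \<Omega> \<Longrightarrow> \<exists>N::nat. \<forall>n\<ge>N. K \<subseteq> C n"
    using open_Union_compact_subsets[OF \<Omega>] by metis
  have um: "(\<lambda>x. indicator (C n) x *\<^sub>R u x) \<in> borel_measurable lebesgue" for n
    using u C(1,2) by (auto simp: Lp_loc_def Lp_def set_borel_measurable_def)
  have "(\<lambda>x. indicator \<Omega> x * u x) \<in> borel_measurable lebesgue"
  proof (rule borel_measurable_LIMSEQ_real[OF _ um])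
    fix x
    show "(\<lambda>n. indicator (C n) x *\<^sub>R u x) \<longlonglongrightarrow> indicator \<Omega> x * u x"
    proof (rule tendsto_eventually)
      have "\<exists>N. \<forall>n\<ge>N. indicator (C n) x = (indicator \<Omega> x :: real)"
      proof (cases "x \<in> \<Omega>")
        case True
        then obtain N where "\<forall>n\<ge>N. x \<in> C n" using C(5)[of "{x}"] by auto
        then show ?thesis using True by (intro exI[of _ N]) auto
      qed (use C(2) in \<open>auto split: split_indicator\<close>)
      then show "eventually (\<lambda>n. indicator (C n) x *\<^sub>R u x = indicator \<Omega> x * u x) sequentially"
        unfolding eventually_sequentially by (metis real_scaleR_def)
    qed
  qed
  then obtain w where w: "w \<in> borel_measurable lborel" "AE x in lborel. indicator \<Omega> x * u x = w x"
    using completion_ex_borel_measurable_real by blast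
  define v where "v = (\<lambda>x. indicator \<Omega> x * w x)"
  have ae: "AE x in lborel. x \<in> \<Omega> \<longrightarrow> u x = v x"
    using w(2) by eventually_elim (auto simp: v_def)
  show ?thesis
  proof (rule that[of v])
    have [measurable]: "\<Omega> \<in> sets borel" using \<Omega> by simp
    show "v \<in> borel_measurable borel" unfolding v_def using w(1) by measurable
    show "v x = 0" if "x \<notin> \<Omega>" for x using that by (simp add: v_def)
    show "AE x in lebesgue. x \<in> \<Omega> \<longrightarrow> u x = v x" using ae by (rule AE_completion)
    fix K assume K: "compact K" "K \<subseteq> \<Omega>"
    have "Lint q K v = (\<integral>\<^sup>+x. ennreal (norm (indicator K x *\<^sub>R \<bar>u x\<bar> powr q)) \<partial>lebesgue)"
      unfolding Lint_def nn_integral_completion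
      using ae by (intro nn_integral_cong_AE, eventually_elim) (use K(2) in \<open>auto split: split_indicator\<close>)
    moreover have "integrable lebesgue (\<lambda>x. indicator K x *\<^sub>R \<bar>u x\<bar> powr q)"
      using u K by (auto simp: Lp_loc_def Lp_def set_integrable_def)
    ultimately show "Lint q K v < \<infinity>" by (simp add: integrable_iff_bounded)
  qed
qed

lemma Lp_of_Lint:
  fixes v :: "'a::euclidean_space \<Rightarrow> real"
  assumes v: "v \<in> borel_measurable borel" and K: "K \<in> sets borel" and fin: "Lint q K v < \<infinity>"
    and ae: "AE x in lebesgue. x \<in> K \<longrightarrow> u x = v x"
  shows "u \<in> Lp q K"
proof -
  have [measurable]: "v \<in> borel_measurable lebesgue" using v by (simp add: measurable_completion)
  have [measurable]: "K \<in> sets lebesgue" using K by simp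
  have 1: "(\<lambda>x. indicator K x *\<^sub>R v x) \<in> borel_measurable lebesgue" by measurable
  then have m: "(\<lambda>x. indicator K x *\<^sub>R u x) \<in> borel_measurable lebesgue"
    by (rule borel_measurable_AE) (use ae in \<open>eventually_elim, auto split: split_indicator\<close>)
  have eq: "indicator K x *\<^sub>R \<bar>u x\<bar> powr q = indicator K x *\<^sub>R \<bar>indicator K x *\<^sub>R u x\<bar> powr q" for x
    by (auto split: split_indicator)
  have "integrable lebesgue (\<lambda>x. indicator K x *\<^sub>R \<bar>u x\<bar> powr q)"
  proof (rule integrableI_bounded)
    show "(\<lambda>x. indicator K x *\<^sub>R \<bar>u x\<bar> powr q) \<in> borel_measurable lebesgue"
      unfolding eq using m by measurable
    have "(\<integral>\<^sup>+x. ennreal (norm (indicator K x *\<^sub>R \<bar>u x\<bar> powr q)) \<partial>lebesgue) = (\<integral>\<^sup>+x. ennreal (norm (v x) powr q) * indicator K x \<partial>lebesgue)"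
      using ae by (intro nn_integral_cong_AE, eventually_elim) (auto split: split_indicator)
    also have "\<dots> = Lint q K v" by (simp add: Lint_def nn_integral_completion)
    finally show "(\<integral>\<^sup>+x. ennreal (norm (indicator K x *\<^sub>R \<bar>u x\<bar> powr q)) \<partial>lebesgue) < \<infinity>" using fin by simp
  qed
  then show ?thesis using m by (simp add: Lp_def set_borel_measurable_def set_integrable_def)
qed

lemma Lp_loc_of_Lint:
  fixes v :: "'a::euclidean_space \<Rightarrow> real"
  assumes v: "v \<in> borel_measurable borel" and fin: "\<And>K. compact K \<Longrightarrow> K \<subseteq> \<Omega> \<Longrightarrow> Lint q K v < \<infinity>"
    and ae: "AE x in lebesgue. x \<in> \<Omega> \<longrightarrow> u x = v x"
  shows "u \<in> Lp_loc q \<Omega>"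
  unfolding Lp_loc_def
proof (intro CollectI allI impI)
  fix K assume K: "compact K \<and> K \<subseteq> \<Omega>"
  show "u \<in> Lp q K"
    by (rule Lp_of_Lint[OF v]) (use K fin in \<open>auto simp: borel_closed compact_imp_closed intro!: eventually_mono[OF ae]\<close>)
qed

lemma lebesgue_set_integral_AE:
  fixes u v :: "'a::euclidean_space \<Rightarrow> real"
  assumes v[measurable]: "v \<in> borel_measurable borel" and Z[measurable]: "Z \<in> borel_measurable borel" and \<Omega>: "\<Omega> \<in> sets borel"
    and ae: "AE x in lebesgue. x \<in> \<Omega> \<longrightarrow> u x = v x" and out: "\<And>x. x \<notin> \<Omega> \<Longrightarrow> Z x = 0"
  shows "(LINT x:\<Omega>|lebesgue. u x * Z x) = (\<integral>x. v x * Z x \<partial>lborel)"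
proof -
  have m: "(\<lambda>x. v x * Z x) \<in> borel_measurable lborel" by measurable
  then have m': "(\<lambda>x. v x * Z x) \<in> borel_measurable lebesgue" by (rule measurable_completion)
  have ae': "AE x in lebesgue. v x * Z x = indicator \<Omega> x *\<^sub>R (u x * Z x)"
    using ae by eventually_elim (auto simp: out split: split_indicator)
  have "(LINT x:\<Omega>|lebesgue. u x * Z x) = (\<integral>x. v x * Z x \<partial>lebesgue)"
    unfolding set_lebesgue_integral_def
    by (rule integral_cong_AE[OF borel_measurable_AE[OF m' ae'] m']) (rule eventually_mono[OF ae'], erule sym)
  also have "\<dots> = (\<integral>x. v x * Z x \<partial>lborel)" by (rule integral_completion[OF m])
  finally show ?thesis .
qed

lemma test_function_outside:
  assumes \<phi>: "\<phi> \<in> test_functions \<Omega>"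
  shows "smooth_map \<phi>" "compact (closure (support_on UNIV \<phi>))" "closure (support_on UNIV \<phi>) \<subseteq> \<Omega>"
    "x \<notin> closure (support_on UNIV \<phi>) \<Longrightarrow> \<phi> x = 0" "x \<notin> closure (support_on UNIV \<phi>) \<Longrightarrow> vf_apply Y \<phi> x = 0"
proof -
  show 0: "smooth_map \<phi>" "compact (closure (support_on UNIV \<phi>))" "closure (support_on UNIV \<phi>) \<subseteq> \<Omega>"
    using \<phi> by (auto simp: test_functions_def)
  have z: "\<phi> x = 0" if "x \<notin> closure (support_on UNIV \<phi>)" for x
    using that closure_subset[of "support_on UNIV \<phi>"] by (auto simp: support_on_def)
  then show "x \<notin> closure (support_on UNIV \<phi>) \<Longrightarrow> \<phi> x = 0" .
  assume x: "x \<notin> closure (support_on UNIV \<phi>)"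
  have "((\<lambda>x. 0) has_derivative (\<lambda>h. 0)) (at x)" by simp
  then have "(\<phi> has_derivative (\<lambda>h. 0)) (at x)"
    by (rule has_derivative_transform_within_open[OF _ open_Compl[OF closed_closure[of "support_on UNIV \<phi>"]]]) (use x z in auto)
  then show "vf_apply Y \<phi> x = 0"
    unfolding vf_apply_def by (metis frechet_derivative_at)
qed

lemma test_functions_mono: "\<Omega> \<subseteq> \<Omega>' \<Longrightarrow> test_functions \<Omega> \<subseteq> test_functions \<Omega>'"
  by (auto simp: test_functions_def)

text \<open>The form of \<open>weak_derivative\<close> for Borel functions. As test functions and
  their derivatives vanish off \<Omega>, the integrals run over the whole space, where translations
  and Fubini's theorem apply.\<close>

definition wd :: "('a::euclidean_space \<Rightarrow> 'a) \<Rightarrow> 'a set \<Rightarrow> ('a \<Rightarrow> real) \<Rightarrow> ('a \<Rightarrow> real) \<Rightarrow> bool" where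
  "wd Y \<Omega> u g \<longleftrightarrow> Lloc1 \<Omega> u \<and> Lloc1 \<Omega> g \<and>
     (\<forall>\<phi>\<in>test_functions \<Omega>. (\<integral>x. u x * vf_apply Y \<phi> x \<partial>lborel) = - (\<integral>x. g x * \<phi> x \<partial>lborel))"

lemma Lloc1_mono: "Lloc1 \<Omega>' u \<Longrightarrow> \<Omega> \<subseteq> \<Omega>' \<Longrightarrow> Lloc1 \<Omega> u"
  by (auto simp: Lloc1_def)

lemma wd_mono: "wd Y \<Omega>' u g \<Longrightarrow> \<Omega> \<subseteq> \<Omega>' \<Longrightarrow> wd Y \<Omega> u g"
  using test_functions_mono[of \<Omega> \<Omega>'] by (auto simp: wd_def intro: Lloc1_mono)

lemma smooth_vf_apply: "smooth_map Y \<Longrightarrow> smooth_map \<phi> \<Longrightarrow> smooth_map (vf_apply Y \<phi>)"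
  unfolding vf_apply_def[abs_def]
  by (rule smooth_map_derivative_apply) (auto intro: smooth_map_bounded_linear bounded_linear_ident)

lemma smooth_map_measurable: "smooth_map f \<Longrightarrow> f \<in> borel_measurable borel"
  by (intro borel_measurable_continuous_onI smooth_map_continuous)

lemma weak_derivative_iff_wd:
  assumes Y: "smooth_map Y" and \<Omega>: "open \<Omega>"
    and u: "AE x in lebesgue. x \<in> \<Omega> \<longrightarrow> u x = u' x" "u' \<in> borel_measurable borel"
    and g: "AE x in lebesgue. x \<in> \<Omega> \<longrightarrow> g x = g' x" "g' \<in> borel_measurable borel"
    and loc: "Lloc1 \<Omega> u'" "Lloc1 \<Omega> g'"
  shows "weak_derivative Y \<Omega> u g \<longleftrightarrow> wd Y \<Omega> u' g'"
proof -
  have "u \<in> Lp_loc 1 \<Omega>" "g \<in> Lp_loc 1 \<Omega>"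
    using loc by (auto intro!: Lp_loc_of_Lint[OF u(2) _ u(1)] Lp_loc_of_Lint[OF g(2) _ g(1)] simp: Lloc1_def)
  moreover have "(LINT x:\<Omega>|lebesgue. u x * vf_apply Y \<phi> x) = (\<integral>x. u' x * vf_apply Y \<phi> x \<partial>lborel)"
    "(LINT x:\<Omega>|lebesgue. g x * \<phi> x) = (\<integral>x. g' x * \<phi> x \<partial>lborel)" if \<phi>: "\<phi> \<in> test_functions \<Omega>" for \<phi>
  proof -
    note t = test_function_outside[OF \<phi>]
    have \<Omega>b: "\<Omega> \<in> sets borel" using \<Omega> by simp
    have o: "x \<notin> \<Omega> \<Longrightarrow> x \<notin> closure (support_on UNIV \<phi>)" for x using t(3) by blast
    show "(LINT x:\<Omega>|lebesgue. u x * vf_apply Y \<phi> x) = (\<integral>x. u' x * vf_apply Y \<phi> x \<partial>lborel)"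
      by (rule lebesgue_set_integral_AE[OF u(2) smooth_map_measurable[OF smooth_vf_apply[OF Y t(1)]] \<Omega>b u(1)])
         (rule t(5)[OF o])
    show "(LINT x:\<Omega>|lebesgue. g x * \<phi> x) = (\<integral>x. g' x * \<phi> x \<partial>lborel)"
      by (rule lebesgue_set_integral_AE[OF g(2) smooth_map_measurable[OF t(1)] \<Omega>b g(1)])
         (rule t(4)[OF o])
  qed
  ultimately show ?thesis using loc by (simp add: weak_derivative_def wd_def)
qed

text \<open>One \<open>g'\<close> serves all Borel representatives of \<open>u\<close>, so the
  components of a gradient can be chosen separately for the same representative.\<close>

lemma weak_derivative_representative:
  assumes Y: "smooth_map Y" and \<Omega>: "open \<Omega>" and w: "weak_derivative Y \<Omega> u g"
  obtains g' where "Lloc1 \<Omega> g'" "\<And>x. x \<notin> \<Omega> \<Longrightarrow> g' x = 0" "AE x in lebesgue. x \<in> \<Omega> \<longrightarrow> g x = g' x"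
    "\<And>u'. u' \<in> borel_measurable borel \<Longrightarrow> AE x in lebesgue. x \<in> \<Omega> \<longrightarrow> u x = u' x \<Longrightarrow> wd Y \<Omega> u' g'"
proof -
  have g: "g \<in> Lp_loc 1 \<Omega>" and u: "u \<in> Lp_loc 1 \<Omega>" using w by (auto simp: weak_derivative_def)
  obtain g' where g': "g' \<in> borel_measurable borel" "\<And>x. x \<notin> \<Omega> \<Longrightarrow> g' x = 0" "AE x in lebesgue. x \<in> \<Omega> \<longrightarrow> g x = g' x"
    "\<And>K. compact K \<Longrightarrow> K \<subseteq> \<Omega> \<Longrightarrow> Lint 1 K g' < \<infinity>"
    using lebesgue_representative[OF \<Omega> g] by metis
  obtain u0 where u0: "u0 \<in> borel_measurable borel" "AE x in lebesgue. x \<in> \<Omega> \<longrightarrow> u x = u0 x"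
    "\<And>K. compact K \<Longrightarrow> K \<subseteq> \<Omega> \<Longrightarrow> Lint 1 K u0 < \<infinity>"
    using lebesgue_representative[OF \<Omega> u] by metis
  have gl: "Lloc1 \<Omega> g'" using g' by (simp add: Lloc1_def)
  show ?thesis
  proof (rule that[OF gl g'(2,3)])
    fix u' assume u': "u' \<in> borel_measurable borel" "AE x in lebesgue. x \<in> \<Omega> \<longrightarrow> u x = u' x"
    have "AE x in lborel. x \<in> \<Omega> \<longrightarrow> u' x = u0 x"
      using u'(2) u0(2) unfolding AE_completion_iff by eventually_elim auto
    then have "Lint 1 K u' = Lint 1 K u0" if "K \<subseteq> \<Omega>" for K
      unfolding Lint_def by (intro nn_integral_cong_AE, eventually_elim) (use that in \<open>auto split: split_indicator\<close>)
    then have "Lloc1 \<Omega> u'" using u' u0(3) by (simp add: Lloc1_def)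
    from weak_derivative_iff_wd[OF Y \<Omega> u'(2,1) g'(3,1) this gl] show "wd Y \<Omega> u' g'" using w by simp
  qed
qed

lemma Lloc1_diff:
  assumes "Lloc1 \<Omega> g" "Lloc1 \<Omega> h" shows "Lloc1 \<Omega> (\<lambda>x. g x - h x)"
  unfolding Lloc1_def
proof (intro conjI allI impI)
  have [measurable]: "g \<in> borel_measurable borel" "h \<in> borel_measurable borel" using assms by (auto simp: Lloc1_def)
  show "(\<lambda>x. g x - h x) \<in> borel_measurable borel" by measurable
  fix K assume K: "compact K" "K \<subseteq> \<Omega>"
  then have "K \<in> sets borel" by (simp add: borel_closed compact_imp_closed)
  then have "Lint 1 K (\<lambda>x. g x + - h x) \<le> ennreal (2 powr (1 - 1)) * (Lint 1 K g + Lint 1 K (\<lambda>x. - h x))"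
    by (intro Lint_add_2) auto
  moreover have "Lint 1 K (\<lambda>x. - h x) = Lint 1 K h" by (simp add: Lint_def)
  ultimately show "Lint 1 K (\<lambda>x. g x - h x) < \<infinity>"
    using assms K by (auto simp: Lloc1_def intro: order_le_less_trans)
qed

lemma wd_unique:
  assumes \<Omega>: "open \<Omega>" and w: "wd Y \<Omega> u g" "wd Y \<Omega> u h"
  shows "AE x in lborel. x \<in> \<Omega> \<longrightarrow> g x = h x"
proof -
  have l: "Lloc1 \<Omega> g" "Lloc1 \<Omega> h" using w by (auto simp: wd_def)
  have "AE x in lborel. x \<in> \<Omega> \<longrightarrow> g x - h x = 0"
  proof (rule fundamental_lemma[OF \<Omega> Lloc1_diff[OF l]])
    fix \<phi> assume \<phi>: "\<phi> \<in> test_functions \<Omega>"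
    define S where "S = closure (support_on UNIV \<phi>)"
    have S: "compact S" "S \<subseteq> \<Omega>" using test_function_outside[OF \<phi>] by (auto simp: S_def)
    have "bounded (\<phi> ` S)"
      by (intro compact_imp_bounded compact_continuous_image continuous_on_subset[OF smooth_map_continuous] test_function_outside[OF \<phi>] S) simp
    then obtain C where "\<And>x. x \<in> S \<Longrightarrow> \<bar>\<phi> x\<bar> \<le> C" by (auto simp: bounded_iff)
    then have C: "\<bar>\<phi> x\<bar> \<le> max C 0" for x
      using test_function_outside(4)[OF \<phi>, of x] by (cases "x \<in> S") (auto simp: S_def max.coboundedI1)
    have i: "integrable lborel (\<lambda>x. f x * \<phi> x)" if "Lloc1 \<Omega> f" for f
      by (rule integrable_of_Lint[where K = S, OF _ _ _ _ _ C])
         (use that S smooth_map_measurable[OF test_function_outside(1)[OF \<phi>]] test_function_outside(4)[OF \<phi>] in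
          \<open>auto simp: Lloc1_def borel_closed compact_imp_closed S_def\<close>)
    have "(\<integral>x. (g x - h x) * \<phi> x \<partial>lborel) = (\<integral>x. g x * \<phi> x \<partial>lborel) - (\<integral>x. h x * \<phi> x \<partial>lborel)"
      unfolding left_diff_distrib by (rule Bochner_Integration.integral_diff[OF i[OF l(1)] i[OF l(2)]])
    then show "(\<integral>x. (g x - h x) * \<phi> x \<partial>lborel) = 0" using w \<phi> by (simp add: wd_def)
  qed
  then show ?thesis by simp
qed

lemma weak_derivative_unique:
  assumes Y: "smooth_map Y" and \<Omega>: "open \<Omega>" and w: "weak_derivative Y \<Omega> u g" "weak_derivative Y \<Omega> u h"
  shows "AE x in lebesgue. x \<in> \<Omega> \<longrightarrow> g x = h x"
proof -
  obtain u0 where u0: "u0 \<in> borel_measurable borel" "AE x in lebesgue. x \<in> \<Omega> \<longrightarrow> u x = u0 x"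
    using lebesgue_representative[OF \<Omega>, of u 1] w(1) unfolding weak_derivative_def by metis
  obtain g' where g': "AE x in lebesgue. x \<in> \<Omega> \<longrightarrow> g x = g' x" "wd Y \<Omega> u0 g'"
    by (rule weak_derivative_representative[OF Y \<Omega> w(1)]) (use u0 in blast)
  obtain h' where h': "AE x in lebesgue. x \<in> \<Omega> \<longrightarrow> h x = h' x" "wd Y \<Omega> u0 h'"
    by (rule weak_derivative_representative[OF Y \<Omega> w(2)]) (use u0 in blast)
  have "AE x in lebesgue. x \<in> \<Omega> \<longrightarrow> g' x = h' x"
    by (rule AE_completion[OF wd_unique[OF \<Omega> g'(2) h'(2)]])
  then show ?thesis using g'(1) h'(1) by eventually_elim auto
qed

section \<open>Weak derivatives along left-invariant fields\<close>

lemma closed_subset_compact: "compact S \<Longrightarrow> closed A \<Longrightarrow> A \<subseteq> S \<Longrightarrow> compact A"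
  for S :: "'a::t2_space set"
  using compact_Int_closed[of S A] by (simp add: Int_absorb1)

lemma compact_support_bounded:
  fixes Z :: "'a::euclidean_space \<Rightarrow> real"
  assumes "continuous_on UNIV Z" "compact S" "\<And>x. x \<notin> S \<Longrightarrow> Z x = 0"
  obtains C where "0 \<le> C" "\<And>x. \<bar>Z x\<bar> \<le> C"
proof -
  have "bounded (Z ` S)"
    by (intro compact_imp_bounded compact_continuous_image continuous_on_subset[OF assms(1)] assms subset_UNIV)
  then obtain C where "\<And>x. x \<in> S \<Longrightarrow> \<bar>Z x\<bar> \<le> C" unfolding bounded_iff by auto
  then have "\<bar>Z x\<bar> \<le> max C 0" for x
    using assms(3)[of x] by (cases "x \<in> S") (auto simp: max.coboundedI1)
  then show ?thesis using that[of "max C 0"] by simp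
qed

lemma compact_support_integrable:
  fixes Z :: "'a::euclidean_space \<Rightarrow> real"
  assumes Z: "continuous_on UNIV Z" "compact S" "\<And>x. x \<notin> S \<Longrightarrow> Z x = 0"
  shows "integrable lborel Z"
proof -
  obtain C where C: "\<And>x. \<bar>Z x\<bar> \<le> C" using compact_support_bounded[OF Z] by blast
  have [measurable]: "Z \<in> borel_measurable borel" using Z(1) by (rule borel_measurable_continuous_onI)
  have S: "S \<in> sets borel" using Z by (simp add: borel_closed compact_imp_closed)
  have "Lint 1 S (\<lambda>x. 1::real) < \<infinity>"
    using Lqloc_continuous[of "\<lambda>x. 1::real" 1] Z(2) by (auto simp: Lqloc_def)
  then have "integrable lborel (\<lambda>x. 1 * Z x)"
    by (intro integrable_of_Lint[OF _ _ S _ Z(3) C]) auto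
  then show ?thesis by simp
qed

context carnot_group
begin

lemma smooth_left_inv_field: "smooth_map (left_inv_field mul v)"
proof -
  have "smooth_map (\<lambda>x. DM (x, 0) (0, v))"
    by (rule smooth_map_derivative_apply[OF smooth_mult])
       (intro smooth_map_Pair smooth_map_const smooth_map_bounded_linear bounded_linear_ident)+
  then show ?thesis by (simp add: left_inv_field_DL[abs_def] DL_DM)
qed

text \<open>In exponential coordinates the integral curve of the field through \<open>x\<close> is s
  \<mapsto> x (s v).\<close>

lemma has_derivative_along_field:
  assumes "smooth_map \<psi>"
  shows "((\<lambda>s. \<psi> (mul x (s *\<^sub>R v))) has_real_derivative vf_apply (left_inv_field mul v) \<psi> (mul x (t *\<^sub>R v))) (at t)"
  unfolding has_real_derivative_iff_has_vector_derivative
proof (rule has_vector_derivative_shift)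
  let ?y = "mul x (t *\<^sub>R v)"
  have "((\<lambda>s. s *\<^sub>R v) has_derivative (\<lambda>s. s *\<^sub>R v)) (at 0)" by (auto intro!: derivative_eq_intros)
  from diff_chain_at[OF this] has_derivative_mul_left[of ?y 0]
  have "((\<lambda>s. mul ?y (s *\<^sub>R v)) has_derivative (\<lambda>s. DL ?y 0 (s *\<^sub>R v))) (at 0)" by (simp add: o_def)
  from diff_chain_at[OF this] smooth_map_has_derivative[OF assms, of ?y]
  have "((\<lambda>s. \<psi> (mul ?y (s *\<^sub>R v))) has_derivative (\<lambda>s. frechet_derivative \<psi> (at ?y) (DL ?y 0 (s *\<^sub>R v)))) (at 0)"
    by (simp add: o_def)
  moreover have "frechet_derivative \<psi> (at ?y) (DL ?y 0 (s *\<^sub>R v)) = s *\<^sub>R vf_apply (left_inv_field mul v) \<psi> ?y" for s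
    using linear_cmul[OF linear_DL] linear_cmul[OF has_derivative_linear[OF smooth_map_has_derivative[OF assms]]]
    by (simp add: vf_apply_def left_inv_field_DL)
  moreover have "mul ?y (s *\<^sub>R v) = mul x ((t + s) *\<^sub>R v)" for s
    by (simp add: assoc exp_coords)
  ultimately show "((\<lambda>s. \<psi> (mul x ((t + s) *\<^sub>R v))) has_vector_derivative vf_apply (left_inv_field mul v) \<psi> ?y) (at 0)"
    by (simp add: has_vector_derivative_def)
qed

text \<open>Left-invariant fields are divergence-free, because right translations preserve Lebesgue measure.\<close>

lemma integral_vf_apply_zero:
  assumes \<psi>: "\<psi> \<in> test_functions UNIV"
  shows "(\<integral>x. vf_apply (left_inv_field mul v) \<psi> x \<partial>lborel) = 0"
proof -
  define Z where "Z = vf_apply (left_inv_field mul v) \<psi>"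
  define S where "S = closure (support_on UNIV \<psi>)"
  note t = test_function_outside[OF \<psi>]
  have S: "compact S" using t by (simp add: S_def)
  have out: "\<psi> x = 0" "Z x = 0" if "x \<notin> S" for x using t that by (simp_all add: S_def Z_def)
  have cont: "continuous_on UNIV \<psi>" "continuous_on UNIV Z"
    unfolding Z_def by (intro smooth_map_continuous smooth_vf_apply smooth_left_inv_field t)+
  have [measurable]: "\<psi> \<in> borel_measurable borel" "Z \<in> borel_measurable borel"
    by (rule borel_measurable_continuous_onI[OF cont(1)], rule borel_measurable_continuous_onI[OF cont(2)])
  obtain C where C: "0 \<le> C" "\<And>x. \<bar>Z x\<bar> \<le> C" using compact_support_bounded[OF cont(2) S out(2)] by blast
  \<comment> \<open>Contains the supports of all right translates of \<psi> by
    \<open>t *\<^sub>R v\<close> with t in [0,1]; with the bound \<open>C\<close> from the mean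
    value theorem it dominates the difference quotients.\<close>
  define K' where "K' = (\<lambda>(x, t::real). mul x (- (t *\<^sub>R v))) ` (S \<times> {0..1})"
  have K': "compact K'" unfolding K'_def split_beta'
    by (intro compact_continuous_image compact_Times S compact_Icc continuous_intros)
  then have [measurable]: "K' \<in> sets borel" by (simp add: borel_closed compact_imp_closed)
  have outK: "\<psi> (mul x (t *\<^sub>R v)) = 0" if "x \<notin> K'" "t \<in> {0..1}" for x t
  proof (rule out(1), rule notI)
    assume "mul x (t *\<^sub>R v) \<in> S"
    then have "mul (mul x (t *\<^sub>R v)) (- (t *\<^sub>R v)) \<in> K'" unfolding K'_def using that(2) by (intro image_eqI[of _ _ "(mul x (t *\<^sub>R v), t)"]) auto
    then show False using that(1) by simp
  qed
  have bnd: "\<bar>\<psi> (mul x (h *\<^sub>R v)) - \<psi> x\<bar> \<le> h * C" if h: "0 < h" for x h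
  proof -
    obtain z where z: "\<psi> (mul x (h *\<^sub>R v)) - \<psi> (mul x (0 *\<^sub>R v)) = (h - 0) * vf_apply (left_inv_field mul v) \<psi> (mul x (z *\<^sub>R v))"
      using MVT2[OF h, of "\<lambda>s. \<psi> (mul x (s *\<^sub>R v))" "\<lambda>s. vf_apply (left_inv_field mul v) \<psi> (mul x (s *\<^sub>R v))"]
        has_derivative_along_field[OF t(1)] by blast
    then have "\<bar>\<psi> (mul x (h *\<^sub>R v)) - \<psi> x\<bar> = h * \<bar>Z (mul x (z *\<^sub>R v))\<bar>" using h by (simp add: abs_mult Z_def)
    then show ?thesis using C(2) h by (simp add: mult_left_mono)
  qed
  define h where "h = (\<lambda>n. inverse (real (Suc n)))"
  have h: "0 < h n" "h n \<le> 1" for n by (simp_all add: h_def field_simps)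
  define D where "D = (\<lambda>n x. (\<psi> (mul x (h n *\<^sub>R v)) - \<psi> x) / h n)"
  have int\<psi>: "integrable lborel \<psi>" by (rule compact_support_integrable[OF cont(1) S out(1)])
  have intt: "integrable lborel (\<lambda>x. \<psi> (mul x y)) \<and> (\<integral>x. \<psi> (mul x y) \<partial>lborel) = (\<integral>x. \<psi> x \<partial>lborel)" for y
    using integrable_distr[of "\<lambda>x. mul x y" lborel borel \<psi>] integral_distr[of "\<lambda>x. mul x y" lborel borel \<psi>] int\<psi>
    by (simp add: distr_mul_right)
  have D0: "(\<integral>x. D n x \<partial>lborel) = 0" for n
    unfolding D_def using intt[of "h n *\<^sub>R v"] int\<psi> by simp
  have "(\<lambda>n. \<integral>x. D n x \<partial>lborel) \<longlonglongrightarrow> (\<integral>x. Z x \<partial>lborel)"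
  proof (rule integral_dominated_convergence[where w = "\<lambda>x. C * indicator K' x"])
    show "integrable lborel (\<lambda>x. C * indicator K' x)"
      using emeasure_compact_finite[OF K'] by simp
    show "AE x in lborel. (\<lambda>n. D n x) \<longlonglongrightarrow> Z x"
    proof (rule AE_I2)
      fix x
      have "((\<lambda>s. (\<psi> (mul x ((0 + s) *\<^sub>R v)) - \<psi> (mul x (0 *\<^sub>R v))) / s) \<longlongrightarrow> Z (mul x (0 *\<^sub>R v))) (at 0)"
        using has_derivative_along_field[OF t(1), of x v 0] by (simp add: DERIV_def Z_def)
      moreover have "filterlim h (at 0) sequentially"
        using h(1) LIMSEQ_inverse_real_of_nat unfolding h_def by (auto simp: filterlim_at)
      ultimately have "(\<lambda>n. (\<psi> (mul x ((0 + h n) *\<^sub>R v)) - \<psi> (mul x (0 *\<^sub>R v))) / h n) \<longlonglongrightarrow> Z (mul x (0 *\<^sub>R v))"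
        by (rule filterlim_compose)
      then show "(\<lambda>n. D n x) \<longlonglongrightarrow> Z x" by (simp add: D_def)
    qed
    show "AE x in lborel. norm (D n x) \<le> C * indicator K' x" for n
    proof (rule AE_I2)
      fix x
      show "norm (D n x) \<le> C * indicator K' x"
      proof (cases "x \<in> K'")
        case True
        then show ?thesis using bnd[OF h(1), of x n] h(1)[of n] by (simp add: D_def divide_le_eq mult.commute)
      next
        case False
        then show ?thesis using outK[OF False, of "h n"] outK[OF False, of 0] h[of n] by (simp add: D_def)
      qed
    qed
  qed (unfold D_def, measurable)
  then show ?thesis by (simp add: D0 Z_def LIMSEQ_const_iff)
qed

text \<open>Integration by parts for the test function l \<phi>, whose derivative along the field
  has integral zero. Additivity of \<open>l\<close> for the group law makes the derivative of
  \<open>l\<close> along the field the constant \<open>l v\<close>.\<close>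

lemma wd_linear:
  assumes l: "linear l" and hom: "\<And>x y. l (mul x y) = l x + l y"
  shows "wd (left_inv_field mul v) \<Omega> l (\<lambda>x. l v)"
  unfolding wd_def
proof (intro conjI ballI)
  have bl: "bounded_linear l" using l linear_conv_bounded_linear by blast
  then have "Lqloc 1 l" by (intro Lqloc_continuous linear_continuous_on) auto
  then show "Lloc1 \<Omega> l" by (simp add: Lqloc_def Lloc1_def)
  have "Lqloc 1 (\<lambda>x::real^'n. l v)" by (rule Lqloc_continuous) auto
  then show "Lloc1 \<Omega> (\<lambda>x. l v)" by (simp add: Lqloc_def Lloc1_def)
  fix \<phi> assume \<phi>: "\<phi> \<in> test_functions \<Omega>"
  note t = test_function_outside[OF \<phi>]
  define S where "S = closure (support_on UNIV \<phi>)"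
  have S: "compact S" using t by (simp add: S_def)
  have out: "\<phi> x = 0" "vf_apply (left_inv_field mul v) \<phi> x = 0" if "x \<notin> S" for x using t that by (simp_all add: S_def)
  define \<psi> where "\<psi> = (\<lambda>x. l x * \<phi> x)"
  have sl: "smooth_map l" by (rule smooth_map_bounded_linear[OF bl])
  have sp: "smooth_map \<psi>" unfolding \<psi>_def by (intro smooth_map_mult sl t)
  have "closure (support_on UNIV \<psi>) \<subseteq> S"
    unfolding S_def by (rule closure_mono) (auto simp: support_on_def \<psi>_def)
  then have "\<psi> \<in> test_functions UNIV"
    using sp closed_subset_compact[OF S closed_closure] by (simp add: test_functions_def)
  then have z: "(\<integral>x. vf_apply (left_inv_field mul v) \<psi> x \<partial>lborel) = 0" by (rule integral_vf_apply_zero)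
  have Dl: "l (DL x 0 v) = l v" for x
  proof -
    have "(l has_derivative (\<lambda>h. l (DL x 0 h))) (at 0)"
    proof -
      have "((\<lambda>y. l (mul x y)) has_derivative (\<lambda>h. l (DL x 0 h))) (at 0)"
        by (rule has_derivative_compose[OF has_derivative_mul_left bounded_linear_imp_has_derivative[OF bl]])
      then have "((\<lambda>y. l (mul x y) - l x) has_derivative (\<lambda>h. l (DL x 0 h) - 0)) (at 0)"
        by (intro has_derivative_diff has_derivative_const)
      then show ?thesis by (simp add: hom)
    qed
    from has_derivative_unique[OF this bounded_linear_imp_has_derivative[OF bl]] show ?thesis by metis
  qed
  have "vf_apply (left_inv_field mul v) \<psi> x = l x * vf_apply (left_inv_field mul v) \<phi> x + l v * \<phi> x" for x
  proof -
    have "(\<psi> has_derivative (\<lambda>h. l x * frechet_derivative \<phi> (at x) h + l h * \<phi> x)) (at x)"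
      unfolding \<psi>_def
      by (rule has_derivative_mult[OF bounded_linear_imp_has_derivative[OF bl] smooth_map_has_derivative[OF t(1)]])
    from fun_cong[OF frechet_derivative_at[OF this], of "left_inv_field mul v x"]
    show ?thesis by (simp add: vf_apply_def left_inv_field_DL Dl)
  qed
  then have e: "(\<integral>x. l x * vf_apply (left_inv_field mul v) \<phi> x + l v * \<phi> x \<partial>lborel) = 0" using z by simp
  have "integrable lborel (\<lambda>x. l x * vf_apply (left_inv_field mul v) \<phi> x)"
  proof (rule compact_support_integrable[OF _ S])
    show "continuous_on UNIV (\<lambda>x. l x * vf_apply (left_inv_field mul v) \<phi> x)"
      by (intro smooth_map_continuous smooth_map_mult sl smooth_vf_apply smooth_left_inv_field t)
  qed (simp add: out)
  moreover have "integrable lborel (\<lambda>x. l v * \<phi> x)"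
  proof (rule compact_support_integrable[OF _ S])
    show "continuous_on UNIV (\<lambda>x. l v * \<phi> x)"
      by (intro continuous_on_mult_left smooth_map_continuous t)
  qed (simp add: out)
  ultimately show "(\<integral>x. l x * vf_apply (left_inv_field mul v) \<phi> x \<partial>lborel) = - (\<integral>x. l v * \<phi> x \<partial>lborel)"
    using e by (subst (asm) Bochner_Integration.integral_add) auto
qed

lemma vf_apply_translate:
  assumes "smooth_map \<phi>"
  shows "vf_apply (left_inv_field mul v) (\<lambda>z. \<phi> (mul y z)) z = vf_apply (left_inv_field mul v) \<phi> (mul y z)"
proof -
  have "((\<lambda>z. \<phi> (mul y z)) has_derivative (\<lambda>h. frechet_derivative \<phi> (at (mul y z)) (DL y z h))) (at z)"
    using has_derivative_compose[OF has_derivative_mul_left[of y z] smooth_map_has_derivative[OF assms]] .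
  from fun_cong[OF frechet_derivative_at[OF this], of "left_inv_field mul v z"]
  show ?thesis using DL_chain[of y z 0 v] by (simp add: vf_apply_def left_inv_field_DL)
qed

text \<open>Fubini's theorem and the substitution z = y^-1 x shift the translations from
  \<open>u\<close> to the function it is integrated against.\<close>

lemma conv_integral:
  fixes u Z :: "real^'n \<Rightarrow> real"
  assumes u: "Lqloc 1 u" and \<rho>: "mollifier \<delta> \<rho>" and Z: "Z \<in> borel_measurable borel"
    and S: "compact S" and out: "\<And>x. x \<notin> S \<Longrightarrow> Z x = 0" and C: "\<And>x. \<bar>Z x\<bar> \<le> C"
  shows "(\<integral>x. conv \<rho> u x * Z x \<partial>lborel) = (\<integral>y. \<rho> y * (\<integral>z. u z * Z (mul y z) \<partial>lborel) \<partial>lborel)"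
proof -
  have um[measurable]: "u \<in> borel_measurable borel" using u by (rule Lqloc_measurable)
  have rm[measurable]: "\<rho> \<in> borel_measurable borel" using mollifierD[OF \<rho>] by simp
  note Z[measurable]
  have Sb[measurable]: "S \<in> sets borel" using S by (simp add: borel_closed compact_imp_closed)
  have C0: "0 \<le> C" using C[of undefined] by linarith
  define K where "K = tset (cball 0 \<delta>) S"
  have K: "compact K" unfolding K_def by (intro compact_tset S compact_cball)
  have Kb: "K \<in> sets borel" using K by (simp add: borel_closed compact_imp_closed)
  define L where "L = Lint 1 K u"
  have L: "L < \<infinity>" using u K by (simp add: L_def Lqloc_def)
  have Lu: "Lint 1 S (\<lambda>x. u (mul (- y) x)) \<le> L" if "norm y \<le> \<delta>" for y
    unfolding L_def using that by (intro Lint_translate_le um Kb) (auto simp: K_def intro!: tsetI)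
  have int: "integrable (lborel \<Otimes>\<^sub>M lborel) (\<lambda>(x, y). \<rho> y * u (mul (- y) x) * Z x)"
  proof (rule integrableI_bounded)
    show "(\<lambda>(x, y). \<rho> y * u (mul (- y) x) * Z x) \<in> borel_measurable (lborel \<Otimes>\<^sub>M lborel)" by measurable
    have "(\<integral>\<^sup>+p. ennreal (norm (case p of (x, y) \<Rightarrow> \<rho> y * u (mul (- y) x) * Z x)) \<partial>(lborel \<Otimes>\<^sub>M lborel)) =
       (\<integral>\<^sup>+y. (\<integral>\<^sup>+x. ennreal (norm (\<rho> y * u (mul (- y) x) * Z x)) \<partial>lborel) \<partial>lborel)"
      using pair_sigma_finite.nn_integral_snd[OF sigma_pair_lborel, of "\<lambda>(x, y). ennreal (norm (\<rho> y * u (mul (- y) x) * Z x))"]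
      by (simp add: split_beta')
    also have "\<dots> \<le> (\<integral>\<^sup>+y. ennreal (\<rho> y) * (ennreal C * L) \<partial>lborel)"
    proof (rule nn_integral_mono)
      fix y :: "real^'n"
      show "(\<integral>\<^sup>+x. ennreal (norm (\<rho> y * u (mul (- y) x) * Z x)) \<partial>lborel) \<le> ennreal (\<rho> y) * (ennreal C * L)"
      proof (cases "norm y \<le> \<delta>")
        case True
        have "(\<integral>\<^sup>+x. ennreal (norm (\<rho> y * u (mul (- y) x) * Z x)) \<partial>lborel) \<le>
            (\<integral>\<^sup>+x. ennreal (\<rho> y * C) * (ennreal (norm (u (mul (- y) x)) powr 1) * indicator S x) \<partial>lborel)"
        proof (rule nn_integral_mono)
          fix x
          show "ennreal (norm (\<rho> y * u (mul (- y) x) * Z x)) \<le> ennreal (\<rho> y * C) * (ennreal (norm (u (mul (- y) x)) powr 1) * indicator S x)"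
          proof (cases "x \<in> S")
            case True
            have "\<rho> y * \<bar>u (mul (- y) x)\<bar> * \<bar>Z x\<bar> \<le> \<rho> y * \<bar>u (mul (- y) x)\<bar> * C"
              using C mollifierD(5)[OF \<rho>, of y] by (intro mult_left_mono) auto
            then show ?thesis using True C0 mollifierD(5)[OF \<rho>, of y]
              by (simp add: abs_mult ennreal_mult[symmetric] ennreal_leI mult_ac)
          qed (simp add: out)
        qed
        also have "\<dots> = ennreal (\<rho> y * C) * Lint 1 S (\<lambda>x. u (mul (- y) x))"
          unfolding Lint_def by (rule nn_integral_cmult) measurable
        also have "\<dots> \<le> ennreal (\<rho> y * C) * L" by (intro mult_left_mono Lu True) auto
        also have "\<dots> = ennreal (\<rho> y) * (ennreal C * L)"
          using C0 mollifierD(5)[OF \<rho>, of y] by (simp add: ennreal_mult mult.assoc)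
        finally show ?thesis .
      qed (use mollifierD(3)[OF \<rho>, of y] in simp)
    qed
    also have "\<dots> = ennreal C * L" using mollifierD(6)[OF \<rho>] by (simp add: nn_integral_multc)
    also have "\<dots> < \<infinity>" using L by (simp add: ennreal_mult_less_top)
    finally show "(\<integral>\<^sup>+p. ennreal (norm (case p of (x, y) \<Rightarrow> \<rho> y * u (mul (- y) x) * Z x)) \<partial>(lborel \<Otimes>\<^sub>M lborel)) < \<infinity>" .
  qed
  have "(\<integral>x. conv \<rho> u x * Z x \<partial>lborel) = (\<integral>x. (\<integral>y. \<rho> y * u (mul (- y) x) * Z x \<partial>lborel) \<partial>lborel)"
    by (simp add: conv_def)
  also have "\<dots> = (\<integral>y. (\<integral>x. \<rho> y * u (mul (- y) x) * Z x \<partial>lborel) \<partial>lborel)"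
    using pair_sigma_finite.Fubini_integral[OF sigma_pair_lborel int] by simp
  also have "\<dots> = (\<integral>y. \<rho> y * (\<integral>z. u z * Z (mul y z) \<partial>lborel) \<partial>lborel)"
  proof (rule Bochner_Integration.integral_cong[OF refl])
    fix y
    have "(\<integral>x. u (mul (- y) x) * Z x \<partial>lborel) = (\<integral>z. u z * Z (mul y z) \<partial>lborel)"
      using integral_distr[of "mul y" lborel borel "\<lambda>x. u (mul (- y) x) * Z x"] by (simp add: distr_mul_left)
    then show "(\<integral>x. \<rho> y * u (mul (- y) x) * Z x \<partial>lborel) = \<rho> y * (\<integral>z. u z * Z (mul y z) \<partial>lborel)"
      by (simp add: mult.assoc)
  qed
  finally show ?thesis .
qed

text \<open>For \<open>y\<close> in the support of the kernel, z \<mapsto> \<phi>(y z) is a test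
  function on \<open>A\<close>, and left invariance of the field lets differentiation commute with
  this translation. Testing \<open>u\<close> with it and averaging over \<open>y\<close> gives the
  claim.\<close>

lemma wd_conv:
  assumes w: "wd (left_inv_field mul v) A u g" and u: "Lqloc 1 u" and g: "Lqloc 1 g" and \<rho>: "mollifier \<delta> \<rho>"
    and sub: "tset (cball 0 \<delta>) A' \<subseteq> A"
  shows "wd (left_inv_field mul v) A' (conv \<rho> u) (conv \<rho> g)"
  unfolding wd_def
proof (intro conjI ballI)
  show "Lloc1 A' (conv \<rho> u)" "Lloc1 A' (conv \<rho> g)"
    using Lqloc_conv[OF u \<rho>] Lqloc_conv[OF g \<rho>] by (auto simp: Lqloc_def Lloc1_def)
  let ?Y = "left_inv_field mul v"
  fix \<phi> assume \<phi>: "\<phi> \<in> test_functions A'"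
  note t = test_function_outside[OF \<phi>]
  define S where "S = closure (support_on UNIV \<phi>)"
  have S: "compact S" "S \<subseteq> A'" using t by (simp_all add: S_def)
  have out: "\<phi> x = 0" "vf_apply ?Y \<phi> x = 0" if "x \<notin> S" for x using t that by (simp_all add: S_def)
  have c: "continuous_on UNIV \<phi>" "continuous_on UNIV (vf_apply ?Y \<phi>)"
    by (intro smooth_map_continuous smooth_vf_apply smooth_left_inv_field t)+
  obtain C1 where C1: "\<And>x. \<bar>\<phi> x\<bar> \<le> C1" using compact_support_bounded[OF c(1) S(1) out(1)] by blast
  obtain C2 where C2: "\<And>x. \<bar>vf_apply ?Y \<phi> x\<bar> \<le> C2" using compact_support_bounded[OF c(2) S(1) out(2)] by blast
  have key: "\<rho> y * (\<integral>z. u z * vf_apply ?Y \<phi> (mul y z) \<partial>lborel) = - (\<rho> y * (\<integral>z. g z * \<phi> (mul y z) \<partial>lborel))" for y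
  proof (cases "norm y \<le> \<delta>")
    case True
    define \<psi> where "\<psi> = (\<lambda>z. \<phi> (mul y z))"
    have "smooth_map \<psi>" unfolding \<psi>_def by (rule smooth_map_compose[OF t(1) smooth_map_mul_left])
    moreover have sup: "closure (support_on UNIV \<psi>) \<subseteq> mul (- y) ` S"
    proof (rule closure_minimal)
      show "support_on UNIV \<psi> \<subseteq> mul (- y) ` S"
      proof
        fix z assume "z \<in> support_on UNIV \<psi>"
        then have "mul y z \<in> S" using out(1)[of "mul y z"] by (auto simp: support_on_def \<psi>_def)
        then show "z \<in> mul (- y) ` S" by (metis image_eqI mul_neg_cancel(1))
      qed
      show "closed (mul (- y) ` S)"
        by (intro compact_imp_closed compact_continuous_image S continuous_intros)
    qed
    moreover have "mul (- y) ` S \<subseteq> A"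
    proof -
      have "mul (- y) ` S \<subseteq> tset (cball 0 \<delta>) A'" using True S(2) by (auto intro!: tsetI)
      then show ?thesis using sub by blast
    qed
    moreover have "compact (closure (support_on UNIV \<psi>))"
    proof (rule closed_subset_compact[OF _ closed_closure sup])
      show "compact (mul (- y) ` S)" by (intro compact_continuous_image S continuous_intros)
    qed
    ultimately have "\<psi> \<in> test_functions A" by (auto simp: test_functions_def)
    then have "(\<integral>z. u z * vf_apply ?Y \<psi> z \<partial>lborel) = - (\<integral>z. g z * \<psi> z \<partial>lborel)" using w by (simp add: wd_def)
    then show ?thesis unfolding \<psi>_def vf_apply_translate[OF t(1)] by simp
  qed (use mollifierD(3)[OF \<rho>, of y] in simp)
  show "(\<integral>x. conv \<rho> u x * vf_apply ?Y \<phi> x \<partial>lborel) = - (\<integral>x. conv \<rho> g x * \<phi> x \<partial>lborel)"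
  proof -
    have "(\<integral>x. conv \<rho> u x * vf_apply ?Y \<phi> x \<partial>lborel) = (\<integral>y. \<rho> y * (\<integral>z. u z * vf_apply ?Y \<phi> (mul y z) \<partial>lborel) \<partial>lborel)"
      by (rule conv_integral[OF u \<rho> borel_measurable_continuous_onI[OF c(2)] S(1) out(2) C2])
    also have "\<dots> = (\<integral>y. - (\<rho> y * (\<integral>z. g z * \<phi> (mul y z) \<partial>lborel)) \<partial>lborel)"
      by (simp only: key)
    also have "\<dots> = - (\<integral>y. \<rho> y * (\<integral>z. g z * \<phi> (mul y z) \<partial>lborel) \<partial>lborel)"
      by simp
    also have "(\<integral>y. \<rho> y * (\<integral>z. g z * \<phi> (mul y z) \<partial>lborel) \<partial>lborel) = (\<integral>x. conv \<rho> g x * \<phi> x \<partial>lborel)"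
      by (rule conv_integral[OF g \<rho> borel_measurable_continuous_onI[OF c(1)] S(1) out(1) C1, symmetric])
    finally show ?thesis .
  qed
qed

lemma conv_vec_nth:
  fixes g :: "real^'n \<Rightarrow> real^'m"
  assumes "Lqloc 1 g" "mollifier \<delta> \<rho>"
  shows "conv \<rho> g x $ j = conv \<rho> (\<lambda>x. g x $ j) x"
  using integral_bounded_linear[OF bounded_linear_vec_nth[of j] conv_integrable[OF assms, of x]]
  by (simp add: conv_def)

end

lemma weak_derivative_mono:
  assumes w: "weak_derivative Y \<Omega>' u g" and sub: "\<Omega> \<subseteq> \<Omega>'"
  shows "weak_derivative Y \<Omega> u g"
  unfolding weak_derivative_def
proof (intro conjI ballI)
  show "u \<in> Lp_loc 1 \<Omega>" "g \<in> Lp_loc 1 \<Omega>" using w sub by (auto simp: weak_derivative_def Lp_loc_def)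
  fix \<phi> assume \<phi>: "\<phi> \<in> test_functions \<Omega>"
  note t = test_function_outside[OF \<phi>]
  have "(LINT x:\<Omega>|lebesgue. u x * vf_apply Y \<phi> x) = (LINT x:\<Omega>'|lebesgue. u x * vf_apply Y \<phi> x)"
    "(LINT x:\<Omega>|lebesgue. g x * \<phi> x) = (LINT x:\<Omega>'|lebesgue. g x * \<phi> x)"
    unfolding set_lebesgue_integral_def
    by (rule Bochner_Integration.integral_cong[OF refl]; use t sub in \<open>fastforce split: split_indicator\<close>)+
  then show "(LINT x:\<Omega>|lebesgue. u x * vf_apply Y \<phi> x) = - (LINT x:\<Omega>|lebesgue. g x * \<phi> x)"
    using w \<phi> test_functions_mono[OF sub] by (auto simp: weak_derivative_def)
qed

context carnot_group
begin

section \<open>The horizontal gradient on an open set\<close>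

lemma weak_hgrad_unique:
  assumes "open \<Omega>" "is_weak_hgrad mul X \<Omega> u g" "is_weak_hgrad mul X \<Omega> u h"
  shows "AE x in lebesgue. x \<in> \<Omega> \<longrightarrow> g x = h x"
proof -
  have "AE x in lebesgue. \<forall>j. x \<in> \<Omega> \<longrightarrow> g x $ j = h x $ j"
    by (subst AE_all_countable, intro allI weak_derivative_unique[OF smooth_left_inv_field])
       (use assms in \<open>auto simp: is_weak_hgrad_def\<close>)
  then show ?thesis by eventually_elim (simp add: vec_eq_iff)
qed

lemma hgrad_eq:
  assumes "open \<Omega>" "is_weak_hgrad mul X \<Omega> u g"
  shows "AE x in lebesgue. x \<in> \<Omega> \<longrightarrow> hgrad mul X \<Omega> u x = g x"
  by (rule weak_hgrad_unique[OF assms(1) _ assms(2)]) (unfold hgrad_def, rule someI[of _ g], rule assms(2))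

text \<open>\<open>hgrad\<close> selects a gradient on all of \<open>A\<close>, while
  \<open>sobolev_loc\<close> provides one on each relatively compact part only. By uniqueness the
  local gradients fit together, so the selection is made from a nonempty set.\<close>

lemma sobolev_loc_weak_hgrad:
  fixes X :: "'m::finite \<Rightarrow> real^'n"
  assumes A: "open A" and u: "u \<in> sobolev_loc mul X 1 A"
  shows "\<exists>g. is_weak_hgrad mul X A u g"
proof -
  obtain C where C: "\<And>n. compact (C n)" "\<And>n. C n \<subseteq> A" "\<And>n. C n \<subseteq> interior (C (Suc n))" "\<Union>(range C) = A"
      "\<And>K. compact K \<Longrightarrow> K \<subseteq> A \<Longrightarrow> \<exists>N::nat. \<forall>n\<ge>N. K \<subseteq> C n"
    using open_Union_compact_subsets[OF A] by metis
  define Q where "Q = (\<lambda>n. interior (C n))"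
  have Qo: "open (Q n)" and Qb: "Q n \<in> sets borel" for n by (simp_all add: Q_def)
  have QA: "Q n \<subseteq> A" for n using C(2) interior_subset by (auto simp: Q_def)
  have QC: "closure (Q n) \<subseteq> C n" for n
    unfolding Q_def by (rule closure_minimal[OF interior_subset compact_imp_closed[OF C(1)]])
  have "Q n \<subseteq> Q (Suc n)" for n unfolding Q_def using C(3)[of n] interior_subset by blast
  then have Qmono: "m \<le> n \<Longrightarrow> Q m \<subseteq> Q n" for m n by (rule lift_Suc_mono_le)
  have QK: "\<exists>n. K \<subseteq> Q n" if "compact K" "K \<subseteq> A" for K
    using C(5)[OF that] C(3) unfolding Q_def by (meson order_refl subset_trans)
  have "\<exists>g. is_weak_hgrad mul X (Q n) u g" for n
  proof -
    have "compact (closure (Q n))" by (rule closed_subset_compact[OF C(1) closed_closure QC])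
    moreover have "closure (Q n) \<subseteq> A" using QC C(2) by blast
    ultimately show ?thesis using u Qo unfolding sobolev_loc_def sobolev_def by blast
  qed
  then obtain G where G: "\<And>n. is_weak_hgrad mul X (Q n) u (G n)" by metis
  \<comment> \<open>Each point uses the gradient of the first exhausting set that contains it; this
    agrees almost everywhere on \<open>Q n\<close> with \<open>G n\<close>, for every
    \<open>n\<close>.\<close>
  define N where "N = (\<lambda>x. LEAST n. x \<in> Q n)"
  define g where "g = (\<lambda>x. G (N x) x)"
  have ae: "AE x in lebesgue. x \<in> Q n \<longrightarrow> g x = G n x" for n
  proof -
    have "AE x in lebesgue. \<forall>m. m \<le> n \<longrightarrow> x \<in> Q m \<longrightarrow> G m x = G n x"
      unfolding AE_all_countable
    proof
      fix m
      show "AE x in lebesgue. m \<le> n \<longrightarrow> x \<in> Q m \<longrightarrow> G m x = G n x"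
      proof (cases "m \<le> n")
        case True
        have "is_weak_hgrad mul X (Q m) u (G n)"
          using G[of n] weak_derivative_mono[OF _ Qmono[OF True]] by (simp add: is_weak_hgrad_def)
        from weak_hgrad_unique[OF Qo G this] show ?thesis by eventually_elim simp
      qed simp
    qed
    then show ?thesis
    proof eventually_elim
      fix x assume *: "\<forall>m\<le>n. x \<in> Q m \<longrightarrow> G m x = G n x"
      show "x \<in> Q n \<longrightarrow> g x = G n x"
      proof
        assume x: "x \<in> Q n"
        have "N x \<le> n" "x \<in> Q (N x)" unfolding N_def using x by (auto intro: Least_le LeastI)
        then show "g x = G n x" using * by (simp add: g_def)
      qed
    qed
  qed
  have "weak_derivative (left_inv_field mul (X j)) A u (\<lambda>x. g x $ j)" for j
  proof -
    let ?Y = "left_inv_field mul (X j)"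
    have w: "weak_derivative ?Y (Q n) u (\<lambda>x. G n x $ j)" for n using G by (simp add: is_weak_hgrad_def)
    have wg: "weak_derivative ?Y (Q n) u (\<lambda>x. g x $ j)" for n
    proof -
      obtain u0 where u0: "u0 \<in> borel_measurable borel" "AE x in lebesgue. x \<in> Q n \<longrightarrow> u x = u0 x"
        using lebesgue_representative[OF Qo[of n], of u 1] w[of n] unfolding weak_derivative_def by metis
      obtain g' where g': "Lloc1 (Q n) g'" "AE x in lebesgue. x \<in> Q n \<longrightarrow> G n x $ j = g' x" "wd ?Y (Q n) u0 g'"
        by (rule weak_derivative_representative[OF smooth_left_inv_field Qo w]) (use u0 in blast)
      have "AE x in lebesgue. x \<in> Q n \<longrightarrow> g x $ j = g' x" using ae[of n] g'(2) by eventually_elim auto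
      from weak_derivative_iff_wd[OF smooth_left_inv_field Qo u0(2,1) this _ _ g'(1), of "X j"] g'(1,3)
      show ?thesis by (simp add: wd_def Lloc1_def)
    qed
    show ?thesis unfolding weak_derivative_def
    proof (intro conjI ballI)
      have loc: "f \<in> Lp_loc 1 A" if "\<And>n. f \<in> Lp_loc 1 (Q n)" for f
        unfolding Lp_loc_def
      proof (intro CollectI allI impI)
        fix K assume K: "compact K \<and> K \<subseteq> A"
        then obtain n where "K \<subseteq> Q n" using QK by blast
        then show "f \<in> Lp 1 K" using that[of n] K by (simp add: Lp_loc_def)
      qed
      show "u \<in> Lp_loc 1 A" using w by (intro loc) (simp add: weak_derivative_def)
      show "(\<lambda>x. g x $ j) \<in> Lp_loc 1 A" using wg by (intro loc) (simp add: weak_derivative_def)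
      fix \<phi> assume \<phi>: "\<phi> \<in> test_functions A"
      note t = test_function_outside[OF \<phi>]
      obtain n where n: "closure (support_on UNIV \<phi>) \<subseteq> Q n" using QK[OF t(2,3)] by blast
      then have \<phi>n: "\<phi> \<in> test_functions (Q n)" using t by (simp add: test_functions_def)
      have "(LINT x:A|lebesgue. u x * vf_apply ?Y \<phi> x) = (LINT x:Q n|lebesgue. u x * vf_apply ?Y \<phi> x)"
        "(LINT x:A|lebesgue. g x $ j * \<phi> x) = (LINT x:Q n|lebesgue. g x $ j * \<phi> x)"
        unfolding set_lebesgue_integral_def
        by (rule Bochner_Integration.integral_cong[OF refl]; use test_function_outside[OF \<phi>n] QA in \<open>fastforce split: split_indicator\<close>)+
      then show "(LINT x:A|lebesgue. u x * vf_apply ?Y \<phi> x) = - (LINT x:A|lebesgue. g x $ j * \<phi> x)"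
        using wg[of n] \<phi>n by (simp add: weak_derivative_def)
    qed
  qed
  then show ?thesis unfolding is_weak_hgrad_def by blast
qed

lemma sobolev_loc_of_wd:
  fixes X :: "'m::finite \<Rightarrow> real^'n"
  assumes \<Omega>: "open \<Omega>" and w: "\<And>j. wd (left_inv_field mul (X j)) \<Omega> u (\<lambda>x. g x $ j)"
  shows "is_weak_hgrad mul X \<Omega> u g" "u \<in> sobolev_loc mul X 1 \<Omega>"
proof -
  have l: "Lloc1 \<Omega> u" "Lloc1 \<Omega> (\<lambda>x. g x $ j)" for j using w by (auto simp: wd_def)
  have hg: "is_weak_hgrad mul X \<Omega>' u g" if "open \<Omega>'" "\<Omega>' \<subseteq> \<Omega>" for \<Omega>'
    unfolding is_weak_hgrad_def
  proof
    fix j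
    have l': "Lloc1 \<Omega>' u" "Lloc1 \<Omega>' (\<lambda>x. g x $ j)" using l that(2) by (auto intro: Lloc1_mono)
    show "weak_derivative (left_inv_field mul (X j)) \<Omega>' u (\<lambda>x. g x $ j)"
      using weak_derivative_iff_wd[OF smooth_left_inv_field that(1) _ _ _ _ l', of u "\<lambda>x. g x $ j" "X j"] l'
        wd_mono[OF w that(2)] by (simp add: Lloc1_def)
  qed
  then show "is_weak_hgrad mul X \<Omega> u g" using \<Omega> by simp
  have Lp: "f \<in> Lp 1 \<Omega>'" if f: "Lloc1 \<Omega> f" and \<Omega>': "open \<Omega>'" "compact (closure \<Omega>')" "closure \<Omega>' \<subseteq> \<Omega>" for f :: "real^'n \<Rightarrow> real" and \<Omega>'
  proof (rule Lp_of_Lint)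
    have "Lint 1 \<Omega>' f \<le> Lint 1 (closure \<Omega>') f" by (rule Lint_mono) (auto simp: closure_subset)
    also have "\<dots> < \<infinity>" using f \<Omega>' by (simp add: Lloc1_def)
    finally show "Lint 1 \<Omega>' f < \<infinity>" .
  qed (use f \<Omega>' in \<open>auto simp: Lloc1_def\<close>)
  show "u \<in> sobolev_loc mul X 1 \<Omega>"
    unfolding sobolev_loc_def sobolev_def
  proof (intro CollectI allI impI conjI exI[of _ g])
    fix \<Omega>' assume *: "open \<Omega>' \<and> compact (closure \<Omega>') \<and> closure \<Omega>' \<subseteq> \<Omega>"
    show "u \<in> Lp 1 \<Omega>'" using * by (intro Lp l) auto
    show "is_weak_hgrad mul X \<Omega>' u g" using * closure_subset[of \<Omega>'] by (intro hg) auto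
    show "(\<lambda>x. g x $ j) \<in> Lp 1 \<Omega>'" for j using * by (intro Lp l) auto
  qed
qed

end

section \<open>Measures and the topology of local \<open>L\<^sup>p\<close>\<close>

text \<open>The bound is known on open sets only; outer regularity of Lebesgue measure carries it
  over to null sets.\<close>

lemma null_measure_of_bound:
  fixes \<mu> :: "'a::euclidean_space measure"
  assumes s: "sets \<mu> = sets borel" and A: "open A"
    and bnd: "\<And>W. open W \<Longrightarrow> W \<subseteq> A \<Longrightarrow> emeasure \<mu> W \<le> ennreal C * emeasure lborel W"
    and N: "N \<in> sets borel" "N \<subseteq> A" "emeasure lborel N = 0"
  shows "emeasure \<mu> N = 0"
proof (rule ccontr)
  assume "emeasure \<mu> N \<noteq> 0"
  then have "0 < emeasure \<mu> N" by (simp add: zero_less_iff_neq_zero)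
  then obtain r where r: "r > 0" "ennreal r < emeasure \<mu> N" by (rule ennreal_between_zero)
  \<comment> \<open>Chosen so that \<open>C\<close> times e is at most r, also when \<open>C\<close>
    is zero or negative.\<close>
  define e where "e = r / (max C 0 + 1)"
  have e: "e > 0" using r by (simp add: e_def add_nonneg_pos)
  obtain T where T: "open T" "N \<subseteq> T" "emeasure lebesgue (T - N) < ennreal e"
    using sets_lebesgue_outer_open[of N e] N e by (metis sets_completionI_sets sets_lborel)
  have TN: "T \<inter> A \<in> sets borel" using T A by auto
  have "emeasure lborel (T \<inter> A) \<le> emeasure lborel ((T - N) \<union> N)"
    using T N(1) by (intro emeasure_mono) auto
  also have "\<dots> \<le> emeasure lborel (T - N) + emeasure lborel N"
    using T N(1) by (intro emeasure_subadditive) auto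
  also have "\<dots> = emeasure lebesgue (T - N)" using T N by simp
  finally have "emeasure lborel (T \<inter> A) \<le> ennreal e" using T(3) by simp
  then have "emeasure \<mu> (T \<inter> A) \<le> ennreal C * ennreal e"
    using bnd[of "T \<inter> A"] T(1) A by (meson Int_lower2 mult_left_mono open_Int order_trans zero_le)
  moreover have "emeasure \<mu> N \<le> emeasure \<mu> (T \<inter> A)"
    using T N TN s by (intro emeasure_mono) auto
  moreover have "ennreal C * ennreal e \<le> ennreal r"
  proof -
    have "ennreal C * ennreal e \<le> ennreal (max C 0) * ennreal e" by (intro mult_right_mono ennreal_leI) auto
    also have "\<dots> = ennreal (max C 0 * e)" using e by (simp add: ennreal_mult)
    also have "\<dots> \<le> ennreal r" unfolding e_def using r by (intro ennreal_leI) (simp add: field_simps max_def)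
    finally show ?thesis .
  qed
  ultimately show False using r by (meson leD order_trans)
qed

text \<open>Vitali's theorem provides disjoint balls on which the local estimate holds and which
  miss only a Lebesgue null set of \<open>A\<close>. Absolute continuity of \<mu>, drawn from
  \<open>bnd\<close>, lets \<mu> ignore that set; as \<open>A\<close> has finite volume,
  \<open>e\<close> can tend to 0 after summation.\<close>

lemma local_comparison:
  fixes \<mu> \<nu> :: "'a::euclidean_space measure"
  assumes s: "sets \<mu> = sets borel" "sets \<nu> = sets borel" and A: "open A" "bounded A"
    and bnd: "\<And>W. open W \<Longrightarrow> W \<subseteq> A \<Longrightarrow> emeasure \<mu> W \<le> ennreal C * emeasure lborel W"
    and loc: "\<And>x e. x \<in> A \<Longrightarrow> e > 0 \<Longrightarrow> \<exists>r>0. \<forall>s. 0 < s \<longrightarrow> s \<le> r \<longrightarrow> ball x s \<subseteq> A \<and>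
        emeasure \<mu> (ball x s) \<le> emeasure \<nu> (ball x s) + ennreal e * emeasure lborel (ball x s)"
  shows "emeasure \<mu> A \<le> emeasure \<nu> A"
proof -
  have step: "emeasure \<mu> A \<le> emeasure \<nu> A + ennreal e * emeasure lborel A" if e: "e > 0" for e
  proof -
    define K where "K = {(x, s). x \<in> A \<and> 0 < s \<and> ball x s \<subseteq> A \<and>
        emeasure \<mu> (ball x s) \<le> emeasure \<nu> (ball x s) + ennreal e * emeasure lborel (ball x s)}"
    have cov: "\<exists>i. i \<in> K \<and> x \<in> ball (fst i) (snd i) \<and> snd i < d" if x: "x \<in> A" and d: "0 < d" for x d
    proof -
      obtain r where r: "r > 0" "\<And>s. 0 < s \<Longrightarrow> s \<le> r \<Longrightarrow> ball x s \<subseteq> A \<and>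
        emeasure \<mu> (ball x s) \<le> emeasure \<nu> (ball x s) + ennreal e * emeasure lborel (ball x s)"
        using loc[OF x e] by blast
      define s where "s = min r (d / 2)"
      have "0 < s" "s \<le> r" "s < d" using r(1) d by (auto simp: s_def)
      then show ?thesis using r(2)[of s] x by (intro exI[of _ "(x, s)"]) (auto simp: K_def)
    qed
    obtain C where C: "countable C" "C \<subseteq> K"
        "pairwise (\<lambda>i j. disjnt (ball (fst i) (snd i)) (ball (fst j) (snd j))) C"
        "negligible (A - (\<Union>i\<in>C. ball (fst i) (snd i)))"
      using Vitali_covering_theorem_balls[of A K fst snd, OF cov] by blast
    define B where "B = (\<lambda>i::'a \<times> real. ball (fst i) (snd i))"
    define U where "U = (\<Union>i\<in>C. B i)"
    have Bo: "B i \<in> sets borel" for i by (simp add: B_def)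
    have Uo: "open U" by (auto simp: U_def B_def)
    have BA: "B i \<subseteq> A" if "i \<in> C" for i using subsetD[OF C(2) that] by (cases i) (simp add: K_def B_def)
    have UA: "U \<subseteq> A" using BA by (auto simp: U_def)
    have dis: "disjoint_family_on B C"
      using C(3) by (auto simp: disjoint_family_on_def pairwise_def disjnt_def B_def)
    have eU: "emeasure N U = (\<integral>\<^sup>+i. emeasure N (B i) \<partial>count_space C)" if "sets N = sets borel" for N
      unfolding U_def by (rule emeasure_UN_countable[OF _ C(1) dis]) (use that Bo in auto)
    have N: "A - U \<in> sets borel" using A Uo by auto
    have "emeasure lborel (A - U) = 0"
      using C(4) N by (simp add: U_def B_def negligible_iff_emeasure0)
    then have z: "emeasure \<mu> (A - U) = 0"
      using null_measure_of_bound[OF s(1) A(1) bnd N] by auto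
    have "A = U \<union> (A - U)" using UA by auto
    then have "emeasure \<mu> A \<le> emeasure \<mu> U + emeasure \<mu> (A - U)"
      using emeasure_subadditive[of U \<mu> "A - U"] s N Uo by (metis borel_open)
    also have "\<dots> = (\<integral>\<^sup>+i. emeasure \<mu> (B i) \<partial>count_space C)" using z eU[OF s(1)] by simp
    also have "\<dots> \<le> (\<integral>\<^sup>+i. emeasure \<nu> (B i) + ennreal e * emeasure lborel (B i) \<partial>count_space C)"
      using C(2) by (intro nn_integral_mono) (auto simp: K_def B_def)
    also have "\<dots> = emeasure \<nu> U + ennreal e * emeasure lborel U"
      using eU[OF s(2)] eU[of lborel] by (simp add: nn_integral_add nn_integral_cmult)
    also have "\<dots> \<le> emeasure \<nu> A + ennreal e * emeasure lborel A"
      using UA A s by (intro add_mono mult_left_mono emeasure_mono) auto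
    finally show ?thesis .
  qed
  have fin: "emeasure lborel A < \<infinity>" using A emeasure_bounded_finite by auto
  then obtain m where m: "emeasure lborel A = ennreal m" "m \<ge> 0" by (cases "emeasure lborel A") auto
  show ?thesis
  proof (rule ennreal_le_epsilon)
    fix e :: real assume e: "e > 0"
    have "ennreal (e / (m + 1)) * ennreal m \<le> ennreal e"
      using m e by (simp add: ennreal_mult[symmetric] field_simps ennreal_leI)
    then show "emeasure \<mu> A \<le> emeasure \<nu> A + ennreal e"
      using step[of "e / (m + 1)"] e m by (metis add_left_mono add_nonneg_pos divide_pos_pos order_trans zero_less_one)
  qed
qed

lemma ex_AE_lborel: "(AE x in lborel. P x) \<Longrightarrow> \<exists>x::'a::euclidean_space. P x"
proof (rule ccontr)
  assume ae: "AE x in lborel. P x" and "\<nexists>x::'a. P x"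
  from ae obtain N where N: "{x \<in> space (lborel :: 'a measure). \<not> P x} \<subseteq> N" "emeasure lborel N = 0" "N \<in> sets lborel"
    by (rule AE_E)
  then have "N = UNIV" using \<open>\<nexists>x. P x\<close> by auto
  then show False using N(2) by (simp add: emeasure_lborel_UNIV)
qed

context carnot_group
begin

section \<open>Uniqueness of invariant measures\<close>

lemma open_mul_image: "open A \<Longrightarrow> open (mul y ` A)"
proof -
  assume A: "open A"
  have "mul y ` A = mul (- y) -` A" by (auto simp: image_iff) (metis mul_neg_cancel(2))
  then show ?thesis using open_vimage[OF A, of "mul (- y)"] by (simp add: continuous_on_mul)
qed

lemma bounded_mul_image: "bounded A \<Longrightarrow> bounded (mul y ` A)"
proof -
  assume "bounded A"
  then have "compact (mul y ` closure A)" by (intro compact_continuous_image continuous_intros) (simp add: compact_closure)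
  then show ?thesis by (meson bounded_subset closure_subset compact_imp_bounded image_mono)
qed

text \<open>The bound makes \<nu> absolutely continuous, and invariance makes its density
  \<open>h\<close> agree almost everywhere with each of its left translates. Fubini's theorem then
  fixes one point \<open>x\<close> with h(y x) = h(x) for almost all \<open>y\<close>, so
  \<open>h\<close> is almost everywhere constant.\<close>

lemma haar_unique:
  assumes s: "sets \<nu> = sets borel"
    and bnd: "\<And>A. A \<in> bounded_opens \<Longrightarrow> emeasure \<nu> A \<le> ennreal C * emeasure lborel A"
    and inv: "\<And>y A. A \<in> bounded_opens \<Longrightarrow> emeasure \<nu> (mul y ` A) = emeasure \<nu> A"
  shows "\<exists>c. \<forall>A\<in>bounded_opens. emeasure \<nu> A = c * emeasure lborel A"
proof -
  have "absolutely_continuous lborel \<nu>"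
    unfolding absolutely_continuous_def
  proof
    fix N assume "N \<in> null_sets (lborel :: (real^'n) measure)"
    then have N: "N \<in> sets borel" "emeasure lborel N = 0" by auto
    have z: "emeasure \<nu> (N \<inter> ball 0 (real n)) = 0" for n
    proof (rule null_measure_of_bound[OF s, of "ball 0 (real n)" C])
      show "emeasure \<nu> W \<le> ennreal C * emeasure lborel W" if "open W" "W \<subseteq> ball 0 (real n)" for W
        using that bounded_subset[OF bounded_ball] by (intro bnd) (auto simp: bounded_opens_def)
      have "emeasure lborel (N \<inter> ball 0 (real n)) \<le> emeasure lborel N" using N by (intro emeasure_mono) auto
      then show "emeasure lborel (N \<inter> ball 0 (real n)) = 0" using N by simp
    qed (use N in auto)
    have "N = (\<Union>n. N \<inter> ball 0 (real n))"
      using reals_Archimedean2 by (auto simp: dist_norm)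
    moreover have "emeasure \<nu> (\<Union>n. N \<inter> ball 0 (real n)) = 0"
      using z N s by (intro emeasure_UN_eq_0) auto
    ultimately show "N \<in> null_sets \<nu>" using N s by auto
  qed
  then obtain h where hm: "h \<in> borel_measurable lborel" and h: "density lborel h = \<nu>"
    using sigma_finite_measure.Radon_Nikodym[OF sigma_finite_lborel, of \<nu>] s by auto
  have hb[measurable]: "h \<in> borel_measurable borel" using hm by simp
  have hA: "emeasure \<nu> A = (\<integral>\<^sup>+x. h x * indicator A x \<partial>lborel)" if "A \<in> sets borel" for A
    using that unfolding h[symmetric] by (subst emeasure_density) auto
  have box: "box u v \<in> bounded_opens" for u v :: "real^'n" by (simp add: bounded_opens_def open_box)
  have fin: "emeasure \<nu> (box u v) \<noteq> \<infinity>" for u v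
  proof -
    have "emeasure \<nu> (box u v) < \<infinity>"
      using bnd[OF box[of u v]] by (rule order_le_less_trans) (use emeasure_bounded_finite[OF bounded_box, of u v] in \<open>simp add: ennreal_mult_less_top\<close>)
    then show ?thesis by simp
  qed
  have ae: "AE x in lborel. h (mul y x) = h x" for y
  proof -
    have "density lborel (\<lambda>x. h (mul y x)) = \<nu>"
    proof (rule measure_eqI_generator_eq[where E = "range (\<lambda>(a, b). box a b)" and \<Omega> = UNIV and A = "\<lambda>n. box (- (real n *\<^sub>R One)) (real n *\<^sub>R One)"])
      show "Int_stable (range (\<lambda>(a, b). box a b :: (real^'n) set))"
        by (auto simp: Int_stable_def box_Int_box)
      show "sets (density lborel (\<lambda>x. h (mul y x))) = sigma_sets UNIV (range (\<lambda>(a, b). box a b))" "sets \<nu> = sigma_sets UNIV (range (\<lambda>(a, b). box a b))"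
        by (simp_all add: s borel_eq_box)
      show "(\<Union>n. box (- (real n *\<^sub>R One)) (real n *\<^sub>R One)) = (UNIV :: (real^'n) set)"
        by (rule UN_box_eq_UNIV)
      have eq: "emeasure (density lborel (\<lambda>x. h (mul y x))) (box u v) = emeasure \<nu> (box u v)" for u v
      proof -
        have ob: "mul y ` box u v \<in> sets borel" using open_mul_image[OF open_box, of y u v] by (rule borel_open)
        have "emeasure (density lborel (\<lambda>x. h (mul y x))) (box u v) = (\<integral>\<^sup>+x. h (mul y x) * indicator (box u v) x \<partial>lborel)"
          by (subst emeasure_density) auto
        also have "\<dots> = (\<integral>\<^sup>+x. (\<lambda>z. h z * indicator (mul y ` box u v) z) (mul y x) \<partial>lborel)"
          by (rule nn_integral_cong) (auto split: split_indicator, metis mul_neg_cancel(1))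
        also have "\<dots> = (\<integral>\<^sup>+z. h z * indicator (mul y ` box u v) z \<partial>lborel)"
          using ob by (intro nn_integral_mul_left borel_measurable_times_ennreal hb borel_measurable_indicator)
        also have "\<dots> = emeasure \<nu> (mul y ` box u v)" using hA[OF ob] by simp
        also have "\<dots> = emeasure \<nu> (box u v)" by (rule inv[OF box])
        finally show ?thesis .
      qed
      then show "emeasure (density lborel (\<lambda>x. h (mul y x))) X = emeasure \<nu> X" if "X \<in> range (\<lambda>(a, b). box a b)" for X
        using that by auto
      show "emeasure (density lborel (\<lambda>x. h (mul y x))) (box (- (real n *\<^sub>R One)) (real n *\<^sub>R One)) \<noteq> \<infinity>" for n
        unfolding eq by (rule fin)
    qed auto
    then have "density lborel (\<lambda>x. h (mul y x)) = density lborel h" using h by simp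
    then show ?thesis
      by (intro sigma_finite_measure.density_unique[OF sigma_finite_lborel]) auto
  qed
  \<comment> \<open>The exceptional null set of \<open>ae\<close> depends on \<open>y\<close>;
    exchanging the quantifiers isolates a single good \<open>x\<close>.\<close>
  have "AE x in lborel. AE y in lborel. h (mul y x) = h x"
  proof (subst pair_sigma_finite.AE_commute[OF sigma_pair_lborel])
    have "Measurable.pred (borel \<Otimes>\<^sub>M borel) (\<lambda>p::(real^'n) \<times> (real^'n). h (mul (snd p) (fst p)) = h (fst p))"
      by measurable
    then show "{x \<in> space (lborel \<Otimes>\<^sub>M lborel). h (mul (snd x) (fst x)) = h (fst x)} \<in> sets (lborel \<Otimes>\<^sub>M lborel)"
      by (simp add: pred_def space_pair_measure cong: sets_pair_measure_cong)
    show "AE y in lborel. AE x in lborel. h (mul y x) = h x" using ae by simp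
  qed
  then obtain x where x: "AE y in lborel. h (mul y x) = h x" using ex_AE_lborel by blast
  \<comment> \<open>The points where \<open>h\<close> differs from c form a right translate by
    \<open>x\<close> of a null set; right translations preserve null sets.\<close>
  define c where "c = h x"
  have "(\<integral>\<^sup>+z. indicator {z. h z \<noteq> c} z \<partial>lborel) = (\<integral>\<^sup>+y. indicator {z. h z \<noteq> c} (mul y x) \<partial>lborel)"
    by (rule nn_integral_mul_right[symmetric]) measurable
  also have "\<dots> = (\<integral>\<^sup>+y. 0 \<partial>(lborel :: (real^'n) measure))"
    using x by (intro nn_integral_cong_AE, eventually_elim) (simp add: c_def)
  finally have "emeasure lborel {z. h z \<noteq> c} = 0" by simp
  then have aec: "AE z in lborel. h z = c"
    by (intro AE_I[of _ _ "{z. h z \<noteq> c}"]) auto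
  show ?thesis
  proof (intro exI[of _ c] ballI)
    fix A :: "(real^'n) set" assume "A \<in> bounded_opens"
    then have A: "A \<in> sets borel" by (simp add: bounded_opens_def)
    have "emeasure \<nu> A = (\<integral>\<^sup>+x. c * indicator A x \<partial>lborel)"
      unfolding hA[OF A] using aec by (intro nn_integral_cong_AE, eventually_elim) simp
    then show "emeasure \<nu> A = c * emeasure lborel A" using A by (simp add: nn_integral_cmult_indicator)
  qed
qed

end

section \<open>Convergence in the topology of local L^p\<close>

lemma Lp_seminorm_Lint:
  fixes v w :: "'a::euclidean_space \<Rightarrow> real"
  assumes v: "v \<in> borel_measurable borel" and ae: "AE x in lebesgue. u x = v x" and K: "K \<in> sets borel"
  shows "Lp_seminorm q K u = enn2real (Lint q K v) powr (1 / q)"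
proof -
  have vm[measurable]: "v \<in> borel_measurable lebesgue" using v by (simp add: measurable_completion)
  have um[measurable]: "u \<in> borel_measurable lebesgue"
    by (rule borel_measurable_AE[OF vm]) (use ae in \<open>eventually_elim, simp\<close>)
  have [measurable]: "K \<in> sets lebesgue" using K by simp
  have "(LINT x:K|lebesgue. \<bar>u x\<bar> powr q) = enn2real (\<integral>\<^sup>+x. ennreal (indicator K x *\<^sub>R \<bar>u x\<bar> powr q) \<partial>lebesgue)"
    unfolding set_lebesgue_integral_def
  proof (rule integral_eq_nn_integral)
    show "(\<lambda>x. indicator K x *\<^sub>R \<bar>u x\<bar> powr q) \<in> borel_measurable lebesgue"
    proof -
      have 1: "(\<lambda>x. indicator K x *\<^sub>R u x) \<in> borel_measurable lebesgue"
        by (intro borel_measurable_scaleR borel_measurable_indicator um) simp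
      have 2: "indicator K x *\<^sub>R \<bar>u x\<bar> powr q = indicator K x *\<^sub>R \<bar>indicator K x *\<^sub>R u x\<bar> powr q" for x
        by (auto split: split_indicator)
      have "(\<lambda>x. indicator K x *\<^sub>R \<bar>indicator K x *\<^sub>R u x\<bar> powr q) \<in> borel_measurable lebesgue"
        using 1 by measurable
      then show ?thesis by (rule measurable_cong[THEN iffD1, rotated]) (rule 2[symmetric])
    qed
  qed auto
  also have "(\<integral>\<^sup>+x. ennreal (indicator K x *\<^sub>R \<bar>u x\<bar> powr q) \<partial>lebesgue) =
      (\<integral>\<^sup>+x. ennreal (norm (v x) powr q) * indicator K x \<partial>lebesgue)"
    using ae by (intro nn_integral_cong_AE, eventually_elim) (auto split: split_indicator)
  finally show ?thesis by (simp add: Lp_seminorm_def Lint_def nn_integral_completion)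
qed

lemma Lqloc_imp_Lp_loc: "Lqloc q u \<Longrightarrow> u \<in> Lp_loc q UNIV" for u :: "'a::euclidean_space \<Rightarrow> real"
  by (rule Lp_loc_of_Lint[of u]) (auto simp: Lqloc_def)

lemma Lp_loc_representative:
  assumes "u \<in> Lp_loc q UNIV"
  obtains v where "Lqloc q v" "AE x in lebesgue. u x = v x"
  using lebesgue_representative[OF open_UNIV assms] by (auto simp: Lqloc_def)

text \<open>A diagonal choice: errors controlled on growing balls yield one sequence that converges
  on every compact set.\<close>

lemma Lint_exhaust_tendsto:
  assumes K: "compact K" and q: "0 \<le> q"
    and w: "\<And>n. Lint q (cball 0 (real n)) (w n) \<le> ennreal (1 / real (Suc n))"
  shows "(\<lambda>n. Lint q K (w n)) \<longlonglongrightarrow> 0"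
proof (rule tendsto_sandwich[OF _ _ tendsto_const])
  obtain r where "\<And>x. x \<in> K \<Longrightarrow> norm x \<le> r" using compact_imp_bounded[OF K] by (auto simp: bounded_iff)
  then have r: "K \<subseteq> cball 0 r" by auto
  obtain n0 where n0: "r \<le> real n0" using real_arch_simple by blast
  show "eventually (\<lambda>n. Lint q K (w n) \<le> ennreal (1 / real (Suc n))) sequentially"
  proof (rule eventually_sequentiallyI)
    fix n assume "n0 \<le> n"
    then have "K \<subseteq> cball 0 (real n)" using r n0 by (auto intro: order_trans)
    then show "Lint q K (w n) \<le> ennreal (1 / real (Suc n))"
      using w[of n] Lint_mono[of K "cball 0 (real n)" "w n" "w n" q] q by (auto intro: order_trans)
  qed
  have "(\<lambda>n. ennreal (1 / real (Suc n))) \<longlonglongrightarrow> ennreal 0"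
    using LIMSEQ_inverse_real_of_nat by (intro tendsto_ennrealI) (simp add: inverse_eq_divide)
  then show "(\<lambda>n. ennreal (1 / real (Suc n))) \<longlonglongrightarrow> 0" by simp
qed simp

lemma Lqloc_diff: "Lqloc q u \<Longrightarrow> Lqloc q v \<Longrightarrow> 1 \<le> q \<Longrightarrow> Lqloc q (\<lambda>x. u x - v x)"
  using Lqloc_add[of q u "\<lambda>x. (- 1) *\<^sub>R v x"] Lqloc_scale[of q v "- 1"] by simp

text \<open>Induction over the generation of the topology leaves the subbasic balls. Their centre
  \<open>u\<close> differs from the limit \<open>w\<close> in general, so the strict inequality for
  w - u has to survive adding the small term \<open>wn n - w\<close>.\<close>

lemma eventually_in_Lp_loc_open:
  fixes w :: "'a::euclidean_space \<Rightarrow> real"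
  assumes U: "openin (Lp_loc_topology q) U" and q: "1 \<le> q" and w: "Lqloc q w" and wn: "\<And>n. Lqloc q (wn n)"
    and lim: "\<And>K. compact K \<Longrightarrow> (\<lambda>n. Lint q K (\<lambda>x. wn n x - w x)) \<longlonglongrightarrow> 0" and wU: "w \<in> U"
  shows "eventually (\<lambda>n. wn n \<in> U) sequentially"
proof -
  have "generate_topology_on {{v \<in> Lp_loc q UNIV. Lp_seminorm q K (\<lambda>x. v x - u x) < r} | K u r.
        compact K \<and> u \<in> Lp_loc q UNIV \<and> 0 < r} U"
    using U unfolding Lp_loc_topology_def openin_topology_generated_by_iff .
  then show ?thesis using wU
  proof induction
    case (Basis s)
    then obtain K u r where s: "s = {v \<in> Lp_loc q UNIV. Lp_seminorm q K (\<lambda>x. v x - u x) < r}"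
      and K: "compact K" and u: "u \<in> Lp_loc q UNIV" and r: "0 < r" by blast
    have Kb: "K \<in> sets borel" using K by (simp add: borel_closed compact_imp_closed)
    obtain u0 where u0: "Lqloc q u0" "AE x in lebesgue. u x = u0 x" using Lp_loc_representative[OF u] by metis
    have sem: "Lp_seminorm q K (\<lambda>x. v x - u x) = enn2real (Lint q K (\<lambda>x. v x - u0 x)) powr (1 / q)" if v: "Lqloc q v" for v
      by (rule Lp_seminorm_Lint[OF Lqloc_measurable[OF Lqloc_diff[OF v u0(1) q]] _ Kb]) (use u0(2) in \<open>eventually_elim, simp\<close>)
    have "Lint q K (\<lambda>x. w x - u0 x) < \<infinity>" using Lqloc_diff[OF w u0(1) q] K by (simp add: Lqloc_def)
    then obtain l where l: "Lint q K (\<lambda>x. w x - u0 x) = ennreal l" "0 \<le> l" by (cases "Lint q K (\<lambda>x. w x - u0 x)") auto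
    have "l powr (1 / q) < r" using Basis(2) l sem[OF w] by (simp add: s)
    then have "(l powr (1 / q)) powr q < r powr q" using q by (intro powr_less_mono2) auto
    then have lr: "l < r powr q" using l q by (simp add: powr_powr)
    \<comment> \<open>For small t the factor in front of the fixed term is so close to 1 that it
      stays below r^q; the factor of the small term may be large, since that term tends to
      0.\<close>
    have "((\<lambda>t. (1 - t) powr (1 - q) * l) \<longlongrightarrow> (1 - 0) powr (1 - q) * l) (at_right (0::real))"
      by (intro tendsto_intros) auto
    then have "eventually (\<lambda>t. (1 - t) powr (1 - q) * l < r powr q) (at_right (0::real))"
      using lr by (intro order_tendstoD(2)) auto
    moreover have "eventually (\<lambda>t::real. t < 1) (at_right 0)" by (rule eventually_at_rightI[of 0 1]) auto
    moreover have "eventually (\<lambda>t::real. 0 < t) (at_right 0)" by (rule eventually_at_right_less)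
    ultimately have "eventually (\<lambda>t::real. (1 - t) powr (1 - q) * l < r powr q \<and> t < 1 \<and> 0 < t) (at_right 0)"
      by (intro eventually_conj)
    then obtain t :: real where t: "(1 - t) powr (1 - q) * l < r powr q" "t < 1" "0 < t"
      using eventually_happens by fastforce
    have "(\<lambda>n. ennreal ((1 - t) powr (1 - q) * l) + ennreal (t powr (1 - q)) * Lint q K (\<lambda>x. wn n x - w x)) \<longlonglongrightarrow>
        ennreal ((1 - t) powr (1 - q) * l) + ennreal (t powr (1 - q)) * 0"
      by (intro tendsto_add tendsto_const tendsto_mult_ennreal lim[OF K]) auto
    then have "eventually (\<lambda>n. ennreal ((1 - t) powr (1 - q) * l) + ennreal (t powr (1 - q)) * Lint q K (\<lambda>x. wn n x - w x) < ennreal (r powr q)) sequentially"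
      using t r by (intro order_tendstoD(2)) (auto simp: ennreal_less_iff l)
    then show ?case
    proof eventually_elim
      case (elim n)
      have "Lint q K (\<lambda>x. wn n x - u0 x) = Lint q K (\<lambda>x. (w x - u0 x) + (wn n x - w x))" by simp
      also have "\<dots> \<le> ennreal ((1 - t) powr (1 - q)) * Lint q K (\<lambda>x. w x - u0 x) + ennreal (t powr (1 - q)) * Lint q K (\<lambda>x. wn n x - w x)"
        by (intro Lint_add Kb q t Lqloc_measurable[OF Lqloc_diff[OF w u0(1) q]] Lqloc_measurable[OF Lqloc_diff[OF wn w q]])
      also have "\<dots> = ennreal ((1 - t) powr (1 - q) * l) + ennreal (t powr (1 - q)) * Lint q K (\<lambda>x. wn n x - w x)"
        using l by (simp add: ennreal_mult)
      finally have "Lint q K (\<lambda>x. wn n x - u0 x) < ennreal (r powr q)" using elim by simp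
      then have "enn2real (Lint q K (\<lambda>x. wn n x - u0 x)) < r powr q"
        by (cases "Lint q K (\<lambda>x. wn n x - u0 x)") (auto simp: ennreal_less_iff)
      then have "enn2real (Lint q K (\<lambda>x. wn n x - u0 x)) powr (1 / q) < (r powr q) powr (1 / q)"
        using q by (intro powr_less_mono2) auto
      then have "Lp_seminorm q K (\<lambda>x. wn n x - u x) < r" using r q by (simp add: sem[OF wn] powr_powr)
      then show ?case using Lqloc_imp_Lp_loc[OF wn] by (simp add: s)
    qed
  next
    case (Int s t)
    then show ?case by (auto intro: eventually_conj)
  next
    case (UN k)
    then obtain s where "s \<in> k" "w \<in> s" by blast
    then have "eventually (\<lambda>n. wn n \<in> s) sequentially" using UN by blast
    then show ?case by eventually_elim (use \<open>s \<in> k\<close> in blast)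
  qed simp
qed

section \<open>Invariant functionals\<close>

locale invariant_functional = carnot_group mul minv V k
  for mul :: "real^'n \<Rightarrow> real^'n \<Rightarrow> real^'n" and minv V k +
  fixes X :: "'m::finite \<Rightarrow> real^'n" and p a b :: real and F :: "(real^'n) functional"
  assumes basis: "is_basis_of X (V 1)" and p: "1 \<le> p"
    and incr: "increasing_functional p F" and locality: "local_functional p F"
    and left_inv: "left_invariant_functional mul minv p F" and meas: "measure_functional p F"
    and cvx: "convex_functional p F" and lsc: "lsc_functional p F"
    and add_const: "\<And>u A c. u \<in> Lp_loc p UNIV \<Longrightarrow> A \<in> bounded_opens \<Longrightarrow> F (\<lambda>x. u x + c) A = F u A"
    and ab: "0 < a" "0 < b"
    and growth: "\<And>u A. u \<in> Lp_loc p UNIV \<Longrightarrow> A \<in> bounded_opens \<Longrightarrow> u \<in> sobolev_loc mul X 1 A \<Longrightarrow>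
           F u A \<le> (\<integral>\<^sup>+x\<in>A. ennreal (a + b * norm (hgrad mul X A u x) powr p) \<partial>lebesgue)"
begin

text \<open>The counterpart of \<open>is_weak_hgrad\<close> for Borel representatives.\<close>

definition hg :: "(real^'n) set \<Rightarrow> (real^'n \<Rightarrow> real) \<Rightarrow> (real^'n \<Rightarrow> real^'m) \<Rightarrow> bool" where
  "hg W u g \<longleftrightarrow> (\<forall>j. wd (left_inv_field mul (X j)) W u (\<lambda>x. g x $ j))"

lemma hg_mono: "hg W' u g \<Longrightarrow> W \<subseteq> W' \<Longrightarrow> hg W u g"
  by (auto simp: hg_def intro: wd_mono)

lemma nn_integral_lebesgue_AE:
  assumes "AE x in lebesgue. x \<in> W \<longrightarrow> g x = h x"
  shows "(\<integral>\<^sup>+x\<in>W. f (g x) \<partial>lebesgue) = (\<integral>\<^sup>+x\<in>W. f (h x) \<partial>lborel)"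
proof -
  have "(\<integral>\<^sup>+x\<in>W. f (g x) \<partial>lebesgue) = (\<integral>\<^sup>+x\<in>W. f (h x) \<partial>lebesgue)"
    using assms by (intro nn_integral_cong_AE, eventually_elim) (auto split: split_indicator)
  then show ?thesis by (simp add: nn_integral_completion)
qed

lemma growth_hg:
  assumes u: "Lqloc p u" and W: "W \<in> bounded_opens" and g: "hg W u g"
  shows "F u W \<le> (\<integral>\<^sup>+x\<in>W. ennreal (a + b * norm (g x) powr p) \<partial>lborel)"
proof -
  have W': "open W" using W by (simp add: bounded_opens_def)
  note s = sobolev_loc_of_wd[OF W', of X u g] g[unfolded hg_def, rule_format]
  have "F u W \<le> (\<integral>\<^sup>+x\<in>W. ennreal (a + b * norm (hgrad mul X W u x) powr p) \<partial>lebesgue)"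
    by (rule growth[OF Lqloc_imp_Lp_loc[OF u] W]) (use s in blast)
  also have "\<dots> = (\<integral>\<^sup>+x\<in>W. ennreal (a + b * norm (g x) powr p) \<partial>lborel)"
    by (rule nn_integral_lebesgue_AE[OF hgrad_eq[OF W']]) (use s in blast)
  finally show ?thesis .
qed

lemma growth_bounded:
  assumes u: "Lqloc p u" and W: "W \<in> bounded_opens" and g: "hg W u g" and R: "\<And>x. x \<in> W \<Longrightarrow> norm (g x) \<le> R"
  shows "F u W \<le> ennreal (a + b * R powr p) * emeasure lborel W"
proof -
  have "F u W \<le> (\<integral>\<^sup>+x\<in>W. ennreal (a + b * norm (g x) powr p) \<partial>lborel)" by (rule growth_hg[OF u W g])
  also have "\<dots> \<le> (\<integral>\<^sup>+x. ennreal (a + b * R powr p) * indicator W x \<partial>lborel)"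
    using ab p by (intro nn_integral_mono)
      (auto split: split_indicator intro!: ennreal_leI mult_left_mono powr_mono2 R)
  also have "\<dots> = ennreal (a + b * R powr p) * emeasure lborel W"
    using W by (intro nn_integral_cmult_indicator) (simp add: bounded_opens_def)
  finally show ?thesis .
qed

lemma functional_measure:
  assumes "Lqloc p u"
  obtains \<mu> where "sets \<mu> = sets borel" "\<And>A. A \<in> bounded_opens \<Longrightarrow> F u A = emeasure \<mu> A"
  using bspec[OF meas[unfolded measure_functional_def] Lqloc_imp_Lp_loc[OF assms]] that by blast

lemma F_convex:
  assumes "Lqloc p u" "Lqloc p v" "A \<in> bounded_opens" "0 \<le> t" "t \<le> 1"
  shows "F (\<lambda>x. (1 - t) * u x + t * v x) A \<le> ennreal (1 - t) * F u A + ennreal t * F v A"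
  by (rule cvx[unfolded convex_functional_def, rule_format, OF assms(3) Lqloc_imp_Lp_loc Lqloc_imp_Lp_loc])
     (use assms in auto)

lemma hg_comb:
  assumes "hg W u g" "hg W v h"
  shows "hg W (\<lambda>x. c * u x + d * v x) (\<lambda>x. c *\<^sub>R g x + d *\<^sub>R h x)"
  unfolding hg_def
proof
  fix j
  let ?Y = "left_inv_field mul (X j)"
  have w: "wd ?Y W u (\<lambda>x. g x $ j)" "wd ?Y W v (\<lambda>x. h x $ j)" using assms by (auto simp: hg_def)
  have comb: "Lloc1 W (\<lambda>x. c * f x + d * f' x)" if "Lloc1 W f" "Lloc1 W f'" for f f' :: "real^'n \<Rightarrow> real"
    unfolding Lloc1_def
  proof (intro conjI allI impI)
    have [measurable]: "f \<in> borel_measurable borel" "f' \<in> borel_measurable borel" using that by (auto simp: Lloc1_def)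
    show "(\<lambda>x. c * f x + d * f' x) \<in> borel_measurable borel" by measurable
    fix K assume K: "compact K" "K \<subseteq> W"
    then have Kb: "K \<in> sets borel" by (simp add: borel_closed compact_imp_closed)
    have "Lint 1 K (\<lambda>x. c *\<^sub>R f x + d *\<^sub>R f' x) \<le> ennreal (2 powr (1 - 1)) * (Lint 1 K (\<lambda>x. c *\<^sub>R f x) + Lint 1 K (\<lambda>x. d *\<^sub>R f' x))"
      using Kb by (intro Lint_add_2) auto
    also have "\<dots> < \<infinity>" using that K Kb by (simp only: Lint_scale Lloc1_def) (simp add: ennreal_mult_less_top)
    finally show "Lint 1 K (\<lambda>x. c * f x + d * f' x) < \<infinity>" by simp
  qed
  have int: "integrable lborel (\<lambda>x. f x * Z x)"
    if f: "Lloc1 W f" and Z: "smooth_map Z" "compact S" "S \<subseteq> W" "\<And>x. x \<notin> S \<Longrightarrow> Z x = 0" for f Z :: "real^'n \<Rightarrow> real" and S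
  proof -
    obtain C where "\<And>x. \<bar>Z x\<bar> \<le> C"
      using compact_support_bounded[OF smooth_map_continuous[OF Z(1)] Z(2,4)] by blast
    then show ?thesis
      using f Z by (intro integrable_of_Lint[OF _ smooth_map_measurable[OF Z(1)], where K = S]) (auto simp: Lloc1_def borel_closed compact_imp_closed)
  qed
  show "wd ?Y W (\<lambda>x. c * u x + d * v x) (\<lambda>x. (c *\<^sub>R g x + d *\<^sub>R h x) $ j)"
    unfolding wd_def
  proof (intro conjI ballI)
    show "Lloc1 W (\<lambda>x. c * u x + d * v x)" using w by (intro comb) (auto simp: wd_def)
    show "Lloc1 W (\<lambda>x. (c *\<^sub>R g x + d *\<^sub>R h x) $ j)" using comb[of "\<lambda>x. g x $ j" "\<lambda>x. h x $ j"] w by (simp add: wd_def)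
    fix \<phi> assume \<phi>: "\<phi> \<in> test_functions W"
    note t = test_function_outside[OF \<phi>]
    have sv: "smooth_map (vf_apply ?Y \<phi>)" by (intro smooth_vf_apply smooth_left_inv_field t)
    have i: "integrable lborel (\<lambda>x. u x * vf_apply ?Y \<phi> x)" "integrable lborel (\<lambda>x. v x * vf_apply ?Y \<phi> x)"
      by (rule int[OF _ sv t(2,3,5)], use w in \<open>simp_all add: wd_def\<close>)+
    have i': "integrable lborel (\<lambda>x. g x $ j * \<phi> x)" "integrable lborel (\<lambda>x. h x $ j * \<phi> x)"
      by (rule int[OF _ t(1,2,3,4)], use w in \<open>simp_all add: wd_def\<close>)+
    have "(\<integral>x. (c * u x + d * v x) * vf_apply ?Y \<phi> x \<partial>lborel) =
      (\<integral>x. c * (u x * vf_apply ?Y \<phi> x) + d * (v x * vf_apply ?Y \<phi> x) \<partial>lborel)"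
      by (simp add: algebra_simps)
    also have "\<dots> = c * (\<integral>x. u x * vf_apply ?Y \<phi> x \<partial>lborel) + d * (\<integral>x. v x * vf_apply ?Y \<phi> x \<partial>lborel)"
      using i by simp
    also have "\<dots> = - (c * (\<integral>x. g x $ j * \<phi> x \<partial>lborel) + d * (\<integral>x. h x $ j * \<phi> x \<partial>lborel))"
      using w \<phi> by (simp add: wd_def)
    also have "c * (\<integral>x. g x $ j * \<phi> x \<partial>lborel) + d * (\<integral>x. h x $ j * \<phi> x \<partial>lborel) =
      (\<integral>x. c * (g x $ j * \<phi> x) + d * (h x $ j * \<phi> x) \<partial>lborel)"
      using i' by simp
    also have "\<dots> = (\<integral>x. (c *\<^sub>R g x + d *\<^sub>R h x) $ j * \<phi> x \<partial>lborel)"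
      by (simp add: algebra_simps)
    finally show "(\<integral>x. (c * u x + d * v x) * vf_apply ?Y \<phi> x \<partial>lborel) = - (\<integral>x. (c *\<^sub>R g x + d *\<^sub>R h x) $ j * \<phi> x \<partial>lborel)" .
  qed
qed

lemma Lqloc_comb: "Lqloc p u \<Longrightarrow> Lqloc p v \<Longrightarrow> Lqloc p (\<lambda>x. c * u x + d * v x)" for u v :: "real^'n \<Rightarrow> real"
  using Lqloc_add[OF Lqloc_scale[of p u c] Lqloc_scale[of p v d] p] by simp

text \<open>If the gradients of \<open>u\<close> and \<open>v\<close> differ by at most \<open>\<epsilon>\<close>, then \<open>u = (1 - \<epsilon>) v + \<epsilon> w\<close> with
  \<open>w = v + (u - v) / \<epsilon>\<close>, whose gradient is bounded independently of \<open>\<epsilon>\<close>; convexity does the rest.\<close>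

lemma F_close_gradients:
  assumes u: "Lqloc p u" and v: "Lqloc p v" and W: "W \<in> bounded_opens" and g: "hg W u g" and h: "hg W v h"
    and R: "\<And>x. x \<in> W \<Longrightarrow> norm (h x) \<le> R" and \<epsilon>: "0 < \<epsilon>" "\<epsilon> < 1" and d: "\<And>x. x \<in> W \<Longrightarrow> norm (g x - h x) \<le> \<epsilon>"
  shows "F u W \<le> F v W + ennreal (\<epsilon> * (a + b * (R + 1) powr p)) * emeasure lborel W"
proof -
  define w where "w = (\<lambda>x. (1 - 1 / \<epsilon>) * v x + (1 / \<epsilon>) * u x)"
  have wL: "Lqloc p w" unfolding w_def by (rule Lqloc_comb[OF v u])
  have hw: "hg W w (\<lambda>x. (1 - 1 / \<epsilon>) *\<^sub>R h x + (1 / \<epsilon>) *\<^sub>R g x)" unfolding w_def by (rule hg_comb[OF h g])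
  have "norm ((1 - 1 / \<epsilon>) *\<^sub>R h x + (1 / \<epsilon>) *\<^sub>R g x) \<le> R + 1" if "x \<in> W" for x
  proof -
    have "(1 - 1 / \<epsilon>) *\<^sub>R h x + (1 / \<epsilon>) *\<^sub>R g x = h x + (1 / \<epsilon>) *\<^sub>R (g x - h x)" by (simp add: algebra_simps)
    also have "norm \<dots> \<le> norm (h x) + norm (g x - h x) / \<epsilon>"
      using norm_triangle_ineq[of "h x" "(1 / \<epsilon>) *\<^sub>R (g x - h x)"] \<epsilon> by simp
    also have "\<dots> \<le> R + 1" using d[OF that] \<epsilon> by (intro add_mono R that) simp
    finally show ?thesis .
  qed
  then have Fw: "F w W \<le> ennreal (a + b * (R + 1) powr p) * emeasure lborel W"
    by (rule growth_bounded[OF wL W hw])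
  have "u = (\<lambda>x. (1 - \<epsilon>) * v x + \<epsilon> * w x)" using \<epsilon> by (simp add: w_def fun_eq_iff field_simps)
  then have "F u W \<le> ennreal (1 - \<epsilon>) * F v W + ennreal \<epsilon> * F w W"
    using F_convex[OF v wL W, of \<epsilon>] \<epsilon> by simp
  also have "\<dots> \<le> 1 * F v W + ennreal \<epsilon> * (ennreal (a + b * (R + 1) powr p) * emeasure lborel W)"
    using \<epsilon> by (intro add_mono mult_right_mono mult_left_mono Fw) (auto simp flip: ennreal_1 intro!: ennreal_leI)
  also have "\<dots> = F v W + ennreal (\<epsilon> * (a + b * (R + 1) powr p)) * emeasure lborel W"
    using \<epsilon> ab by (simp add: ennreal_mult mult.assoc)
  finally show ?thesis .
qed

section \<open>The candidate integrand\<close>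

text \<open>This is the homomorphism \<open>\<ell>\<^sub>\<eta>\<close>. It sees \<open>x\<close>
  only through its first layer, which is what makes it additive for the group law.\<close>

definition lin :: "real^'m \<Rightarrow> real^'n \<Rightarrow> real" where
  "lin \<eta> x = (\<Sum>j\<in>UNIV. \<eta> $ j * representation (range X) (pr 1 x) (X j))"

lemma X_basis: "inj X" "independent (range X)" "span (range X) = V 1"
  using basis by (auto simp: is_basis_of_def)

lemma lin_comb: "lin ((1 - t) *\<^sub>R \<xi> + t *\<^sub>R \<eta>) x = (1 - t) * lin \<xi> x + t * lin \<eta> x"
  by (simp add: lin_def sum_distrib_left sum.distrib[symmetric] algebra_simps sum_subtractf[symmetric])

lemma linear_lin: "linear (lin \<eta>)"
proof -
  have s: "pr 1 x \<in> span (range X)" for x using pr_in[of 1 x] X_basis(3) by simp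
  have "linear (\<lambda>x. representation (range X) (pr 1 x) (X j))" for j
    by (rule linearI)
       (simp_all only: linear_add[OF linear_pr] linear_cmul[OF linear_pr] representation_add[OF X_basis(2) s s]
          representation_scale[OF X_basis(2) s] real_scaleR_def)
  then show ?thesis unfolding lin_def
    by (intro linear_compose_sum ballI linear_compose_scale_right[where 'b = real, unfolded real_scaleR_def])
qed

lemma lin_mul: "lin \<eta> (mul x y) = lin \<eta> x + lin \<eta> y"
proof -
  have "lin \<eta> (mul x y) = lin \<eta> (x + y)"
    unfolding lin_def pr_1_mul by (simp only: linear_add[OF linear_pr])
  then show ?thesis using linear_add[OF linear_lin] by simp
qed

lemma lin_X: "lin \<eta> (X j) = \<eta> $ j"
proof -
  have "X j \<in> V 1" using X_basis(3) span_base[of "X j" "range X"] by auto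
  then have "pr 1 (X j) = X j" using pr_layer[of "X j" 1 1] step_pos by simp
  moreover have "representation (range X) (X j) (X i) = (if i = j then 1 else 0)" for i
    using representation_basis[OF X_basis(2), of "X j"] X_basis(1) by (auto simp: inj_eq)
  ultimately have "lin \<eta> (X j) = (\<Sum>i\<in>UNIV. \<eta> $ i * (if i = j then 1 else 0))"
    unfolding lin_def by (simp only:)
  then show ?thesis by (simp add: if_distrib cong: if_cong)
qed

lemma hg_lin: "hg W (lin \<eta>) (\<lambda>x. \<eta>)"
  unfolding hg_def using wd_linear[OF linear_lin lin_mul] by (simp add: lin_X[symmetric])

lemma Lqloc_lin: "Lqloc q (lin \<eta>)" if "0 \<le> q"
proof (rule Lqloc_continuous[OF _ that])
  show "continuous_on UNIV (lin \<eta>)"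
    using linear_lin linear_conv_bounded_linear linear_continuous_on by blast
qed

text \<open>Any set of positive finite volume could normalise; the quotient turns out to be the
  constant that \<open>haar_unique\<close> provides for the measure F(\<open>lin \<eta>\<close>,
  .).\<close>

definition dens :: "real^'m \<Rightarrow> ennreal" where
  "dens \<eta> = F (lin \<eta>) (ball 0 1) / emeasure lborel (ball (0::real^'n) 1)"

lemma unit_ball_emeasure: "0 < emeasure lborel (ball (0::real^'n) 1)" "emeasure lborel (ball (0::real^'n) 1) < top"
proof -
  show "emeasure lborel (ball (0::real^'n) 1) < top" using emeasure_bounded_finite[of "ball (0::real^'n) 1"] by simp
  show "0 < emeasure lborel (ball (0::real^'n) 1)"
    using content_ball_pos[of 1 "0::real^'n"] by (simp add: measure_def enn2real_positive_iff)
qed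

lemma p0: "0 \<le> p" using p by simp

lemma F_lin: "A \<in> bounded_opens \<Longrightarrow> F (lin \<eta>) A = dens \<eta> * emeasure lborel A"
proof -
  assume A: "A \<in> bounded_opens"
  obtain \<nu> where \<nu>: "sets \<nu> = sets borel" "\<And>A. A \<in> bounded_opens \<Longrightarrow> F (lin \<eta>) A = emeasure \<nu> A"
    using functional_measure[OF Lqloc_lin[OF p0]] by metis
  have "\<exists>c. \<forall>A\<in>bounded_opens. emeasure \<nu> A = c * emeasure lborel A"
  proof (rule haar_unique[OF \<nu>(1)])
    fix A :: "(real^'n) set" assume A: "A \<in> bounded_opens"
    show "emeasure \<nu> A \<le> ennreal (a + b * norm \<eta> powr p) * emeasure lborel A"
      using growth_bounded[OF Lqloc_lin[OF p0] A hg_lin, of \<eta> "norm \<eta>"] \<nu>(2)[OF A] by simp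
    fix y
    have yA: "mul y ` A \<in> bounded_opens" using A by (simp add: bounded_opens_def open_mul_image bounded_mul_image)
    have L: "lin \<eta> \<in> Lp_loc p UNIV" by (rule Lqloc_imp_Lp_loc[OF Lqloc_lin[OF p0]])
    \<comment> \<open>Translating \<open>lin \<eta>\<close> by \<open>y\<close> subtracts the
      constant \<open>lin \<eta> y\<close>, to which \<open>F\<close> is insensitive.\<close>
    have "F (lin \<eta>) (mul y ` A) = F (\<lambda>x. lin \<eta> x + - lin \<eta> y) (mul y ` A)" using add_const[OF L yA, of "- lin \<eta> y"] by simp
    also have "(\<lambda>x. lin \<eta> x + - lin \<eta> y) = (\<lambda>x. lin \<eta> (mul (minv y) x))"
      by (simp add: lin_mul minv_eq linear_neg[OF linear_lin])
    also have "F \<dots> (mul y ` A) = F (lin \<eta>) A"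
      using left_inv L A unfolding left_invariant_functional_def by blast
    finally show "emeasure \<nu> (mul y ` A) = emeasure \<nu> A" using \<nu>(2) A yA by simp
  qed
  then obtain c where c: "\<And>A. A \<in> bounded_opens \<Longrightarrow> F (lin \<eta>) A = c * emeasure lborel A" using \<nu>(2) by metis
  have "dens \<eta> = c"
    unfolding dens_def using c[of "ball 0 1"] unit_ball_emeasure
    by (simp add: bounded_opens_def mult_divide_eq_ennreal)
  then show ?thesis using c[OF A] by simp
qed

lemma ball_bounded_open: "ball x r \<in> bounded_opens"
  by (simp add: bounded_opens_def)

lemma dens_le: "dens \<eta> \<le> ennreal (a + b * norm \<eta> powr p)"
proof -
  have "F (lin \<eta>) (ball 0 1) \<le> ennreal (a + b * norm \<eta> powr p) * emeasure lborel (ball (0::real^'n) 1)"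
    by (rule growth_bounded[OF Lqloc_lin[OF p0] ball_bounded_open hg_lin]) simp
  then have "dens \<eta> \<le> ennreal (a + b * norm \<eta> powr p) * emeasure lborel (ball (0::real^'n) 1) / emeasure lborel (ball (0::real^'n) 1)"
    unfolding dens_def by (rule divide_right_mono_ennreal)
  then show ?thesis using unit_ball_emeasure by (simp add: mult_divide_eq_ennreal)
qed

lemma dens_convex: "convex_ennreal dens"
  unfolding convex_ennreal_def
proof (intro allI ballI)
  fix \<xi> \<eta> :: "real^'m" and t :: real assume t: "t \<in> {0..1}"
  let ?B = "ball (0::real^'n) 1"
  have "F (lin ((1 - t) *\<^sub>R \<xi> + t *\<^sub>R \<eta>)) ?B \<le> ennreal (1 - t) * F (lin \<xi>) ?B + ennreal t * F (lin \<eta>) ?B"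
    using F_convex[OF Lqloc_lin[OF p0] Lqloc_lin[OF p0] ball_bounded_open, of t \<xi> \<eta> 0 1] t
    by (simp add: lin_comb[abs_def])
  then have "dens ((1 - t) *\<^sub>R \<xi> + t *\<^sub>R \<eta>) \<le> (ennreal (1 - t) * F (lin \<xi>) ?B + ennreal t * F (lin \<eta>) ?B) / emeasure lborel ?B"
    unfolding dens_def by (rule divide_right_mono_ennreal)
  also have "\<dots> = ennreal (1 - t) * dens \<xi> + ennreal t * dens \<eta>"
    by (simp add: dens_def divide_ennreal_def distrib_right mult.assoc)
  finally show "dens ((1 - t) *\<^sub>R \<xi> + t *\<^sub>R \<eta>) \<le> ennreal (1 - t) * dens \<xi> + ennreal t * dens \<eta>" .
qed

text \<open>The integrand as a real function: it is finite by \<open>dens_le\<close>, so continuity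
  of finite convex functions and Jensen's inequality become available.\<close>

definition fr :: "real^'m \<Rightarrow> real" where "fr \<eta> = enn2real (dens \<eta>)"

lemma dens_fr: "dens \<eta> = ennreal (fr \<eta>)"
proof -
  have "dens \<eta> < top" using dens_le[of \<eta>] by (rule order_le_less_trans) simp
  then show ?thesis by (simp add: fr_def)
qed

lemma fr_nonneg: "0 \<le> fr \<eta>" by (simp add: fr_def)

lemma fr_le: "fr \<eta> \<le> a + b * norm \<eta> powr p"
  using dens_le[of \<eta>] ab unfolding dens_fr by (subst (asm) ennreal_le_iff) auto

lemma fr_convex: "convex_on UNIV fr"
proof (rule convex_onI)
  fix t :: real and x y :: "real^'m" assume t: "0 < t" "t < 1"
  have "ennreal (fr ((1 - t) *\<^sub>R x + t *\<^sub>R y)) \<le> ennreal (1 - t) * ennreal (fr x) + ennreal t * ennreal (fr y)"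
    using dens_convex t unfolding convex_ennreal_def dens_fr by simp
  also have "\<dots> = ennreal ((1 - t) * fr x + t * fr y)"
    using t fr_nonneg by (simp add: ennreal_mult[symmetric] ennreal_plus[symmetric] del: ennreal_plus)
  finally show "fr ((1 - t) *\<^sub>R x + t *\<^sub>R y) \<le> (1 - t) * fr x + t * fr y"
    using t fr_nonneg by (subst (asm) ennreal_le_iff) auto
qed simp

lemma fr_continuous: "continuous_on UNIV fr"
  by (rule convex_on_continuous[OF open_UNIV fr_convex])

section \<open>Functions with a continuous gradient\<close>

text \<open>On a small ball both F(v, .) and the measure with density fr(h) are close to
  F(\<open>lin (h x)\<close>, .), the functional with the gradient frozen at the centre.
  \<open>local_comparison\<close> in both directions turns this into equality.\<close>

lemma representation_continuous:
  assumes v: "Lqloc p v" and A: "A \<in> bounded_opens" and h: "hg A v h" and hc: "continuous_on UNIV h"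
    and R: "\<And>x. x \<in> A \<Longrightarrow> norm (h x) \<le> R"
  shows "F v A = (\<integral>\<^sup>+x\<in>A. ennreal (fr (h x)) \<partial>lborel)"
proof -
  have Ao: "open A" "bounded A" using A by (auto simp: bounded_opens_def)
  obtain \<mu> where \<mu>: "sets \<mu> = sets borel" "\<And>A. A \<in> bounded_opens \<Longrightarrow> F v A = emeasure \<mu> A"
    using functional_measure[OF v] by metis
  have fhc: "continuous_on UNIV (\<lambda>x. fr (h x))" by (rule continuous_on_compose2[OF fr_continuous hc]) simp
  have [measurable]: "(\<lambda>x. fr (h x)) \<in> borel_measurable borel" using fhc by (rule borel_measurable_continuous_onI)
  define \<nu> where "\<nu> = density lborel (\<lambda>x. ennreal (fr (h x)))"
  have \<nu>s: "sets \<nu> = sets borel" by (simp add: \<nu>_def)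
  have \<nu>: "emeasure \<nu> W = (\<integral>\<^sup>+x\<in>W. ennreal (fr (h x)) \<partial>lborel)" if "open W" for W
    using that unfolding \<nu>_def by (subst emeasure_density) auto
  define C where "C = a + b * R powr p"
  define C1 where "C1 = a + b * (R + 1) powr p"
  have C1: "C1 > 0" using ab by (simp add: C1_def add_pos_nonneg)
  have sub: "W \<in> bounded_opens" if "open W" "W \<subseteq> A" for W
    using that Ao bounded_subset by (auto simp: bounded_opens_def)
  have bnd\<mu>: "emeasure \<mu> W \<le> ennreal C * emeasure lborel W" if "open W" "W \<subseteq> A" for W
    using growth_bounded[OF v sub[OF that] hg_mono[OF h that(2)], of R] R that(2) \<mu>(2)[OF sub[OF that]] by (auto simp: C_def)
  have bnd\<nu>: "emeasure \<nu> W \<le> ennreal C * emeasure lborel W" if "open W" "W \<subseteq> A" for W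
  proof -
    have "emeasure \<nu> W \<le> (\<integral>\<^sup>+x. ennreal C * indicator W x \<partial>lborel)"
      unfolding \<nu>[OF that(1)]
    proof (rule nn_integral_mono)
      fix x
      have "fr (h x) \<le> C" if "x \<in> W"
      proof -
        have "norm (h x) powr p \<le> R powr p" using R[of x] that \<open>W \<subseteq> A\<close> p by (intro powr_mono2) auto
        then have "b * norm (h x) powr p \<le> b * R powr p" using ab by simp
        then show ?thesis using fr_le[of "h x"] by (simp add: C_def)
      qed
      then show "ennreal (fr (h x)) * indicator W x \<le> ennreal C * indicator W x"
        by (auto split: split_indicator intro: ennreal_leI)
    qed
    also have "\<dots> = ennreal C * emeasure lborel W" using that by (simp add: nn_integral_cmult_indicator)
    finally show ?thesis .
  qed
  have loc: "\<exists>r>0. \<forall>s. 0 < s \<longrightarrow> s \<le> r \<longrightarrow> ball x s \<subseteq> A \<and>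
     emeasure \<mu> (ball x s) \<le> emeasure \<nu> (ball x s) + ennreal e * emeasure lborel (ball x s) \<and>
     emeasure \<nu> (ball x s) \<le> emeasure \<mu> (ball x s) + ennreal e * emeasure lborel (ball x s)"
    if x: "x \<in> A" and e: "e > 0" for x e
  proof -
    \<comment> \<open>Half of \<open>e\<close> pays for freezing the gradient, an error of
      \<epsilon> C1 per unit volume by \<open>F_close_gradients\<close>, and the other half for the
      oscillation of fr(h). The cap 1/2 keeps \<epsilon> below 1.\<close>
    define \<epsilon> where "\<epsilon> = min (1 / 2) (e / (2 * C1))"
    have \<epsilon>: "0 < \<epsilon>" "\<epsilon> < 1" "\<epsilon> * C1 \<le> e / 2" using e C1 by (auto simp: \<epsilon>_def field_simps min_def)
    obtain r0 where r0: "r0 > 0" "ball x r0 \<subseteq> A" using Ao(1) x open_contains_ball by blast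
    obtain r1 where r1: "r1 > 0" "\<And>z. dist z x < r1 \<Longrightarrow> dist (h z) (h x) < \<epsilon>"
      using hc \<epsilon>(1) unfolding continuous_on_iff by (metis UNIV_I)
    obtain r2 where r2: "r2 > 0" "\<And>z. dist z x < r2 \<Longrightarrow> dist (fr (h z)) (fr (h x)) < e / 2"
      using fhc e half_gt_zero[of e] unfolding continuous_on_iff by (metis UNIV_I)
    define r where "r = min r0 (min r1 r2)"
    have r: "r > 0" "r \<le> r0" "r \<le> r1" "r \<le> r2" using r0 r1 r2 by (auto simp: r_def)
    show ?thesis
    proof (intro exI[of _ r] conjI allI impI)
      show "r > 0" by fact
      fix s assume s: "0 < s" "s \<le> r"
      let ?W = "ball x s"
      show WA: "?W \<subseteq> A" using r0(2) s r by (meson order_trans subset_ball)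
      have W: "?W \<in> bounded_opens" by (rule ball_bounded_open)
      have [measurable]: "?W \<in> sets borel" by simp
      have hd: "norm (h z - h x) \<le> \<epsilon>" if "z \<in> ?W" for z
        using r1(2)[of z] that s r by (simp add: dist_norm dist_commute norm_minus_commute less_imp_le)
      have fd: "\<bar>fr (h z) - fr (h x)\<bar> \<le> e / 2" if "z \<in> ?W" for z
        using r2(2)[of z] that s r by (simp add: dist_real_def dist_commute less_imp_le)
      have hR: "norm (h z) \<le> R" if "z \<in> ?W" for z using R WA that by blast
      have hxR: "norm (h x) \<le> R" using R x by blast
      have hv: "hg ?W v h" by (rule hg_mono[OF h WA])
      have f: "F v ?W \<le> F (lin (h x)) ?W + ennreal (\<epsilon> * C1) * emeasure lborel ?W"
        unfolding C1_def using hd hxR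
        by (intro F_close_gradients[OF v Lqloc_lin[OF p0] W hv hg_lin _ \<epsilon>(1,2)]) auto
      have g: "F (lin (h x)) ?W \<le> F v ?W + ennreal (\<epsilon> * C1) * emeasure lborel ?W"
        unfolding C1_def using hd hR
        by (intro F_close_gradients[OF Lqloc_lin[OF p0] v W hg_lin hv _ \<epsilon>(1,2)]) (auto simp: norm_minus_commute)
      have l: "F (lin (h x)) ?W = ennreal (fr (h x)) * emeasure lborel ?W"
        using F_lin[OF W] by (simp add: dens_fr)
      have c: "ennreal (fr (h x)) * emeasure lborel ?W = (\<integral>\<^sup>+z. ennreal (fr (h x)) * indicator ?W z \<partial>lborel)"
        by (simp add: nn_integral_cmult_indicator)
      have e2: "(\<integral>\<^sup>+z. ennreal (e / 2) * indicator ?W z \<partial>lborel) = ennreal (e / 2) * emeasure lborel ?W"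
        by (simp add: nn_integral_cmult_indicator)
      have m1: "ennreal (fr (h x)) * emeasure lborel ?W \<le> emeasure \<nu> ?W + ennreal (e / 2) * emeasure lborel ?W"
      proof -
        have "(\<integral>\<^sup>+z. ennreal (fr (h x)) * indicator ?W z \<partial>lborel) \<le>
           (\<integral>\<^sup>+z. ennreal (fr (h z)) * indicator ?W z + ennreal (e / 2) * indicator ?W z \<partial>lborel)"
        proof (rule nn_integral_mono)
          fix z
          have "ennreal (fr (h x)) \<le> ennreal (fr (h z)) + ennreal (e / 2)" if "z \<in> ?W"
          proof -
            have "fr (h x) \<le> fr (h z) + e / 2" using fd[OF that] by linarith
            then have "ennreal (fr (h x)) \<le> ennreal (fr (h z) + e / 2)" by (rule ennreal_leI)
            also have "\<dots> = ennreal (fr (h z)) + ennreal (e / 2)" using fr_nonneg e by (intro ennreal_plus) auto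
            finally show ?thesis .
          qed
          then show "ennreal (fr (h x)) * indicator ?W z \<le> ennreal (fr (h z)) * indicator ?W z + ennreal (e / 2) * indicator ?W z"
            by (auto split: split_indicator)
        qed
        also have "\<dots> = emeasure \<nu> ?W + ennreal (e / 2) * emeasure lborel ?W"
          unfolding \<nu>[OF open_ball] e2[symmetric] by (rule nn_integral_add) measurable
        finally show ?thesis by (simp add: c)
      qed
      have m2: "emeasure \<nu> ?W \<le> ennreal (fr (h x)) * emeasure lborel ?W + ennreal (e / 2) * emeasure lborel ?W"
      proof -
        have "emeasure \<nu> ?W \<le> (\<integral>\<^sup>+z. ennreal (fr (h x)) * indicator ?W z + ennreal (e / 2) * indicator ?W z \<partial>lborel)"
          unfolding \<nu>[OF open_ball]
        proof (rule nn_integral_mono)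
          fix z
          have "ennreal (fr (h z)) \<le> ennreal (fr (h x)) + ennreal (e / 2)" if "z \<in> ?W"
          proof -
            have "fr (h z) \<le> fr (h x) + e / 2" using fd[OF that] by linarith
            then have "ennreal (fr (h z)) \<le> ennreal (fr (h x) + e / 2)" by (rule ennreal_leI)
            also have "\<dots> = ennreal (fr (h x)) + ennreal (e / 2)" using fr_nonneg e by (intro ennreal_plus) auto
            finally show ?thesis .
          qed
          then show "ennreal (fr (h z)) * indicator ?W z \<le> ennreal (fr (h x)) * indicator ?W z + ennreal (e / 2) * indicator ?W z"
            by (auto split: split_indicator)
        qed
        also have "\<dots> = ennreal (fr (h x)) * emeasure lborel ?W + ennreal (e / 2) * emeasure lborel ?W"
          unfolding c e2[symmetric] by (rule nn_integral_add) measurable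
        finally show ?thesis .
      qed
      have E: "ennreal (\<epsilon> * C1) * emeasure lborel ?W \<le> ennreal (e / 2) * emeasure lborel ?W"
        using \<epsilon>(3) by (intro mult_right_mono ennreal_leI) auto
      have ee: "ennreal (e / 2) * emeasure lborel ?W + ennreal (e / 2) * emeasure lborel ?W = ennreal e * emeasure lborel ?W"
        using e by (simp add: distrib_right[symmetric] ennreal_plus[symmetric] del: ennreal_plus)
      have "F v ?W \<le> ennreal (fr (h x)) * emeasure lborel ?W + ennreal (e / 2) * emeasure lborel ?W"
        using f E unfolding l by (meson add_left_mono order_trans)
      also have "\<dots> \<le> (emeasure \<nu> ?W + ennreal (e / 2) * emeasure lborel ?W) + ennreal (e / 2) * emeasure lborel ?W"
        by (intro add_right_mono m1)
      finally show "emeasure \<mu> ?W \<le> emeasure \<nu> ?W + ennreal e * emeasure lborel ?W"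
        using \<mu>(2)[OF W] ee by (simp add: add.assoc)
      have "emeasure \<nu> ?W \<le> (F v ?W + ennreal (e / 2) * emeasure lborel ?W) + ennreal (e / 2) * emeasure lborel ?W"
        using m2 g E unfolding l by (meson add_left_mono add_right_mono order_trans)
      then show "emeasure \<nu> ?W \<le> emeasure \<mu> ?W + ennreal e * emeasure lborel ?W"
        using \<mu>(2)[OF W] ee by (simp add: add.assoc)
    qed
  qed
  have "emeasure \<mu> A \<le> emeasure \<nu> A"
  proof (rule local_comparison[OF \<mu>(1) \<nu>s Ao])
    show "emeasure \<mu> W \<le> ennreal C * emeasure lborel W" if "open W" "W \<subseteq> A" for W
      by (rule bnd\<mu>[OF that])
    fix x and e :: real assume xe: "x \<in> A" "e > 0"
    obtain r where "r > 0" and r: "\<forall>s. 0 < s \<longrightarrow> s \<le> r \<longrightarrow> ball x s \<subseteq> A \<and>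
     emeasure \<mu> (ball x s) \<le> emeasure \<nu> (ball x s) + ennreal e * emeasure lborel (ball x s) \<and>
     emeasure \<nu> (ball x s) \<le> emeasure \<mu> (ball x s) + ennreal e * emeasure lborel (ball x s)"
      using loc[OF xe] by (elim exE conjE) (rule that)
    then show "\<exists>r>0. \<forall>s. 0 < s \<longrightarrow> s \<le> r \<longrightarrow> ball x s \<subseteq> A \<and>
        emeasure \<mu> (ball x s) \<le> emeasure \<nu> (ball x s) + ennreal e * emeasure lborel (ball x s)"
      by (intro exI[of _ r]) simp
  qed
  moreover have "emeasure \<nu> A \<le> emeasure \<mu> A"
  proof (rule local_comparison[OF \<nu>s \<mu>(1) Ao])
    show "emeasure \<nu> W \<le> ennreal C * emeasure lborel W" if "open W" "W \<subseteq> A" for W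
      by (rule bnd\<nu>[OF that])
    fix x and e :: real assume xe: "x \<in> A" "e > 0"
    obtain r where "r > 0" and r: "\<forall>s. 0 < s \<longrightarrow> s \<le> r \<longrightarrow> ball x s \<subseteq> A \<and>
     emeasure \<mu> (ball x s) \<le> emeasure \<nu> (ball x s) + ennreal e * emeasure lborel (ball x s) \<and>
     emeasure \<nu> (ball x s) \<le> emeasure \<mu> (ball x s) + ennreal e * emeasure lborel (ball x s)"
      using loc[OF xe] by (elim exE conjE) (rule that)
    then show "\<exists>r>0. \<forall>s. 0 < s \<longrightarrow> s \<le> r \<longrightarrow> ball x s \<subseteq> A \<and>
        emeasure \<nu> (ball x s) \<le> emeasure \<mu> (ball x s) + ennreal e * emeasure lborel (ball x s)"
      by (intro exI[of _ r]) simp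
  qed
  ultimately show ?thesis using \<mu>(2)[OF A] \<nu>[OF Ao(1)] by simp
qed

section \<open>The functional under regularisation\<close>

lemma lsc_sequence:
  assumes u: "Lqloc p u" and un: "\<And>n. Lqloc p (un n)" and A: "A \<in> bounded_opens"
    and lim: "\<And>K. compact K \<Longrightarrow> (\<lambda>n. Lint p K (\<lambda>x. un n x - u x)) \<longlonglongrightarrow> 0" and bnd: "\<And>n. F (un n) A \<le> T"
  shows "F u A \<le> T"
proof (rule ccontr)
  assume "\<not> F u A \<le> T"
  then have "u \<in> {u \<in> Lp_loc p UNIV. T < F u A}" using Lqloc_imp_Lp_loc[OF u] by simp
  moreover have "openin (Lp_loc_topology p) {u \<in> Lp_loc p UNIV. T < F u A}"
    using lsc A by (simp add: lsc_functional_def)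
  ultimately have "eventually (\<lambda>n. un n \<in> {u \<in> Lp_loc p UNIV. T < F u A}) sequentially"
    using eventually_in_Lp_loc_open[OF _ p u un lim] by blast
  then obtain n where "T < F (un n) A" by (auto simp: eventually_sequentially)
  then show False using bnd[of n] by simp
qed

lemma F_convex_sum:
  fixes n :: nat and u :: "nat \<Rightarrow> real^'n \<Rightarrow> real"
  assumes A: "A \<in> bounded_opens"
  shows "(\<And>i. i < n \<Longrightarrow> Lqloc p (u i)) \<Longrightarrow> (\<And>i. i < n \<Longrightarrow> F (u i) A \<le> T) \<Longrightarrow> (\<And>i. i < n \<Longrightarrow> 0 \<le> c i) \<Longrightarrow> (\<Sum>i<n. c i) = 1 \<Longrightarrow>
    Lqloc p (\<lambda>x. \<Sum>i<n. c i * u i x) \<and> F (\<lambda>x. \<Sum>i<n. c i * u i x) A \<le> T"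
proof (induction n arbitrary: c)
  case (Suc n)
  show ?case
  proof (cases "c n = 1")
    \<comment> \<open>Separated because the induction hypothesis is applied to the first weights
      divided by \<open>1 - c n\<close>.\<close>
    case True
    then have "(\<Sum>i<n. c i) = 0" using Suc.prems(4) by simp
    then have "\<forall>i\<in>{..<n}. c i = 0" using Suc.prems(3) by (subst (asm) sum_nonneg_eq_0_iff) auto
    then have "(\<lambda>x. \<Sum>i<Suc n. c i * u i x) = u n" using True by simp
    then show ?thesis using Suc.prems(1,2)[of n] by simp
  next
    case False
    have s: "(\<Sum>i<n. c i) = 1 - c n" using Suc.prems(4) by simp
    moreover have "0 \<le> (\<Sum>i<n. c i)" using Suc.prems(3) by (intro sum_nonneg) auto
    ultimately have cn: "0 \<le> c n" "c n < 1" using Suc.prems(3)[of n] False by auto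
    have IH: "Lqloc p (\<lambda>x. \<Sum>i<n. c i / (1 - c n) * u i x) \<and> F (\<lambda>x. \<Sum>i<n. c i / (1 - c n) * u i x) A \<le> T"
      by (rule Suc.IH) (use Suc.prems cn s in \<open>auto simp: sum_divide_distrib[symmetric]\<close>)
    have eq: "(\<lambda>x. \<Sum>i<Suc n. c i * u i x) = (\<lambda>x. (1 - c n) * (\<Sum>i<n. c i / (1 - c n) * u i x) + c n * u n x)"
      using cn by (simp add: sum_distrib_left)
    have "F (\<lambda>x. \<Sum>i<Suc n. c i * u i x) A \<le> ennreal (1 - c n) * F (\<lambda>x. \<Sum>i<n. c i / (1 - c n) * u i x) A + ennreal (c n) * F (u n) A"
      unfolding eq using IH Suc.prems(1)[of n] cn A by (intro F_convex) auto
    also have "\<dots> \<le> ennreal (1 - c n) * T + ennreal (c n) * T"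
      using IH Suc.prems(2)[of n] by (intro add_mono mult_left_mono) auto
    also have "\<dots> = T" using cn by (simp add: distrib_right[symmetric] ennreal_plus[symmetric] del: ennreal_plus)
    finally have "F (\<lambda>x. \<Sum>i<Suc n. c i * u i x) A \<le> T" .
    moreover have "Lqloc p (\<lambda>x. \<Sum>i<Suc n. c i * u i x)"
      unfolding eq using IH Suc.prems(1)[of n] by (intro Lqloc_comb) auto
    ultimately show ?thesis by blast
  qed
qed simp

lemma F_conv_le:
  assumes u: "Lqloc p u" and \<rho>: "mollifier \<delta> \<rho>" and A: "A \<in> bounded_opens" and A': "A' \<in> bounded_opens"
    and sub: "tset (cball 0 \<delta>) A' \<subseteq> A"
  shows "F (conv \<rho> u) A' \<le> F u A"
proof -
  \<comment> \<open>A translate of \<open>u\<close> seen on \<open>A'\<close> is \<open>u\<close>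
    seen on y^-1 A', which is contained in \<open>A\<close>: this is where part of the domain is
    lost.\<close>
  have tr: "F (\<lambda>x. u (mul (- y) x)) A' \<le> F u A" if y: "norm y \<le> \<delta>" for y
  proof -
    have sub': "mul (- y) ` A' \<subseteq> A" using sub y by (auto intro!: subsetD[OF sub] tsetI)
    have B: "mul (- y) ` A' \<in> bounded_opens" using A' by (simp add: bounded_opens_def open_mul_image bounded_mul_image)
    have L: "u \<in> Lp_loc p UNIV" by (rule Lqloc_imp_Lp_loc[OF u])
    have "mul y ` mul (- y) ` A' = A'" by (simp add: image_image)
    then have "F (\<lambda>x. u (mul (- y) x)) A' = F u (mul (- y) ` A')"
      using left_inv L B unfolding left_invariant_functional_def minv_eq by metis
    also have "\<dots> \<le> F u A" using incr L B A sub' unfolding increasing_functional_def by blast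
    finally show ?thesis .
  qed
  \<comment> \<open>The n-th Riemann sum is accurate up to 1/(n+1) on the ball of radius n, as
    \<open>Lint_exhaust_tendsto\<close> requires.\<close>
  have "\<exists>w. Lqloc p w \<and> F w A' \<le> F u A \<and> Lint p (cball 0 (real n)) (\<lambda>x. w x - conv \<rho> u x) \<le> ennreal (1 / real (Suc n))" for n
  proof -
    have e0: "0 < ennreal (1 / real (Suc n))" by simp
    have "\<exists>(N::nat) ys c. (\<forall>i<N. norm (ys i) \<le> \<delta>) \<and> (\<forall>i<N. 0 \<le> c i) \<and> (\<Sum>i<N. c i) = 1 \<and>
      Lint p (cball 0 (real n)) (\<lambda>x. conv \<rho> u x - (\<Sum>i<N. c i *\<^sub>R u (mul (- ys i) x))) \<le> ennreal (1 / real (Suc n))"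
    proof (rule riemann_sums[OF u compact_cball p e0 \<rho>])
      fix N :: nat and ys :: "nat \<Rightarrow> real^'n" and c :: "nat \<Rightarrow> real"
      assume *: "\<And>i. i < N \<Longrightarrow> norm (ys i) \<le> \<delta>" "\<And>i. i < N \<Longrightarrow> 0 \<le> c i" "(\<Sum>i<N. c i) = 1"
        "Lint p (cball 0 (real n)) (\<lambda>x. conv \<rho> u x - (\<Sum>i<N. c i *\<^sub>R u (mul (- ys i) x))) \<le> ennreal (1 / real (Suc n))"
      show ?thesis by (intro exI[of _ N] exI[of _ ys] exI[of _ c] conjI allI impI *)
    qed
    then obtain N :: nat and ys c where N: "\<forall>i<N. norm (ys i) \<le> \<delta>" "\<forall>i<N. 0 \<le> c i" "(\<Sum>i<N. c i) = 1"
      "Lint p (cball 0 (real n)) (\<lambda>x. conv \<rho> u x - (\<Sum>i<N. c i *\<^sub>R u (mul (- ys i) x))) \<le> ennreal (1 / real (Suc n))"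
      by auto
    have "Lqloc p (\<lambda>x. \<Sum>i<N. c i * u (mul (- ys i) x)) \<and> F (\<lambda>x. \<Sum>i<N. c i * u (mul (- ys i) x)) A' \<le> F u A"
      by (rule F_convex_sum[OF A']) (use N tr Lqloc_translate[OF u] in auto)
    moreover have "Lint p (cball 0 (real n)) (\<lambda>x. (\<Sum>i<N. c i * u (mul (- ys i) x)) - conv \<rho> u x) \<le> ennreal (1 / real (Suc n))"
      using N(4) by (simp add: Lint_def norm_minus_commute abs_minus_commute)
    ultimately show ?thesis by blast
  qed
  then obtain w where w: "\<And>n. Lqloc p (w n)" "\<And>n. F (w n) A' \<le> F u A"
    "\<And>n. Lint p (cball 0 (real n)) (\<lambda>x. w n x - conv \<rho> u x) \<le> ennreal (1 / real (Suc n))" by metis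
  show ?thesis
  proof (rule lsc_sequence[OF Lqloc_conv[OF u \<rho> p] w(1) A' _ w(2)])
    fix K :: "(real^'n) set" assume "compact K"
    then show "(\<lambda>n. Lint p K (\<lambda>x. w n x - conv \<rho> u x)) \<longlonglongrightarrow> 0"
      using w(3) p0 by (intro Lint_exhaust_tendsto) auto
  qed
qed

end

section \<open>The integral representation\<close>

lemma Lint_1_vec_finite:
  fixes g :: "'a::euclidean_space \<Rightarrow> real^'m"
  assumes g: "\<And>j. Lloc1 \<Omega> (\<lambda>x. g x $ j)"
  shows "g \<in> borel_measurable borel" "compact K \<Longrightarrow> K \<subseteq> \<Omega> \<Longrightarrow> Lint 1 K g < \<infinity>"
proof -
  have m[measurable]: "(\<lambda>x. g x $ j) \<in> borel_measurable borel" for j using g by (simp add: Lloc1_def)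
  then show "g \<in> borel_measurable borel"
    by (subst borel_measurable_euclidean_space) (auto simp: Basis_vec_def inner_axis)
  assume K: "compact K" "K \<subseteq> \<Omega>"
  then have Kb[measurable]: "K \<in> sets borel" by (simp add: borel_closed compact_imp_closed)
  have "Lint 1 K g \<le> (\<integral>\<^sup>+x. (\<Sum>j\<in>UNIV. ennreal (norm (g x $ j) powr 1) * indicator K x) \<partial>lborel)"
    unfolding Lint_def
  proof (rule nn_integral_mono)
    fix x
    have "ennreal (norm (g x)) \<le> ennreal (\<Sum>j\<in>UNIV. \<bar>g x $ j\<bar>)" by (intro ennreal_leI norm_le_l1_cart)
    also have "\<dots> = (\<Sum>j\<in>UNIV. ennreal \<bar>g x $ j\<bar>)" by (rule sum_ennreal[symmetric]) simp
    finally show "ennreal (norm (g x) powr 1) * indicator K x \<le> (\<Sum>j\<in>UNIV. ennreal (norm (g x $ j) powr 1) * indicator K x)"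
      by (auto split: split_indicator)
  qed
  also have "\<dots> = (\<Sum>j\<in>UNIV. Lint 1 K (\<lambda>x. g x $ j))"
    unfolding Lint_def by (rule nn_integral_sum) measurable
  also have "\<dots> < \<infinity>" using g K by (simp add: Lloc1_def)
  finally show "Lint 1 K g < \<infinity>" .
qed

lemma wd_cong:
  assumes w: "wd Y \<Omega> u g" and g': "g' \<in> borel_measurable borel" "\<And>x. x \<in> \<Omega> \<Longrightarrow> g' x = g x"
  shows "wd Y \<Omega> u g'"
proof -
  have "Lint 1 K g' = Lint 1 K g" if "K \<subseteq> \<Omega>" for K
    unfolding Lint_def using that g'(2) by (intro nn_integral_cong) (auto split: split_indicator)
  then have "Lloc1 \<Omega> g'" using w g'(1) by (simp add: wd_def Lloc1_def)
  moreover have "(\<integral>x. g' x * \<phi> x \<partial>lborel) = (\<integral>x. g x * \<phi> x \<partial>lborel)" if "\<phi> \<in> test_functions \<Omega>" for \<phi>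
  proof (rule Bochner_Integration.integral_cong[OF refl])
    fix x show "g' x * \<phi> x = g x * \<phi> x"
      using g'(2)[of x] test_function_outside(3,4)[OF that] by (cases "x \<in> \<Omega>") auto
  qed
  ultimately show ?thesis using w by (simp add: wd_def)
qed

text \<open>The map (y, x) \<mapsto> y^-1 x is uniformly continuous on a compact set and equals
  \<open>x\<close> at y = 0, so small \<open>y\<close> move no point of \<open>K\<close> out of a
  fixed neighbourhood of \<open>K\<close> inside \<open>A\<close>.\<close>

lemma (in carnot_group) ex_small_translations:
  assumes K: "compact K" and A: "open A" "K \<subseteq> A"
  obtains \<delta> where "\<delta> > 0" "tset (cball 0 \<delta>) K \<subseteq> A"
proof -
  obtain e where e: "e > 0" "(\<Union>x\<in>K. ball x e) \<subseteq> A"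
    using compact_subset_open_imp_ball_epsilon_subset[OF K A] by blast
  have "uniformly_continuous_on (cball 0 1 \<times> K) (\<lambda>z. mul (- fst z) (snd z))"
    by (intro compact_uniformly_continuous compact_Times K compact_cball continuous_intros)
  then obtain d where d: "d > 0" "\<And>z z'. z \<in> cball 0 1 \<times> K \<Longrightarrow> z' \<in> cball 0 1 \<times> K \<Longrightarrow> dist z' z < d \<Longrightarrow>
      dist (mul (- fst z') (snd z')) (mul (- fst z) (snd z)) < e"
    using e(1) unfolding uniformly_continuous_on_def by metis
  define \<delta> where "\<delta> = min 1 (d / 2)"
  have \<delta>: "\<delta> > 0" "\<delta> \<le> 1" "\<delta> < d" using d(1) by (auto simp: \<delta>_def)
  have "tset (cball 0 \<delta>) K \<subseteq> A"
  proof
    fix z assume "z \<in> tset (cball 0 \<delta>) K"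
    then obtain y x where z: "z = mul (- y) x" "norm y \<le> \<delta>" "x \<in> K" by (auto simp: tset_def)
    then have "dist (mul (- y) x) x < e"
      using d(2)[of "(0, x)" "(y, x)"] \<delta> by (simp add: dist_Pair_Pair dist_norm)
    then have "z \<in> ball x e" by (simp add: z(1) dist_commute)
    then show "z \<in> A" using e(2) z(3) by blast
  qed
  then show ?thesis using \<delta>(1) that by blast
qed

context invariant_functional
begin

section \<open>Functions with a locally integrable gradient\<close>

text \<open>The gradient is integrable only locally in \<open>A\<close>, so its convolution need not
  exist. It is cut off to a relatively compact set \<open>A2\<close> that contains every point met
  when regularising on \<open>A'\<close>; there the convolution of the truncated gradient is still
  the gradient of the regularised function.\<close>

lemma core:
  assumes u: "Lqloc p u" and A: "A \<in> bounded_opens" and g: "hg A u g"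
    and A': "open A'" "compact (closure A')" "closure A' \<subseteq> A"
  shows "(\<integral>\<^sup>+x\<in>A'. ennreal (fr (g x)) \<partial>lborel) \<le> F u A" "F u A' \<le> (\<integral>\<^sup>+x\<in>A. ennreal (fr (g x)) \<partial>lborel)"
proof -
  have Ao: "open A" "bounded A" using A by (auto simp: bounded_opens_def)
  define K1 where "K1 = closure A'"
  have K1: "compact K1" "K1 \<subseteq> A" "A' \<subseteq> K1" using A' closure_subset by (auto simp: K1_def)
  have A'b: "A' \<in> bounded_opens" using A'(1) bounded_subset[OF compact_imp_bounded[OF K1(1)] K1(3)] by (simp add: bounded_opens_def)
  obtain \<delta>0 where \<delta>0: "\<delta>0 > 0" "tset (cball 0 \<delta>0) K1 \<subseteq> A"
    using ex_small_translations[OF K1(1) Ao(1) K1(2)] by blast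
  have tsub: "tset (cball 0 \<delta>) A' \<subseteq> tset (cball 0 \<delta>0) K1" if "\<delta> \<le> \<delta>0" for \<delta>
    using that K1(3) unfolding tset_def by (intro image_mono) auto
  obtain e where e: "e > 0" "(\<Union>x\<in>tset (cball 0 \<delta>0) K1. ball x e) \<subseteq> A"
    using compact_subset_open_imp_ball_epsilon_subset[OF compact_tset[OF compact_cball K1(1)] Ao(1) \<delta>0(2)] by blast
  \<comment> \<open>Half of the admissible radius keeps the closure inside \<open>A\<close> as
    well.\<close>
  define A2 where "A2 = (\<Union>x\<in>tset (cball 0 \<delta>0) K1. ball x (e / 2))"
  have "A2 \<subseteq> (\<Union>x\<in>tset (cball 0 \<delta>0) K1. ball x e)"
    unfolding A2_def using e(1) by (intro UN_mono subset_ball) auto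
  then have A2: "open A2" "tset (cball 0 \<delta>0) K1 \<subseteq> A2" "A2 \<subseteq> A"
    using e by (auto simp: A2_def)
  have cA2: "closure A2 \<subseteq> A"
  proof
    fix z assume "z \<in> closure A2"
    then obtain w where w: "w \<in> A2" "dist w z < e / 2" using e(1) by (meson closure_approachable half_gt_zero)
    then obtain x where x: "x \<in> tset (cball 0 \<delta>0) K1" "dist x w < e / 2" by (auto simp: A2_def)
    have "dist x z < e" using dist_triangle[of x z w] x w by simp
    then have "z \<in> ball x e" by simp
    then show "z \<in> A" using e(2) x(1) by blast
  qed
  have K2: "compact (closure A2)" using bounded_subset[OF Ao(2) A2(3)] by (simp add: compact_closure)
  have gl: "Lloc1 A (\<lambda>x. g x $ j)" for j using g by (simp add: hg_def wd_def)
  have gm[measurable]: "g \<in> borel_measurable borel" by (rule Lint_1_vec_finite(1)[OF gl])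
  have A2b[measurable]: "A2 \<in> sets borel" "A' \<in> sets borel" "A \<in> sets borel" using A2 A' Ao by auto
  \<comment> \<open>Globally integrable, and equal to \<open>g\<close> wherever a convolution
    evaluated on \<open>A'\<close> looks.\<close>
  define g' where "g' = (\<lambda>x. indicator A2 x *\<^sub>R g x)"
  have g'm[measurable]: "g' \<in> borel_measurable borel" unfolding g'_def by measurable
  have g': "Lqloc 1 g'"
    unfolding Lqloc_def
  proof (intro conjI allI impI g'm)
    fix K :: "(real^'n) set" assume "compact K"
    have "Lint 1 K g' \<le> Lint 1 (closure A2) g"
      unfolding Lint_def g'_def using closure_subset[of A2] by (intro nn_integral_mono) (auto split: split_indicator)
    also have "\<dots> < \<infinity>" by (rule Lint_1_vec_finite(2)[OF gl K2 cA2])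
    finally show "Lint 1 K g' < \<infinity>" .
  qed
  have g'j: "(\<lambda>x. g' x $ j) \<in> borel_measurable borel" for j
    by (rule measurable_compose[OF g'm borel_measurable_continuous_onI]) (intro continuous_intros)
  have Lj: "Lqloc 1 (\<lambda>x. g' x $ j)" for j
    unfolding Lqloc_def
  proof (intro conjI allI impI)
    show "(\<lambda>x. g' x $ j) \<in> borel_measurable borel" by (rule g'j)
    fix K :: "(real^'n) set" assume "compact K"
    then have "Lint 1 K g' < \<infinity>" using g' by (simp add: Lqloc_def)
    moreover have "Lint 1 K (\<lambda>x. g' x $ j) \<le> Lint 1 K g'"
      by (rule Lint_mono) (auto simp: component_le_norm_cart)
    ultimately show "Lint 1 K (\<lambda>x. g' x $ j) < \<infinity>" by simp
  qed
  have wA2: "wd (left_inv_field mul (X j)) A2 u (\<lambda>x. g' x $ j)" for j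
  proof (rule wd_cong)
    show "wd (left_inv_field mul (X j)) A2 u (\<lambda>x. g x $ j)" using g A2(3) by (auto simp: hg_def intro: wd_mono)
    show "(\<lambda>x. g' x $ j) \<in> borel_measurable borel" by (rule g'j)
  qed (simp add: g'_def)
  have u1: "Lqloc 1 u" by (rule Lqloc_1[OF u p])
  have hgc: "hg A' (conv \<rho> u) (conv \<rho> g')" if \<rho>: "mollifier \<delta> \<rho>" and \<delta>: "\<delta> \<le> \<delta>0" for \<rho> \<delta>
    unfolding hg_def
  proof
    fix j
    have "(\<lambda>x. conv \<rho> g' x $ j) = conv \<rho> (\<lambda>x. g' x $ j)" using conv_vec_nth[OF g' \<rho>] by blast
    moreover have "wd (left_inv_field mul (X j)) A' (conv \<rho> u) (conv \<rho> (\<lambda>x. g' x $ j))"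
      by (rule wd_conv[OF wA2 u1 Lj \<rho> order_trans[OF tsub[OF \<delta>] A2(2)]])
    ultimately show "wd (left_inv_field mul (X j)) A' (conv \<rho> u) (\<lambda>x. conv \<rho> g' x $ j)" by simp
  qed
  have Feq: "F (conv \<rho> u) A' = (\<integral>\<^sup>+x\<in>A'. ennreal (fr (conv \<rho> g' x)) \<partial>lborel)" if \<rho>: "mollifier \<delta> \<rho>" and \<delta>: "\<delta> \<le> \<delta>0" for \<rho> \<delta>
  proof -
    have c: "continuous_on UNIV (conv \<rho> g')" by (rule conv_continuous[OF g' \<rho>])
    have "bounded (conv \<rho> g' ` K1)"
      by (intro compact_imp_bounded compact_continuous_image continuous_on_subset[OF c] K1 subset_UNIV)
    then obtain R where "\<And>x. x \<in> K1 \<Longrightarrow> norm (conv \<rho> g' x) \<le> R" by (auto simp: bounded_iff)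
    then show ?thesis using K1(3)
      by (intro representation_continuous[OF Lqloc_conv[OF u \<rho> p] A'b hgc[OF \<rho> \<delta>] c]) auto
  qed
  have F1: "F (conv \<rho> u) A' \<le> F u A" if \<rho>: "mollifier \<delta> \<rho>" and \<delta>: "\<delta> \<le> \<delta>0" for \<rho> \<delta>
    by (rule F_conv_le[OF u \<rho> A A'b order_trans[OF tsub[OF \<delta>] \<delta>0(2)]])
  have F2: "F (conv \<rho> u) A' \<le> (\<integral>\<^sup>+x\<in>A. ennreal (fr (g x)) \<partial>lborel)" if \<rho>: "mollifier \<delta> \<rho>" and \<delta>: "\<delta> \<le> \<delta>0" for \<rho> \<delta>
  proof -
    have "F (conv \<rho> u) A' \<le> (\<integral>\<^sup>+x\<in>A2. ennreal (fr (g' x)) \<partial>lborel)"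
      unfolding Feq[OF \<rho> \<delta>]
      by (rule nn_integral_conv_convex_le[OF fr_convex fr_nonneg g' \<rho> A2b(1,2) order_trans[OF tsub[OF \<delta>] A2(2)]])
    also have "\<dots> \<le> (\<integral>\<^sup>+x\<in>A. ennreal (fr (g x)) \<partial>lborel)"
      using A2(3) by (intro nn_integral_mono) (auto simp: g'_def split: split_indicator)
    finally show ?thesis .
  qed
  \<comment> \<open>The exponents differ on purpose: semicontinuity needs \<open>u\<close>
    approximated in p-norm on ever larger balls, while the gradient is only known to be integrable
    to the first power, and only near \<open>A'\<close>.\<close>
  have ex: "\<exists>\<rho>. (\<exists>\<delta>\<le>\<delta>0. mollifier \<delta> \<rho>) \<and> Lint p (cball 0 (real n)) (\<lambda>x. conv \<rho> u x - u x) \<le> ennreal (1 / real (Suc n)) \<and>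
      Lint 1 K1 (\<lambda>x. conv \<rho> g' x - g' x) \<le> ennreal (1 / real (Suc n))" for n
  proof -
    have e0: "0 < ennreal (1 / real (Suc n))" by simp
    obtain d1 where d1: "d1 > 0" "\<And>\<delta> \<rho>. \<delta> \<le> d1 \<Longrightarrow> mollifier \<delta> \<rho> \<Longrightarrow> Lint p (cball 0 (real n)) (\<lambda>x. conv \<rho> u x - u x) \<le> ennreal (1 / real (Suc n))"
      using conv_tendsto[OF u compact_cball p e0] by blast
    obtain d2 where d2: "d2 > 0" "\<And>\<delta> \<rho>. \<delta> \<le> d2 \<Longrightarrow> mollifier \<delta> \<rho> \<Longrightarrow> Lint 1 K1 (\<lambda>x. conv \<rho> g' x - g' x) \<le> ennreal (1 / real (Suc n))"
      using conv_tendsto[OF g' K1(1) order_refl e0] by blast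
    define \<delta> where "\<delta> = min \<delta>0 (min d1 d2)"
    have \<delta>: "\<delta> > 0" "\<delta> \<le> \<delta>0" "\<delta> \<le> d1" "\<delta> \<le> d2" using \<delta>0 d1 d2 by (auto simp: \<delta>_def)
    obtain \<rho> where "mollifier \<delta> \<rho>" using ex_mollifier[OF \<delta>(1)] by blast
    then show ?thesis using d1(2)[OF \<delta>(3)] d2(2)[OF \<delta>(4)] \<delta>(2) by blast
  qed
  have "\<exists>\<rho>. \<forall>n. (\<exists>\<delta>\<le>\<delta>0. mollifier \<delta> (\<rho> n)) \<and> Lint p (cball 0 (real n)) (\<lambda>x. conv (\<rho> n) u x - u x) \<le> ennreal (1 / real (Suc n)) \<and>
      Lint 1 K1 (\<lambda>x. conv (\<rho> n) g' x - g' x) \<le> ennreal (1 / real (Suc n))"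
    by (rule choice) (rule allI, rule ex)
  then obtain \<rho> where "\<forall>n. (\<exists>\<delta>\<le>\<delta>0. mollifier \<delta> (\<rho> n)) \<and> Lint p (cball 0 (real n)) (\<lambda>x. conv (\<rho> n) u x - u x) \<le> ennreal (1 / real (Suc n)) \<and>
      Lint 1 K1 (\<lambda>x. conv (\<rho> n) g' x - g' x) \<le> ennreal (1 / real (Suc n))" ..
  then have \<rho>: "\<exists>\<delta>\<le>\<delta>0. mollifier \<delta> (\<rho> n)"
    "Lint p (cball 0 (real n)) (\<lambda>x. conv (\<rho> n) u x - u x) \<le> ennreal (1 / real (Suc n))"
    "Lint 1 K1 (\<lambda>x. conv (\<rho> n) g' x - g' x) \<le> ennreal (1 / real (Suc n))" for n
    by blast+
  show "F u A' \<le> (\<integral>\<^sup>+x\<in>A. ennreal (fr (g x)) \<partial>lborel)"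
  proof (rule lsc_sequence[OF u _ A'b])
    show "Lqloc p (conv (\<rho> n) u)" for n using \<rho>(1)[of n] Lqloc_conv[OF u _ p] by blast
    show "F (conv (\<rho> n) u) A' \<le> (\<integral>\<^sup>+x\<in>A. ennreal (fr (g x)) \<partial>lborel)" for n using \<rho>(1)[of n] F2 by blast
    show "(\<lambda>n. Lint p K (\<lambda>x. conv (\<rho> n) u x - u x)) \<longlonglongrightarrow> 0" if "compact K" for K
      by (rule Lint_exhaust_tendsto[OF that p0 \<rho>(2)])
  qed
  define D where "D = (\<lambda>n x. indicator A' x *\<^sub>R (conv (\<rho> n) g' x - g' x))"
  have cm[measurable]: "conv (\<rho> n) g' \<in> borel_measurable borel" for n
  proof -
    obtain \<delta> where "mollifier \<delta> (\<rho> n)" using \<rho>(1) by blast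
    then show ?thesis by (intro conv_measurable g'm mollifierD(4))
  qed
  have Dn: "(\<integral>\<^sup>+x. ennreal (norm (D n x)) \<partial>lborel) \<le> ennreal (1 / real (Suc n))" for n
  proof -
    have "(\<integral>\<^sup>+x. ennreal (norm (D n x)) \<partial>lborel) \<le> Lint 1 K1 (\<lambda>x. conv (\<rho> n) g' x - g' x)"
      unfolding Lint_def D_def using K1(3) by (intro nn_integral_mono) (auto split: split_indicator)
    then show ?thesis using \<rho>(3)[of n] by simp
  qed
  have Di: "integrable lborel (D n)" for n
  proof (rule integrableI_bounded)
    show "D n \<in> borel_measurable lborel" unfolding D_def by measurable
    show "(\<integral>\<^sup>+x. ennreal (norm (D n x)) \<partial>lborel) < \<infinity>" by (rule order_le_less_trans[OF Dn]) simp
  qed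
  have "(\<lambda>n. \<integral>x. norm (D n x) \<partial>lborel) \<longlonglongrightarrow> 0"
  proof (rule tendsto_sandwich[OF _ _ tendsto_const])
    have "(\<integral>x. norm (D n x) \<partial>lborel) \<le> inverse (real (Suc n))" for n
    proof -
      have "ennreal (\<integral>x. norm (D n x) \<partial>lborel) = (\<integral>\<^sup>+x. ennreal (norm (D n x)) \<partial>lborel)"
        using Di[of n] by (intro nn_integral_eq_integral[symmetric]) auto
      then have "ennreal (\<integral>x. norm (D n x) \<partial>lborel) \<le> ennreal (inverse (real (Suc n)))"
        using Dn[of n] by (simp add: inverse_eq_divide)
      then show ?thesis by (subst (asm) ennreal_le_iff) auto
    qed
    then show "eventually (\<lambda>n. (\<integral>x. norm (D n x) \<partial>lborel) \<le> inverse (real (Suc n))) sequentially" by simp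
    show "(\<lambda>n. inverse (real (Suc n))) \<longlonglongrightarrow> 0" by (rule LIMSEQ_inverse_real_of_nat)
  qed simp
  \<comment> \<open>A subsequence converging almost everywhere; with continuity of \<open>fr\<close>
    this is what Fatou's lemma needs.\<close>
  then obtain r :: "nat \<Rightarrow> nat" where r: "AE x in lborel. (\<lambda>n. D (r n) x) \<longlonglongrightarrow> 0"
    using tendsto_L1_AE_subseq[of lborel D] Di by blast
  have [measurable]: "fr \<in> borel_measurable borel" by (intro borel_measurable_continuous_onI fr_continuous)
  have "(\<integral>\<^sup>+x\<in>A'. ennreal (fr (g x)) \<partial>lborel) \<le> (\<integral>\<^sup>+x. liminf (\<lambda>n. ennreal (fr (conv (\<rho> (r n)) g' x)) * indicator A' x) \<partial>lborel)"
  proof (rule nn_integral_mono_AE)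
    show "AE x in lborel. ennreal (fr (g x)) * indicator A' x \<le> liminf (\<lambda>n. ennreal (fr (conv (\<rho> (r n)) g' x)) * indicator A' x)"
      using r
    proof eventually_elim
      fix x assume x: "(\<lambda>n. D (r n) x) \<longlonglongrightarrow> 0"
      show "ennreal (fr (g x)) * indicator A' x \<le> liminf (\<lambda>n. ennreal (fr (conv (\<rho> (r n)) g' x)) * indicator A' x)"
      proof (cases "x \<in> A'")
        case True
        have "x \<in> A2"
        proof -
          have "mul (- 0) x \<in> tset (cball 0 \<delta>0) K1" using True K1(3) \<delta>0(1) by (intro tsetI) auto
          then show ?thesis using A2(2) by auto
        qed
        then have gg: "g' x = g x" by (simp add: g'_def)
        have "(\<lambda>n. conv (\<rho> (r n)) g' x - g' x) \<longlonglongrightarrow> 0" using x True by (simp add: D_def)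
        then have "(\<lambda>n. conv (\<rho> (r n)) g' x) \<longlonglongrightarrow> g x" unfolding gg by (rule LIM_zero_cancel)
        then have "(\<lambda>n. fr (conv (\<rho> (r n)) g' x)) \<longlonglongrightarrow> fr (g x)"
          using continuous_on_tendsto_compose[OF fr_continuous] by auto
        then have "(\<lambda>n. ennreal (fr (conv (\<rho> (r n)) g' x))) \<longlonglongrightarrow> ennreal (fr (g x))" by (rule tendsto_ennrealI)
        from lim_imp_Liminf[OF _ this] show ?thesis using True by simp
      qed simp
    qed
  qed
  also have "\<dots> \<le> liminf (\<lambda>n. \<integral>\<^sup>+x. ennreal (fr (conv (\<rho> (r n)) g' x)) * indicator A' x \<partial>lborel)"
    by (rule nn_integral_liminf) measurable
  also have "\<dots> \<le> limsup (\<lambda>n. \<integral>\<^sup>+x. ennreal (fr (conv (\<rho> (r n)) g' x)) * indicator A' x \<partial>lborel)"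
    by (rule Liminf_le_Limsup) simp
  also have "\<dots> \<le> F u A"
  proof (rule Limsup_bounded, rule always_eventually, rule allI)
    fix n
    obtain \<delta> where "\<delta> \<le> \<delta>0" "mollifier \<delta> (\<rho> (r n))" using \<rho>(1) by blast
    then show "(\<integral>\<^sup>+x. ennreal (fr (conv (\<rho> (r n)) g' x)) * indicator A' x \<partial>lborel) \<le> F u A"
      using F1 Feq by metis
  qed
  finally show "(\<integral>\<^sup>+x\<in>A'. ennreal (fr (g x)) \<partial>lborel) \<le> F u A" .
qed

text \<open>The inequalities of \<open>core\<close> lose part of the domain. Applied to an
  increasing exhaustion \<open>Q n\<close> of \<open>A\<close> they lose nothing in the limit,
  because both sides are measures and continuous from below.\<close>

lemma representation_hg:
  assumes u: "Lqloc p u" and A: "A \<in> bounded_opens" and g: "hg A u g"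
  shows "F u A = (\<integral>\<^sup>+x\<in>A. ennreal (fr (g x)) \<partial>lborel)"
proof -
  have Ao: "open A" using A by (simp add: bounded_opens_def)
  obtain C where C: "\<And>n. compact (C n)" "\<And>n. C n \<subseteq> A" "\<And>n. C n \<subseteq> interior (C (Suc n))" "\<Union>(range C) = A"
    using open_Union_compact_subsets[OF Ao] by metis
  define Q where "Q = (\<lambda>n. interior (C n))"
  have Qo: "open (Q n)" for n by (simp add: Q_def)
  have QC: "closure (Q n) \<subseteq> C n" for n
    unfolding Q_def by (rule closure_minimal[OF interior_subset compact_imp_closed[OF C(1)]])
  have Qc: "compact (closure (Q n))" for n by (rule closed_subset_compact[OF C(1) closed_closure QC])
  have QA: "closure (Q n) \<subseteq> A" for n using QC C(2) by blast
  have Qb: "Q n \<in> bounded_opens" for n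
    using Qo bounded_subset[OF compact_imp_bounded[OF Qc] closure_subset] by (simp add: bounded_opens_def)
  have "Q n \<subseteq> Q (Suc n)" for n unfolding Q_def using C(3)[of n] interior_subset by blast
  then have Qi: "incseq Q" by (rule incseq_SucI)
  have QU: "(\<Union>n. Q n) = A"
  proof
    show "(\<Union>n. Q n) \<subseteq> A" using C(2) interior_subset by (fastforce simp: Q_def)
    show "A \<subseteq> (\<Union>n. Q n)" using C(3,4) by (fastforce simp: Q_def)
  qed
  have sup: "emeasure N A = (SUP n. emeasure N (Q n))" if "sets N = sets borel" for N
  proof -
    have "range Q \<subseteq> sets N" using that Qo by auto
    from SUP_emeasure_incseq[OF this Qi] show ?thesis by (simp add: QU)
  qed
  obtain \<mu> where \<mu>: "sets \<mu> = sets borel" "\<And>A. A \<in> bounded_opens \<Longrightarrow> F u A = emeasure \<mu> A"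
    using functional_measure[OF u] by metis
  have gl: "Lloc1 A (\<lambda>x. g x $ j)" for j using g by (simp add: hg_def wd_def)
  have [measurable]: "g \<in> borel_measurable borel" by (rule Lint_1_vec_finite(1)[OF gl])
  have [measurable]: "fr \<in> borel_measurable borel" by (intro borel_measurable_continuous_onI fr_continuous)
  define \<nu> where "\<nu> = density lborel (\<lambda>x. ennreal (fr (g x)))"
  have \<nu>: "emeasure \<nu> W = (\<integral>\<^sup>+x\<in>W. ennreal (fr (g x)) \<partial>lborel)" if "open W" for W
    using that unfolding \<nu>_def by (subst emeasure_density) auto
  note c = core[OF u A g Qo Qc QA]
  have "F u A \<le> (\<integral>\<^sup>+x\<in>A. ennreal (fr (g x)) \<partial>lborel)"
    unfolding \<mu>(2)[OF A] sup[OF \<mu>(1)] using c(2) \<mu>(2)[OF Qb] by (intro SUP_least) simp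
  moreover have "emeasure \<nu> A \<le> F u A"
    using sup[of \<nu>] c(1) \<nu>[OF Qo] by (simp add: \<nu>_def SUP_least)
  ultimately show ?thesis using \<nu>[OF Ao] by simp
qed

text \<open>Return from Borel representatives: locality exchanges \<open>u\<close> for its
  representative \<open>v\<close>, and uniqueness identifies \<open>hgrad\<close> almost everywhere
  with the Borel gradient of \<open>v\<close>.\<close>

lemma representation_sobolev:
  assumes u: "u \<in> Lp_loc p UNIV" and A: "A \<in> bounded_opens" and s: "u \<in> sobolev_loc mul X 1 A"
  shows "F u A = (\<integral>\<^sup>+x\<in>A. dens (hgrad mul X A u x) \<partial>lebesgue)"
proof -
  have Ao: "open A" using A by (simp add: bounded_opens_def)
  obtain G where G: "is_weak_hgrad mul X A u G" using sobolev_loc_weak_hgrad[OF Ao s] by blast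
  obtain v where v: "Lqloc p v" "AE x in lebesgue. u x = v x" using Lp_loc_representative[OF u] by metis
  have uvA: "AE x in lebesgue. x \<in> A \<longrightarrow> u x = v x" using v(2) by eventually_elim simp
  have ex: "\<exists>g'. (AE x in lebesgue. x \<in> A \<longrightarrow> G x $ j = g' x) \<and> wd (left_inv_field mul (X j)) A v g'" for j
  proof -
    have w: "weak_derivative (left_inv_field mul (X j)) A u (\<lambda>x. G x $ j)" using G by (simp add: is_weak_hgrad_def)
    show ?thesis
    proof (rule weak_derivative_representative[OF smooth_left_inv_field Ao w])
      fix g' assume "AE x in lebesgue. x \<in> A \<longrightarrow> G x $ j = g' x"
        "\<And>u'. u' \<in> borel_measurable borel \<Longrightarrow> AE x in lebesgue. x \<in> A \<longrightarrow> u x = u' x \<Longrightarrow> wd (left_inv_field mul (X j)) A u' g'"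
      then show ?thesis using uvA Lqloc_measurable[OF v(1)] by (intro exI[of _ g'] conjI)
    qed
  qed
  have "\<exists>g'. \<forall>j. (AE x in lebesgue. x \<in> A \<longrightarrow> G x $ j = g' j x) \<and> wd (left_inv_field mul (X j)) A v (g' j)"
    by (rule choice) (rule allI, rule ex)
  then obtain g' where "\<forall>j. (AE x in lebesgue. x \<in> A \<longrightarrow> G x $ j = g' j x) \<and> wd (left_inv_field mul (X j)) A v (g' j)" ..
  then have g': "AE x in lebesgue. x \<in> A \<longrightarrow> G x $ j = g' j x" "wd (left_inv_field mul (X j)) A v (g' j)" for j
    by blast+
  define g where "g = (\<lambda>x. \<chi> j. g' j x)"
  have "AE x in lebesgue. \<forall>j. x \<in> A \<longrightarrow> G x $ j = g' j x"
    by (subst AE_all_countable) (rule allI, rule g'(1))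
  with hgrad_eq[OF Ao G] have ae: "AE x in lebesgue. x \<in> A \<longrightarrow> hgrad mul X A u x = g x"
    by eventually_elim (simp add: g_def vec_eq_iff)
  have "hg A v g" using g'(2) by (simp add: hg_def g_def)
  then have "F v A = (\<integral>\<^sup>+x\<in>A. ennreal (fr (g x)) \<partial>lborel)" by (rule representation_hg[OF v(1) A])
  moreover have "F u A = F v A"
    using locality A u Lqloc_imp_Lp_loc[OF v(1)] uvA unfolding local_functional_def by blast
  moreover have "(\<integral>\<^sup>+x\<in>A. dens (hgrad mul X A u x) \<partial>lebesgue) = (\<integral>\<^sup>+x\<in>A. dens (g x) \<partial>lborel)"
    by (rule nn_integral_lebesgue_AE[OF ae])
  ultimately show ?thesis by (simp add: dens_fr)
qed

end

theorem theorem1p1: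
  fixes mul :: "real^'n \<Rightarrow> real^'n \<Rightarrow> real^'n" and minv :: "real^'n \<Rightarrow> real^'n"
    and V :: "nat \<Rightarrow> (real^'n) set" and k :: nat
    and X :: "'m::finite \<Rightarrow> real^'n"
    and p a b :: real
    and F :: "(real^'n \<Rightarrow> real) \<Rightarrow> (real^'n) set \<Rightarrow> ennreal"
  assumes "carnot_group mul minv V k"
    and "is_basis_of X (V 1)"
    and "1 \<le> p"
    and "increasing_functional p F"
    and "local_functional p F" and "left_invariant_functional mul minv p F"
    and "measure_functional p F"
    and "convex_functional p F" and "lsc_functional p F"
    and "\<And>u A c. u \<in> Lp_loc p UNIV \<Longrightarrow> A \<in> bounded_opens \<Longrightarrow> F (\<lambda>x. u x + c) A = F u A"
    and "0 < a" and "0 < b"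
    and "\<And>u A. u \<in> Lp_loc p UNIV \<Longrightarrow> A \<in> bounded_opens \<Longrightarrow> u \<in> sobolev_loc mul X 1 A \<Longrightarrow>
           F u A \<le> (\<integral>\<^sup>+x\<in>A. ennreal (a + b * norm (hgrad mul X A u x) powr p) \<partial>lebesgue)"
  shows "\<exists>f :: real^'m \<Rightarrow> ennreal. convex_ennreal f \<and>
           (\<forall>u\<in>Lp_loc p UNIV. \<forall>A\<in>bounded_opens. u \<in> sobolev_loc mul X 1 A \<longrightarrow>
              F u A = (\<integral>\<^sup>+x\<in>A. f (hgrad mul X A u x) \<partial>lebesgue)) \<and>
           (\<forall>\<eta>. f \<eta> \<le> ennreal (a + b * norm \<eta> powr p))"
proof -
  interpret invariant_functional mul minv V k X p a b F
    by (intro invariant_functional.intro invariant_functional_axioms.intro) (use assms in auto)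
  show ?thesis
    using dens_convex representation_sobolev dens_le by blast
qed

end
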